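(* There exists an absolute constant $\beta>0$ such that for every integer $r\geq 2$ and every integer $n\geq 3$ we have $W(n,r)\geq \beta\, r^{n-1}$.
   Context: The Van der Waerden number $W(n,r)$ is the minimum $N$ such that in every coloring of $\{1,\dots,N\}$ with $r$ colors there exists a monochromatic arithmetic progression of length $n$. *)

theory Defs
  imports Complex_Main "HOL-Library.FuncSet"
begin

definition arith_prog :: "nat \<Rightarrow> nat set \<Rightarrow> bool" where
  "arith_prog n A \<longleftrightarrow> (\<exists>a d. d > 0 \<and> A = (\<lambda>i. a + i * d) ` {..<n})"

definition vdW_property :: "nat \<Rightarrow> nat \<Rightarrow> nat \<Rightarrow> bool" where
  "vdW_property n r N \<longleftrightarrow>
     (\<forall>c \<in> {1..N} \<rightarrow> {..<r}. \<exists>A \<subseteq> {1..N}. arith_prog n A \<and> (\<exists>k. \<forall>x\<in>A. c x = k))"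

(* By van der Waerden's theorem some N has the property for all n and r, so the minimum exists;
   the theorem is not built into the definition. *)
definition vdW_number :: "nat \<Rightarrow> nat \<Rightarrow> nat" where
  "vdW_number n r = (LEAST N. vdW_property n r N)"

end

theory Submission
  imports Defs "HOL-Real_Asymp.Real_Asymp"
begin

text \<open>
  For bounded n the local lemma applied to a uniformly random colouring suffices. For large n a
  random colouring is corrected. Every vertex carries a random colour below r and a random label
  below n. In each of R rounds, with R of order ln n, every progression that is currently
  monochromatic recolours, to the next colour mod r, its unflipped vertices of least label,
  provided that this label is below R. No vertex is recoloured twice.

  If a progression f is monochromatic at the end, every flipped vertex v is explained by a
  progression through v that was monochromatic when v was flipped. Following the explanations from
  f yields a connected family of m progressions. If this family is a hypertree, its colours cost r
  to the power -m(n - 1), and the requirement that the vertex explained by a progression has the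
  least label in it costs O(1/n) for each member other than f. A given vertex lies in at most
  (O(n) N)^m / n such families, so the expected number is summable when N is a small multiple of
  r^(n - 1). The remaining polynomial factor in n is gained because either f has no unflipped
  vertex of label below R, or the explanations reach back through all R rounds and m exceeds R. If
  the family is not a hypertree, a shortest closed chain in it has length O(ln n), and closing the
  chain leaves only polynomially many choices for one of its members, an exponential gain. The
  local lemma avoids all these events at once.
\<close>

section \<open>Van der Waerden's theorem\<close>

text \<open>The uniformly random colouring alone leaves a bound of order r^(n-1)/n, see
  \<open>small_n\<close>; the whole difficulty is the factor n. Labels take n values so that being
  least in a progression has probability about 1/n, which pays for the n choices of the vertex at
  which the next progression is attached. Cutting the labels off at R keeps most vertices fixed: a
  vertex has at most n + R entries that can show a given colour, instead of 2n, and (1 + R/n)^n is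
  still polynomial in n. Recolouring at most once, and only to the next colour mod r, makes the
  colours along a chain of explanations move by one step at a time, so that a chain of L
  progressions has at most r * 2^(L - 1) colour patterns instead of r^L. With R of order ln n both
  e^(-R) and 2^(-R) are negative powers of n, while chains of length O(R) cost only exp(O((ln
  n)^2)), far less than the 2^(n/4) gained by closing them.\<close>

definition vdW_bound :: "nat \<Rightarrow> nat \<Rightarrow> nat \<Rightarrow> bool" where
  "vdW_bound l r N \<longleftrightarrow> (\<forall>c::nat \<Rightarrow> nat. (\<forall>x. c x < r) \<longrightarrow>
     (\<exists>a d. d > 0 \<and> a + l * d < N \<and> (\<forall>i<l. c (a + i * d) = c a)))"

text \<open>Colour focusing: \<open>f\<close> is the next term after a run of l terms in each colour
  of \<open>K\<close>, so giving \<open>f\<close> any of these colours extends a run. Colours are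
  collected rather than progressions, so \<open>card K\<close> counts distinct colours.\<close>

definition focused :: "nat \<Rightarrow> (nat \<Rightarrow> nat) \<Rightarrow> nat \<Rightarrow> nat \<Rightarrow> nat set \<Rightarrow> bool" where
  "focused l c N f K \<longleftrightarrow> f < N \<and>
     (\<forall>k\<in>K. \<exists>a d. d > 0 \<and> a + l * d = f \<and> (\<forall>i<l. c (a + i * d) = k))"

text \<open>The factor 2 makes room for one more term after a progression that ends in a focus f <
  N: its difference is at most f, so this term is still below 2N.\<close>

definition focus_bound :: "nat \<Rightarrow> nat \<Rightarrow> nat \<Rightarrow> nat \<Rightarrow> bool" where
  "focus_bound l r s N \<longleftrightarrow> (\<forall>c::nat \<Rightarrow> nat. (\<forall>x. c x < r) \<longrightarrow>
     (\<exists>a d. d > 0 \<and> a + Suc l * d < 2 * N \<and> (\<forall>i<Suc l. c (a + i * d) = c a)) \<or>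
     (\<exists>f K. card K = s \<and> focused l c N f K))"

lemma focus_arith:
  fixes p q w W M :: nat
  assumes "p \<le> w" "q < 2 * M"
  shows "p + q < 2 * (2 * (w + W + M + 1))"
proof -
  have "p + q < w + 2 * M" using assms by (rule add_le_less_mono)
  also have "\<dots> \<le> 2 * (2 * (w + W + M + 1))" by simp
  finally show ?thesis .
qed

text \<open>Intervals of length M act as single points with r^M colours. Among l equally spaced
  identical intervals, the first contains a progression or s focused runs. In the second case the
  focus moves to the interval that follows: adding the spacing to the differences of the old runs
  keeps them focused, and the copies of the old focus form a run of one more colour.\<close>

lemma focus_step:
  assumes l: "l \<ge> 1" and P: "\<And>r. \<exists>N. vdW_bound l r N" and IH: "focus_bound l r s M"
  shows "\<exists>N. focus_bound l r (Suc s) N"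
proof -
  define R where "R = card ({..<M} \<rightarrow>\<^sub>E {..<r})"
  have fin: "finite ({..<M} \<rightarrow>\<^sub>E {..<r})" by (intro finite_PiE) auto
  obtain h where h: "bij_betw h ({..<M} \<rightarrow>\<^sub>E {..<r}) {..<R}"
    using ex_bij_betw_finite_nat[OF fin] unfolding R_def atLeast0LessThan by auto
  obtain W where W: "vdW_bound l R W" using P by blast
  define N where "N = W * M + W + M + 1"
  have key: "p + q < 2 * (2 * N)" if "p \<le> W * M" "q < 2 * M" for p q
    using focus_arith[OF that] unfolding N_def .
  have "focus_bound l r (Suc s) (2 * N)"
    unfolding focus_bound_def
  proof (intro allI impI)
    fix c :: "nat \<Rightarrow> nat" assume c: "\<forall>x. c x < r"
    define C where "C x = h (\<lambda>y\<in>{..<M}. c (x * M + y))" for x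
    have mem: "(\<lambda>y\<in>{..<M}. c (x * M + y)) \<in> {..<M} \<rightarrow>\<^sub>E {..<r}" for x using c by auto
    have "\<forall>x. C x < R" unfolding C_def using mem h by (metis bij_betwE lessThan_iff)
    then obtain b D where D: "D > 0" "b + l * D < W" and CD: "\<forall>i<l. C (b + i * D) = C b"
      using W unfolding vdW_bound_def by blast
    have same: "c ((b + i * D) * M + y) = c (b * M + y)" if "i < l" "y < M" for i y
    proof -
      have "C (b + i * D) = C b" using CD that by blast
      then have "(\<lambda>y\<in>{..<M}. c ((b + i * D) * M + y)) = (\<lambda>y\<in>{..<M}. c (b * M + y))"
        unfolding C_def using h mem unfolding bij_betw_def inj_on_def by blast
      from fun_cong[OF this, of y] show ?thesis using that by simp
    qed
    define c' where "c' x = c (b * M + x)" for x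
    have "\<forall>x. c' x < r" using c unfolding c'_def by auto
    then consider
      (ap) a d where "d > 0" "a + Suc l * d < 2 * M" "\<forall>i<Suc l. c' (a + i * d) = c' a" |
      (foc) f K where "card K = s" "focused l c' M f K"
      using IH unfolding focus_bound_def by blast
    then show "(\<exists>a d. d > 0 \<and> a + Suc l * d < 2 * (2 * N) \<and> (\<forall>i<Suc l. c (a + i * d) = c a)) \<or>
     (\<exists>f K. card K = Suc s \<and> focused l c (2 * N) f K)"
    proof cases
      case ap
      have "b * M \<le> W * M" using D by (intro mult_right_mono) auto
      then have "b * M + a + Suc l * d < 2 * (2 * N)"
        using key[of "b * M" "a + Suc l * d"] ap(2) by (simp only: add.assoc)
      moreover have "\<forall>i<Suc l. c (b * M + a + i * d) = c (b * M + a)"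
        using ap(3) unfolding c'_def by (simp add: add.assoc)
      ultimately show ?thesis using ap(1) by blast
    next
      case foc
      have fM: "f < M" using foc unfolding focused_def by auto
      have Mpos: "M > 0" using fM by auto
      \<comment> \<open>The interval after the l identical ones may be coloured in any way; only the
        position of the focus in it is used.\<close>
      define F where "F = (b + l * D) * M + f"
      have "(b + l * D) * M \<le> W * M" using D by (intro mult_right_mono) auto
      then have FN: "F < N" using fM unfolding F_def N_def by linarith
      show ?thesis
      \<comment> \<open>Either the old focus has one of the focused colours and completes l + 1
        terms inside one interval, or its colour is new.\<close>
      proof (cases "c (b * M + f) \<in> K")
        case True
        then obtain a d where ad: "d > 0" "a + l * d = f" "\<forall>i<l. c' (a + i * d) = c (b * M + f)"
          using foc unfolding focused_def by blast
        have all: "c (b * M + a + i * d) = c (b * M + f)" if "i < Suc l" for i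
          using ad that unfolding c'_def by (cases "i = l") (auto simp: add.assoc)
        have const: "\<forall>i<Suc l. c (b * M + a + i * d) = c (b * M + a)" using all all[of 0] by simp
        have ld: "d \<le> l * d" using mult_le_mono1[OF l, of d] by (simp only: mult_1)
        have "a + Suc l * d = f + d" using ad(2) by simp
        moreover have "d \<le> f" using ld ad(2) by linarith
        ultimately have small: "a + Suc l * d < 2 * M" using fM by linarith
        have "b * M \<le> W * M" using D by (intro mult_right_mono) auto
        then have "b * M + a + Suc l * d < 2 * (2 * N)"
          using key[of "b * M" "a + Suc l * d"] small by (simp only: add.assoc)
        then show ?thesis using ad(1) const by blast
      next
        case False
        have finK: "finite K"
        proof -
          have "K \<subseteq> {..<r}"
          proof
            fix k assume "k \<in> K"
            then obtain a d where "\<forall>i<l. c' (a + i * d) = k" using foc unfolding focused_def by blast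
            then have "c' (a + 0 * d) = k" using l by (metis less_eq_Suc_le One_nat_def)
            then show "k \<in> {..<r}" using c unfolding c'_def by auto
          qed
          then show ?thesis by (rule finite_subset) auto
        qed
        have "focused l c (2 * N) F (insert (c (b * M + f)) K)"
          unfolding focused_def
        proof (intro conjI ballI)
          show "F < 2 * N" using FN by simp
          fix k assume "k \<in> insert (c (b * M + f)) K"
          then show "\<exists>a d. d > 0 \<and> a + l * d = F \<and> (\<forall>i<l. c (a + i * d) = k)"
          proof
            assume k: "k = c (b * M + f)"
            have "c (b * M + f + i * (D * M)) = k" if "i < l" for i
              using same[OF that fM] k by (simp add: algebra_simps)
            moreover have "b * M + f + l * (D * M) = F" unfolding F_def by (simp add: algebra_simps)
            moreover have "D * M > 0" using D Mpos by simp
            ultimately show ?thesis by blast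
          next
            assume "k \<in> K"
            then obtain a d where ad: "d > 0" "a + l * d = f" "\<forall>i<l. c' (a + i * d) = k"
              using foc unfolding focused_def by blast
            have "c (b * M + a + i * (d + D * M)) = k" if "i < l" for i
            proof -
              have "i * d \<le> l * d" using that by (intro mult_right_mono) auto
              then have "a + i * d < M" using ad fM by linarith
              then have "c ((b + i * D) * M + (a + i * d)) = c' (a + i * d)"
                using same[OF that] unfolding c'_def by blast
              moreover have "c' (a + i * d) = k" using ad(3) that by blast
              moreover have "(b + i * D) * M + (a + i * d) = b * M + a + i * (d + D * M)"
                by (simp add: algebra_simps)
              ultimately show ?thesis by simp
            qed
            moreover have "b * M + a + l * (d + D * M) = F"
              unfolding F_def ad(2)[symmetric] by (simp add: algebra_simps)
            moreover have "d + D * M > 0" using ad by simp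
            ultimately show ?thesis by blast
          qed
        qed
        moreover have "card (insert (c (b * M + f)) K) = Suc s" using finK False foc(1) by simp
        ultimately show ?thesis by blast
      qed
    qed
  qed
  then show ?thesis by blast
qed

text \<open>The number of colours stays arbitrary in the induction on l, because
  \<open>focus_step\<close> applies the shorter length with r^M colours. Asking for r + 1 focused
  colours leaves the progression as the only alternative.\<close>

lemma vdW_bound_exists: "l \<ge> 1 \<Longrightarrow> \<exists>N. vdW_bound l r N"
proof (induction l arbitrary: r rule: nat_induct_at_least)
  case base
  have "vdW_bound 1 r 2" unfolding vdW_bound_def
  proof (intro allI impI)
    fix c :: "nat \<Rightarrow> nat"
    show "\<exists>a d. d > 0 \<and> a + 1 * d < 2 \<and> (\<forall>i<1. c (a + i * d) = c a)"
      by (rule exI[of _ 0], rule exI[of _ 1]) auto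
  qed
  then show ?case by blast
next
  case (Suc l)
  have "\<exists>N. focus_bound l r s N" for s
  proof (induction s)
    case 0
    have "focus_bound l r 0 1" unfolding focus_bound_def focused_def
      by (auto intro!: exI[of _ "{}"])
    then show ?case by blast
  next
    case (Suc s)
    then show ?case using focus_step[OF Suc.hyps(1) \<open>\<And>r. \<exists>N. vdW_bound l r N\<close>] by blast
  qed
  then obtain N where N: "focus_bound l r (Suc r) N" by blast
  have "vdW_bound (Suc l) r (2 * N)" unfolding vdW_bound_def
  proof (intro allI impI)
    fix c :: "nat \<Rightarrow> nat" assume c: "\<forall>x. c x < r"
    have False if f: "card K = Suc r" "focused l c N f K" for f K
    proof -
      have "K \<subseteq> {..<r}"
      proof
        fix k assume "k \<in> K"
        then obtain a d where "\<forall>i<l. c (a + i * d) = k" using f unfolding focused_def by blast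
        then have "c (a + 0 * d) = k" using Suc.hyps by (metis less_eq_Suc_le One_nat_def)
        then show "k \<in> {..<r}" using c by auto
      qed
      then have "card K \<le> r" using card_mono[of "{..<r}" K] by simp
      then show False using f by simp
    qed
    then show "\<exists>a d. d > 0 \<and> a + Suc l * d < 2 * N \<and> (\<forall>i<Suc l. c (a + i * d) = c a)"
      using N c unfolding focus_bound_def by blast
  qed
  then show ?case by blast
qed

text \<open>Needed since the LEAST in vdW_number is unspecified on an empty predicate.\<close>

lemma vdW_property_exists:
  assumes "n \<ge> 1"
  shows "\<exists>N. vdW_property n r N"
proof (cases "r = 0")
  case True
  \<comment> \<open>Without colours a nonempty interval has no colouring, so the property is
    vacuous.\<close>
  then have "vdW_property n r 1" unfolding vdW_property_def by auto
  then show ?thesis by blast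
next
  case False
  obtain N where N: "vdW_bound n r N" using vdW_bound_exists[OF assms] by blast
  have "vdW_property n r N" unfolding vdW_property_def
  proof
    fix c :: "nat \<Rightarrow> nat" assume c: "c \<in> {1..N} \<rightarrow> {..<r}"
    define c' where "c' x = (if Suc x \<in> {1..N} then c (Suc x) else 0)" for x
    have "\<forall>x. c' x < r" using c False unfolding c'_def by auto
    then obtain a d where ad: "d > 0" "a + n * d < N" "\<forall>i<n. c' (a + i * d) = c' a"
      using N unfolding vdW_bound_def by blast
    have le: "a + i * d < N" if "i < n" for i
    proof -
      have "i * d \<le> n * d" using that by (intro mult_right_mono) auto
      then show ?thesis using ad by linarith
    qed
    have "c (Suc a + i * d) = c' a" if "i < n" for i
      using ad(3) le[OF that] that unfolding c'_def by auto
    then have "\<forall>x\<in>(\<lambda>i. Suc a + i * d) ` {..<n}. c x = c' a" by auto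
    moreover have "(\<lambda>i. Suc a + i * d) ` {..<n} \<subseteq> {1..N}" using le by (auto simp: Suc_le_eq)
    moreover have "arith_prog n ((\<lambda>i. Suc a + i * d) ` {..<n})" unfolding arith_prog_def using ad by blast
    ultimately show "\<exists>A\<subseteq>{1..N}. arith_prog n A \<and> (\<exists>k. \<forall>x\<in>A. c x = k)" by blast
  qed
  then show ?thesis by blast
qed

section \<open>The local lemma for boxes\<close>

text \<open>Resetting the value at u is a bijection between the slices \<open>w u = q\<close>, so on
  a set closed under changes at u the coordinate u is uniform.\<close>

lemma card_coordinate:
  fixes W :: "('a \<Rightarrow> 'b) set"
  assumes fin: "finite W" "finite Q" and u: "\<And>w. w \<in> W \<Longrightarrow> w u \<in> Q"
    and inv: "\<And>w q. w \<in> W \<Longrightarrow> q \<in> Q \<Longrightarrow> w(u := q) \<in> W" and A: "A \<subseteq> Q"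
  shows "card {w \<in> W. w u \<in> A} * card Q = card A * card W"
proof (cases "Q = {}")
  case True
  then show ?thesis using u A by auto
next
  case False
  then obtain q0 where q0: "q0 \<in> Q" by auto
  define m where "m = card {w \<in> W. w u = q0}"
  have eq: "card {w \<in> W. w u = q} = m" if "q \<in> Q" for q
  proof -
    have "bij_betw (\<lambda>w. w(u := q0)) {w \<in> W. w u = q} {w \<in> W. w u = q0}"
      by (rule bij_betw_byWitness[where f' = "\<lambda>w. w(u := q)"]) (use inv q0 that in auto)
    then show ?thesis unfolding m_def by (rule bij_betw_same_card)
  qed
  have count: "card {w \<in> W. w u \<in> B} = card B * m" if "B \<subseteq> Q" for B
  proof -
    have fB: "finite B" using that fin(2) finite_subset by blast
    have "{w \<in> W. w u \<in> B} = (\<Union>q\<in>B. {w \<in> W. w u = q})" by auto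
    then have "card {w \<in> W. w u \<in> B} = card (\<Union>q\<in>B. {w \<in> W. w u = q})" by simp
    also have "\<dots> = (\<Sum>q\<in>B. card {w \<in> W. w u = q})"
      by (rule card_UN_disjoint) (use fB fin in auto)
    also have "\<dots> = (\<Sum>q\<in>B. m)" by (rule sum.cong) (use eq that in auto)
    finally show ?thesis by simp
  qed
  have "{w \<in> W. w u \<in> Q} = W" using u by auto
  then have "card W = card Q * m" using count[of Q] by simp
  then show ?thesis using count[OF A] by simp
qed

lemma card_coordinates:
  fixes W :: "('a \<Rightarrow> 'b) set"
  assumes "finite U" and fin: "finite W" "finite Q" and u: "\<And>w u. w \<in> W \<Longrightarrow> u \<in> U \<Longrightarrow> w u \<in> Q"
    and inv: "\<And>w u q. w \<in> W \<Longrightarrow> u \<in> U \<Longrightarrow> q \<in> Q \<Longrightarrow> w(u := q) \<in> W"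
    and A: "\<And>u. u \<in> U \<Longrightarrow> A u \<subseteq> Q"
  shows "card {w \<in> W. \<forall>u\<in>U. w u \<in> A u} * card Q ^ card U = (\<Prod>u\<in>U. card (A u)) * card W"
  using \<open>finite U\<close> u inv A
proof (induction U)
  case empty
  then show ?case by simp
next
  case (insert x U)
  let ?W = "{w \<in> W. \<forall>u\<in>U. w u \<in> A u}"
  have IH: "card ?W * card Q ^ card U = (\<Prod>u\<in>U. card (A u)) * card W"
    using insert by simp
  have "card {w \<in> ?W. w x \<in> A x} * card Q = card (A x) * card ?W"
  proof (rule card_coordinate)
    fix w q assume w: "w \<in> ?W" "q \<in> Q"
    then have "w(x := q) \<in> W" using insert.prems by blast
    moreover have "(w(x := q)) u \<in> A u" if "u \<in> U" for u
      using w that \<open>x \<notin> U\<close> by (cases "u = x") auto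
    ultimately show "w(x := q) \<in> ?W" by blast
  qed (use insert fin in auto)
  moreover have "{w \<in> W. \<forall>u\<in>insert x U. w u \<in> A u} = {w \<in> ?W. w x \<in> A x}" by auto
  ultimately have "card {w \<in> W. \<forall>u\<in>insert x U. w u \<in> A u} * card Q = card (A x) * card ?W" by simp
  then have "card {w \<in> W. \<forall>u\<in>insert x U. w u \<in> A u} * card Q * card Q ^ card U
      = card (A x) * (card ?W * card Q ^ card U)" by simp
  then show ?case using insert(1,2) IH by (simp add: mult.assoc)
qed

text \<open>An event that restricts each variable of a set separately. All exceptional events are
  covered by boxes, whose probabilities are plain products.\<close>

type_synonym ('a, 'b) box = "'a set \<times> ('a \<Rightarrow> 'b set)"

definition hits :: "('a \<Rightarrow> 'b) \<Rightarrow> ('a, 'b) box \<Rightarrow> bool" where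
  "hits w b \<longleftrightarrow> (\<forall>u\<in>fst b. w u \<in> snd b u)"

text \<open>With \<open>s = card Q * (1 - t)\<close> this is the probability of the box, divided by
  1 - t once for each of its variables.\<close>

definition wt :: "real \<Rightarrow> ('a, 'b) box \<Rightarrow> real" where
  "wt s b = (\<Prod>u\<in>fst b. real (card (snd b u)) / s)"

definition mass :: "real \<Rightarrow> 'a \<Rightarrow> ('a, 'b) box set \<Rightarrow> real" where
  "mass s x B = (\<Sum>b\<in>{b\<in>B. x \<in> fst b}. wt s b)"

lemma wt_nonneg: "s \<ge> 0 \<Longrightarrow> wt s b \<ge> 0"
  unfolding wt_def by (intro prod_nonneg) auto

text \<open>The condition sums over the boxes through one variable, so boxes of very different sizes
  enter together and no dependency graph is needed. It is applied with t = 1/n, where a box on n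
  variables is charged only a bounded factor for the powers of 1 - t.\<close>

theorem local_lemma:
  fixes V :: "'a set" and Q :: "'b set" and B :: "('a, 'b) box set" and t :: real
  assumes finV: "finite V" and finQ: "finite Q" and Q: "Q \<noteq> {}" and finB: "finite B"
    and t: "0 \<le> t" "t < 1"
    and B: "\<And>b. b \<in> B \<Longrightarrow> fst b \<subseteq> V \<and> fst b \<noteq> {} \<and> (\<forall>u\<in>fst b. snd b u \<subseteq> Q)"
    and mass: "\<And>x. x \<in> V \<Longrightarrow> mass (card Q * (1 - t)) x B \<le> t"
  shows "\<exists>w \<in> V \<rightarrow>\<^sub>E Q. \<forall>b\<in>B. \<not> hits w b"
proof -
  define \<Omega> where "\<Omega> = V \<rightarrow>\<^sub>E Q"
  have fin\<Omega>: "finite \<Omega>" unfolding \<Omega>_def using finV finQ by (simp add: finite_PiE)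
  define av where "av J = {w \<in> \<Omega>. \<forall>b\<in>J. \<not> hits w b}" for J :: "('a, 'b) box set"
  define g where "g J = real (card (av J))" for J
  define s where "s = card Q * (1 - t)"
  have Qpos: "real (card Q) > 0" using Q finQ by (simp add: card_gt_0_iff)
  have spos: "s > 0" unfolding s_def using Qpos t by simp
  have g0: "g J \<ge> 0" for J unfolding g_def by simp
  have av_sub: "finite (av J)" for J unfolding av_def using fin\<Omega> by simp
  \<comment> \<open>Avoiding boxes disjoint from b puts no condition on the variables of b, so these
    remain uniform and independent.\<close>
  have indep: "real (card {w \<in> av J. hits w b}) = (\<Prod>u\<in>fst b. real (card (snd b u)) / card Q) * g J"
    if b: "b \<in> B" and J: "J \<subseteq> B" "\<And>j. j \<in> J \<Longrightarrow> fst j \<inter> fst b = {}" for b J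
  proof -
    have fb: "finite (fst b)" using B[OF b] finV finite_subset by blast
    have upd: "w(u := q) \<in> av J" if "w \<in> av J" "u \<in> fst b" "q \<in> Q" for w u q
    proof -
      have "u \<in> V" using B[OF b] that by auto
      then have "w(u := q) \<in> \<Omega>" using that unfolding av_def \<Omega>_def
        by (auto simp: PiE_iff extensional_def)
      moreover have "hits (w(u := q)) j = hits w j" if "j \<in> J" for j
      proof -
        have "u \<notin> fst j" using J(2)[OF that] \<open>u \<in> fst b\<close> by auto
        then show ?thesis unfolding hits_def by auto
      qed
      ultimately show ?thesis using that unfolding av_def by auto
    qed
    have "card {w \<in> av J. \<forall>u\<in>fst b. w u \<in> snd b u} * card Q ^ card (fst b)
        = (\<Prod>u\<in>fst b. card (snd b u)) * card (av J)"
    proof (rule card_coordinates[OF fb av_sub finQ _ upd])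
      fix w u assume "w \<in> av J" "u \<in> fst b"
      moreover from this have "u \<in> V" using B[OF b] by blast
      ultimately show "w u \<in> Q" unfolding av_def \<Omega>_def by auto
    qed (use B[OF b] in blast)+
    then have "real (card {w \<in> av J. hits w b}) * real (card Q) ^ card (fst b)
        = (\<Prod>u\<in>fst b. real (card (snd b u))) * g J"
      unfolding hits_def g_def by (simp flip: of_nat_mult of_nat_power of_nat_prod)
    then show ?thesis using Qpos by (simp add: prod_dividef field_simps)
  qed
  define away where "away J A = {j\<in>J. fst j \<inter> A = {}}" for J :: "('a, 'b) box set" and A
  have drop_away: "g (away K A) * (1 - t) ^ card A \<le> g K"
    if "finite A" "A \<subseteq> V" "\<And>L x. L \<subseteq> K \<Longrightarrow> x \<in> V \<Longrightarrow> (1 - t) * g (away L {x}) \<le> g L" for A K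
    using that
  proof (induction A)
    case empty
    then show ?case by (simp add: away_def)
  next
    case (insert a A)
    have "away K A \<subseteq> K" unfolding away_def by auto
    then have "(1 - t) * g (away (away K A) {a}) \<le> g (away K A)" using insert.prems by blast
    moreover have "away (away K A) {a} = away K (insert a A)" unfolding away_def by auto
    ultimately have "(1 - t) * g (away K (insert a A)) \<le> g (away K A)" by simp
    then have "(1 - t) * g (away K (insert a A)) * (1 - t) ^ card A \<le> g (away K A) * (1 - t) ^ card A"
      using t by (intro mult_right_mono) auto
    also have "\<dots> \<le> g K" using insert by auto
    finally show ?case using insert.hyps by (simp add: mult_ac)
  qed
  txt \<open>Imposing the boxes through one more variable keeps at least the proportion 1 - t of the avoiding
    assignments. Freeing all variables of a box b therefore loses at most (1 - t) to the power
    card (fst b), which the weight of b already contains.\<close>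
  have claim: "\<forall>x\<in>V. g J \<ge> (1 - t) * g (away J {x})" if "J \<subseteq> B" for J
    using finite_subset[OF that finB] that
  proof (induction J rule: finite_psubset_induct)
    case (psubset J)
    show ?case
    proof
      fix x assume x: "x \<in> V"
      define J' where "J' = away J {x}"
      have J'J: "J' \<subseteq> J" unfolding J'_def away_def by auto
      show "g J \<ge> (1 - t) * g (away J {x})"
      proof (cases "J' = J")
        case True
        then show ?thesis using g0[of J] t unfolding J'_def
          by (simp add: mult_left_le_one_le)
      next
        case False
        then have J'ss: "J' \<subset> J" using J'J by auto
        have multi: "g (away J' A) * (1 - t) ^ card A \<le> g J'" if "finite A" "A \<subseteq> V" for A
        proof (rule drop_away[OF that])
          fix L x assume "L \<subseteq> J'" "x \<in> V"
          moreover from this have "L \<subset> J" "L \<subseteq> B" using J'ss psubset.prems by auto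
          ultimately show "(1 - t) * g (away L {x}) \<le> g L" using psubset.IH by blast
        qed
        have one: "real (card {w \<in> av J'. hits w b}) \<le> wt s b * g J'" if b: "b \<in> J - J'" for b
        proof -
          have bB: "b \<in> B" using b psubset.prems by auto
          have fb: "finite (fst b)" using B[OF bB] finV finite_subset by blast
          let ?J = "away J' (fst b)"
          have "{w \<in> av J'. hits w b} \<subseteq> {w \<in> av ?J. hits w b}" unfolding av_def away_def by auto
          then have "card {w \<in> av J'. hits w b} \<le> card {w \<in> av ?J. hits w b}"
            by (intro card_mono) (use av_sub in auto)
          then have "real (card {w \<in> av J'. hits w b}) \<le> real (card {w \<in> av ?J. hits w b})" by simp
          also have "\<dots> = (\<Prod>u\<in>fst b. real (card (snd b u)) / card Q) * g ?J"
            by (rule indep[OF bB]) (use psubset.prems J'J in \<open>auto simp: away_def\<close>)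
          also have "\<dots> = wt s b * (g ?J * (1 - t) ^ card (fst b))"
          proof -
            have "(\<Prod>u\<in>fst b. real (card (snd b u)) / card Q) = wt s b * (1 - t) ^ card (fst b)"
              using t unfolding wt_def s_def by (simp add: prod_dividef power_mult_distrib)
            then show ?thesis by simp
          qed
          also have "\<dots> \<le> wt s b * g J'"
            using multi[OF fb] B[OF bB] spos by (intro mult_left_mono wt_nonneg) auto
          finally show ?thesis .
        qed
        \<comment> \<open>An assignment that avoids \<open>J'\<close> but not \<open>J\<close> hits
          one of the boxes through x.\<close>
        have "av J' \<subseteq> av J \<union> (\<Union>b\<in>J - J'. {w \<in> av J'. hits w b})" unfolding av_def by auto
        then have "card (av J') \<le> card (av J \<union> (\<Union>b\<in>J - J'. {w \<in> av J'. hits w b}))"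
          by (intro card_mono) (use av_sub psubset.hyps in auto)
        also have "\<dots> \<le> card (av J) + card (\<Union>b\<in>J - J'. {w \<in> av J'. hits w b})"
          by (rule card_Un_le)
        also have "\<dots> \<le> card (av J) + (\<Sum>b\<in>J - J'. card {w \<in> av J'. hits w b})"
          using card_UN_le[of "J - J'"] psubset.hyps by auto
        finally have "g J' \<le> g J + (\<Sum>b\<in>J - J'. real (card {w \<in> av J'. hits w b}))"
          unfolding g_def by (simp flip: of_nat_add of_nat_sum)
        also have "(\<Sum>b\<in>J - J'. real (card {w \<in> av J'. hits w b})) \<le> (\<Sum>b\<in>J - J'. wt s b * g J')"
          by (rule sum_mono) (rule one)
        also have "\<dots> = (\<Sum>b\<in>J - J'. wt s b) * g J'" by (simp add: sum_distrib_right)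
        also have "(\<Sum>b\<in>J - J'. wt s b) \<le> mass s x B"
          unfolding mass_def
          by (rule sum_mono2) (use psubset.prems finB spos in \<open>auto simp: J'_def away_def intro: wt_nonneg\<close>)
        also have "mass s x B \<le> t" using mass[OF x] unfolding s_def by simp
        finally show ?thesis using g0[of J'] unfolding J'_def[symmetric]
          by (simp add: algebra_simps mult_right_mono)
      qed
    qed
  qed
  \<comment> \<open>Every box has a variable, so freeing all of \<open>V\<close> removes every
    constraint.\<close>
  have "g (away B V) * (1 - t) ^ card V \<le> g B" by (rule drop_away[OF finV]) (use claim in auto)
  moreover have "away B V = {}" unfolding away_def using B by blast
  moreover have "g {} > 0"
  proof -
    have "av {} = \<Omega>" unfolding av_def by auto
    moreover have "card \<Omega> = card Q ^ card V" unfolding \<Omega>_def by (simp add: card_PiE finV)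
    ultimately show ?thesis unfolding g_def using Qpos by simp
  qed
  ultimately have "g B > 0" using t
    by (smt (verit, best) mult_pos_pos zero_less_power)
  then have "av B \<noteq> {}" unfolding g_def by auto
  then show ?thesis unfolding av_def \<Omega>_def by auto
qed

lemma mass_mono_Un:
  assumes "finite A" "finite B" "s \<ge> 0"
  shows "mass s x (A \<union> B) \<le> mass s x A + mass s x B"
proof -
  have eq: "{b \<in> A \<union> B. x \<in> fst b} = {b\<in>A. x \<in> fst b} \<union> {b\<in>B. x \<in> fst b}" by auto
  have "0 \<le> sum (wt s) ({b\<in>A. x \<in> fst b} \<inter> {b\<in>B. x \<in> fst b})"
    by (intro sum_nonneg wt_nonneg) (use assms in auto)
  then show ?thesis unfolding mass_def eq using assms
    by (subst sum_Un) auto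
qed

lemma mass_UN:
  assumes "finite J" "\<And>j. j \<in> J \<Longrightarrow> finite (A j)" "s \<ge> 0"
  shows "mass s x (\<Union>j\<in>J. A j) \<le> (\<Sum>j\<in>J. mass s x (A j))"
  using assms
proof (induction J)
  case empty
  then show ?case by (simp add: mass_def)
next
  case (insert j J)
  have "mass s x (A j \<union> (\<Union>j\<in>J. A j)) \<le> mass s x (A j) + mass s x (\<Union>j\<in>J. A j)"
    by (rule mass_mono_Un) (use insert in auto)
  then show ?case using insert by fastforce
qed

lemma mass_image:
  assumes "finite I" "s \<ge> 0"
  shows "mass s x (f ` I) \<le> (\<Sum>i\<in>{i\<in>I. x \<in> fst (f i)}. wt s (f i))"
proof -
  have "{b \<in> f ` I. x \<in> fst b} = f ` {i\<in>I. x \<in> fst (f i)}" by auto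
  then show ?thesis unfolding mass_def
    using sum_image_le[of "{i\<in>I. x \<in> fst (f i)}" "wt s" f] assms by (simp add: wt_nonneg o_def)
qed

section \<open>Counting connected sets\<close>

text \<open>Connectedness stated through cuts: this is the form in which two clusters are compared,
  and it avoids paths.\<close>

definition linked :: "('p \<Rightarrow> 'p \<Rightarrow> bool) \<Rightarrow> 'p set \<Rightarrow> bool" where
  "linked adj P \<longleftrightarrow> (\<forall>A. A \<subset> P \<and> A \<noteq> {} \<longrightarrow> (\<exists>a\<in>A. \<exists>b\<in>P - A. adj a b))"

lemma sum_Pow_weight:
  fixes p :: real
  assumes "finite M"
  shows "(\<Sum>S\<in>Pow M. p ^ card S * (1 - p) ^ card (M - S)) = 1"
proof -
  have "1 = (\<Prod>x\<in>M. p + (1 - p))" by simp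
  also have "\<dots> = (\<Sum>S\<in>Pow M. (\<Prod>x\<in>S. p) * (\<Prod>x\<in>M - S. 1 - p))"
    by (rule prod_add[OF assms])
  finally show ?thesis by simp
qed

text \<open>When each point is open independently with probability p, this is the probability that A
  is open and B closed; the remaining points sum out to 1.\<close>

lemma sum_between_weight:
  fixes p :: real
  assumes fin: "finite N" and A: "A \<subseteq> N" and B: "B \<subseteq> N" and "A \<inter> B = {}"
  shows "(\<Sum>S\<in>{S\<in>Pow N. A \<subseteq> S \<and> S \<inter> B = {}}. p ^ card S * (1 - p) ^ card (N - S))
       = p ^ card A * (1 - p) ^ card B"
proof -
  define M where "M = N - A - B"
  have finM: "finite M" "finite A" "finite B" using fin A B by (auto simp: M_def intro: finite_subset)
  have "(\<Sum>S\<in>{S\<in>Pow N. A \<subseteq> S \<and> S \<inter> B = {}}. p ^ card S * (1 - p) ^ card (N - S))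
      = (\<Sum>S\<in>Pow M. p ^ card (A \<union> S) * (1 - p) ^ card (N - (A \<union> S)))"
    by (rule sum.reindex_bij_witness[where i = "\<lambda>S. A \<union> S" and j = "\<lambda>S. S - A"])
      (use assms in \<open>auto simp: M_def Un_absorb1\<close>)
  also have "\<dots> = (\<Sum>S\<in>Pow M. (p ^ card A * (1 - p) ^ card B) * (p ^ card S * (1 - p) ^ card (M - S)))"
  proof (rule sum.cong)
    fix S assume S: "S \<in> Pow M"
    then have "finite S" "A \<inter> S = {}" using finM finite_subset[of S M] by (auto simp: M_def)
    then have 1: "card (A \<union> S) = card A + card S" using finM by (simp add: card_Un_disjoint)
    have "N - (A \<union> S) = B \<union> (M - S)" using assms S by (auto simp: M_def)
    moreover have "card (B \<union> (M - S)) = card B + card (M - S)"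
      by (rule card_Un_disjoint) (use finM in \<open>auto simp: M_def\<close>)
    ultimately show "p ^ card (A \<union> S) * (1 - p) ^ card (N - (A \<union> S))
      = (p ^ card A * (1 - p) ^ card B) * (p ^ card S * (1 - p) ^ card (M - S))"
      using 1 by (simp add: power_add mult_ac)
  qed auto
  also have "\<dots> = p ^ card A * (1 - p) ^ card B"
    using sum_Pow_weight[OF finM(1), of p] by (simp add: sum_distrib_left[symmetric])
  finally show ?thesis .
qed

text \<open>In site percolation with density p the events that the cluster of x is P are disjoint for
  distinct P, and each contains the event that P is open and its neighbourhood is closed.\<close>

lemma cluster_sum:
  fixes p :: real
  assumes fin: "finite N" and p: "0 \<le> p" "p \<le> 1"
    and deg: "\<And>a. a \<in> N \<Longrightarrow> card {b\<in>N. adj a b} \<le> \<Delta>" and x: "x \<in> N"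
  shows "(\<Sum>P\<in>{P\<in>Pow N. x \<in> P \<and> linked adj P}. (p * (1 - p) ^ \<Delta>) ^ card P) \<le> p"
proof -
  define wS where "wS S = p ^ card S * (1 - p) ^ card (N - S)" for S :: "'a set"
  have wS0: "wS S \<ge> 0" for S unfolding wS_def using p by auto
  define bd where "bd P = {b\<in>N - P. \<exists>a\<in>P. adj a b}" for P
  define F where "F P = {S\<in>Pow N. P \<subseteq> S \<and> S \<inter> bd P = {}}" for P
  define \<P> where "\<P> = {P\<in>Pow N. x \<in> P \<and> linked adj P}"
  have fin\<P>: "finite \<P>" unfolding \<P>_def using fin by auto
  \<comment> \<open>Both clusters contain x, so if P' leaves P, connectedness of P' gives a step
    from the common part to a point of P' outside P. That point is open for P' but lies on the
    closed boundary of P.\<close>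
  have sub: "P' \<subseteq> P" if "P \<in> \<P>" "P' \<in> \<P>" "S \<in> F P" "S \<in> F P'" for P P' S
  proof (rule ccontr)
    assume "\<not> P' \<subseteq> P"
    then have "P \<inter> P' \<subset> P'" "P \<inter> P' \<noteq> {}" using that unfolding \<P>_def by auto
    moreover have "linked adj P'" using that unfolding \<P>_def by auto
    ultimately obtain a b where ab: "a \<in> P \<inter> P'" "b \<in> P' - P \<inter> P'" "adj a b"
      unfolding linked_def by metis
    then have "b \<in> bd P" "b \<in> S" using that unfolding bd_def F_def by auto
    then show False using that unfolding F_def by auto
  qed
  have "(p * (1 - p) ^ \<Delta>) ^ card P \<le> (\<Sum>S\<in>F P. wS S)" if P: "P \<in> \<P>" for P
  proof -
    have finP: "finite P" "P \<subseteq> N" using P fin finite_subset unfolding \<P>_def by auto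
    have "card (bd P) \<le> card (\<Union>a\<in>P. {b\<in>N. adj a b})"
      by (intro card_mono) (use finP fin in \<open>auto simp: bd_def\<close>)
    also have "\<dots> \<le> (\<Sum>a\<in>P. card {b\<in>N. adj a b})" by (rule card_UN_le[OF finP(1)])
    also have "\<dots> \<le> (\<Sum>a\<in>P. \<Delta>)" by (rule sum_mono) (use deg finP in auto)
    finally have "card (bd P) \<le> \<Delta> * card P" by (simp add: mult.commute)
    then have "(1 - p) ^ (\<Delta> * card P) \<le> (1 - p) ^ card (bd P)"
      using p by (intro power_decreasing) auto
    then have "p ^ card P * (1 - p) ^ (\<Delta> * card P) \<le> p ^ card P * (1 - p) ^ card (bd P)"
      using p by (intro mult_left_mono) auto
    also have "\<dots> = (\<Sum>S\<in>F P. wS S)" unfolding F_def wS_def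
      by (rule sum_between_weight[symmetric]) (use finP fin in \<open>auto simp: bd_def\<close>)
    finally show ?thesis by (simp add: power_mult_distrib power_mult)
  qed
  then have "(\<Sum>P\<in>\<P>. (p * (1 - p) ^ \<Delta>) ^ card P) \<le> (\<Sum>P\<in>\<P>. \<Sum>S\<in>F P. wS S)"
    by (rule sum_mono)
  also have "\<dots> = (\<Sum>S\<in>(\<Union>P\<in>\<P>. F P). wS S)"
  proof (rule sum.UNION_disjoint[symmetric, OF fin\<P>])
    show "\<forall>P\<in>\<P>. finite (F P)" using fin by (auto simp: F_def)
    show "\<forall>P\<in>\<P>. \<forall>P'\<in>\<P>. P \<noteq> P' \<longrightarrow> F P \<inter> F P' = {}"
    proof (intro ballI impI)
      fix P P' assume P: "P \<in> \<P>" "P' \<in> \<P>" "P \<noteq> P'"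
      show "F P \<inter> F P' = {}"
      proof (rule ccontr)
        assume "F P \<inter> F P' \<noteq> {}"
        then obtain S where "S \<in> F P" "S \<in> F P'" by auto
        then show False using sub[of P P' S] sub[of P' P S] P by auto
      qed
    qed
  qed
  also have "\<dots> \<le> (\<Sum>S\<in>{S\<in>Pow N. {x} \<subseteq> S \<and> S \<inter> {} = {}}. wS S)"
    by (rule sum_mono2) (use fin wS0 in \<open>auto simp: F_def \<P>_def\<close>)
  also have "\<dots> = p ^ card {x} * (1 - p) ^ card ({} :: 'a set)" unfolding wS_def
    by (rule sum_between_weight) (use fin x in auto)
  finally show ?thesis unfolding \<P>_def by simp
qed

section \<open>Arithmetic progressions\<close>

definition aps :: "nat \<Rightarrow> nat \<Rightarrow> nat set set" where
  "aps n N = {A. A \<subseteq> {1..N} \<and> arith_prog n A}"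

text \<open>Progressions sharing at least two thirds of their points have the same difference. Such a pair
  is treated as one longer progression, because its members do not behave independently.\<close>

definition blocks :: "nat \<Rightarrow> 'a set set \<Rightarrow> ('a set \<times> 'a set) set" where
  "blocks n E = {(g, h). g \<in> E \<and> h \<in> E \<and> 2 * n \<le> 3 * card (g \<inter> h)}"

lemma card_aps:
  assumes "A \<in> aps n N" shows "card A = n"
proof -
  obtain a d where "d > 0" "A = (\<lambda>i. a + i * d) ` {..<n}"
    using assms unfolding aps_def arith_prog_def by auto
  moreover have "inj_on (\<lambda>i. a + i * d) {..<n}" using \<open>d > 0\<close> by (auto simp: inj_on_def)
  ultimately show ?thesis by (simp add: card_image)
qed

lemma finite_aps: "finite (aps n N)"
  by (rule finite_subset[of _ "Pow {1..N}"]) (auto simp: aps_def)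

lemma card_image_subset:
  assumes "A \<subseteq> f ` S" "finite S"
  shows "card A \<le> card S"
  by (meson assms card_image_le card_mono finite_imageI le_trans)

lemma card_UN_bound:
  assumes "finite A" "card A \<le> m" "\<And>a. a \<in> A \<Longrightarrow> finite (X a) \<and> card (X a) \<le> c"
  shows "finite (\<Union>a\<in>A. X a) \<and> card (\<Union>a\<in>A. X a) \<le> m * c"
proof -
  have "card (\<Union>a\<in>A. X a) \<le> (\<Sum>a\<in>A. card (X a))" by (rule card_UN_le[OF assms(1)])
  also have "\<dots> \<le> card A * c" using sum_bounded_above[of A "\<lambda>a. card (X a)" c] assms(3) by simp
  also have "\<dots> \<le> m * c" by (rule mult_right_mono[OF assms(2)]) simp
  finally show ?thesis using assms by blast
qed

lemma card_image_bound: "finite A \<and> card A \<le> c \<Longrightarrow> finite (f ` A) \<and> card (f ` A) \<le> c"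
  using card_image_le[of A f] by auto

text \<open>A progression is given by the position of x in it and by its difference. The difference
  is at most N/(n - 1), so the n positions cost no more than a factor 2.\<close>

lemma card_aps_through:
  assumes n: "n \<ge> 2"
  shows "card {A \<in> aps n N. x \<in> A} \<le> 2 * N"
proof -
  define S where "S = {..<n} \<times> {1..N div (n - 1)}"
  have "{A \<in> aps n N. x \<in> A} \<subseteq> (\<lambda>(i, d). (\<lambda>j. x - i * d + j * d) ` {..<n}) ` S"
  proof
    fix A assume A: "A \<in> {A \<in> aps n N. x \<in> A}"
    then obtain a d where ad: "d > 0" "A = (\<lambda>i. a + i * d) ` {..<n}"
      unfolding aps_def arith_prog_def by auto
    obtain i where i: "i < n" "x = a + i * d" using A ad by auto
    have "a + (n - 1) * d \<in> A" using ad n by auto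
    then have "a + (n - 1) * d \<le> N" using A unfolding aps_def by auto
    then have "d * (n - 1) \<le> N" by (simp add: mult.commute)
    then have "d \<le> N div (n - 1)" using n by (simp add: less_eq_div_iff_mult_less_eq)
    then have "(i, d) \<in> S" using i ad unfolding S_def by auto
    moreover have "A = (\<lambda>j. x - i * d + j * d) ` {..<n}" using ad i by simp
    ultimately show "A \<in> (\<lambda>(i, d). (\<lambda>j. x - i * d + j * d) ` {..<n}) ` S" by force
  qed
  then have "card {A \<in> aps n N. x \<in> A} \<le> card S"
    by (rule card_image_subset) (simp add: S_def)
  also have "card S = n * (N div (n - 1))" unfolding S_def by (simp add: card_cartesian_product)
  also have "\<dots> \<le> (2 * (n - 1)) * (N div (n - 1))" using n by (intro mult_right_mono) auto
  also have "\<dots> = 2 * ((n - 1) * (N div (n - 1)))" by (simp only: mult.assoc)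
  also have "\<dots> \<le> 2 * N" by (intro mult_left_mono) (auto simp: mult.commute div_times_less_eq_dividend)
  finally show ?thesis .
qed

section \<open>Progressions with a large overlap\<close>

lemma consecutive_in_dense:
  assumes "I \<subseteq> {..<n}" "n + 1 < 2 * card I"
  shows "\<exists>i. i \<in> I \<and> Suc i \<in> I"
proof (rule ccontr)
  assume no: "\<nexists>i. i \<in> I \<and> Suc i \<in> I"
  \<comment> \<open>Without neighbours in \<open>I\<close>, each pair {2j, 2j + 1} holds at most one
    element of it.\<close>
  have "inj_on (\<lambda>i. i div 2) I"
  proof (rule inj_onI)
    fix i j assume ij: "i \<in> I" "j \<in> I" "i div 2 = j div 2"
    then have "i = j \<or> i = Suc j \<or> j = Suc i" by presburger
    then show "i = j" using no ij by auto
  qed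
  moreover have "(\<lambda>i. i div 2) ` I \<subseteq> {..<(n + 1) div 2}"
  proof
    fix y assume "y \<in> (\<lambda>i. i div 2) ` I"
    then obtain i where "i < n" "y = i div 2" using assms by auto
    then have "y < (n + 1) div 2" by presburger
    then show "y \<in> {..<(n + 1) div 2}" by simp
  qed
  ultimately have "card I \<le> card {..<(n + 1) div 2}"
    by (rule card_inj_on_le) simp
  then show False using assms by simp
qed

text \<open>For n \<ge> 4 two thirds of the indices exceed (n + 1)/2, so two consecutive terms of
  the first progression lie in the second, and their distance is a multiple of its difference. The
  overlap condition is symmetric, so the differences of a block divide each other.\<close>

lemma step_dvd:
  assumes n: "n \<ge> 4" and "d > 0"
    and big: "2 * n \<le> 3 * card ((\<lambda>i. a + i * d) ` {..<n} \<inter> (\<lambda>i. b + i * d') ` {..<n})"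
  shows "(d' :: nat) dvd d"
proof -
  define h where "h = (\<lambda>i. b + i * d') ` {..<n}"
  define I where "I = {i\<in>{..<n}. a + i * d \<in> h}"
  have "(\<lambda>i. a + i * d) ` {..<n} \<inter> h = (\<lambda>i. a + i * d) ` I" unfolding I_def by auto
  moreover have "card ((\<lambda>i. a + i * d) ` I) \<le> card I" by (rule card_image_le) (simp add: I_def)
  ultimately have "2 * n \<le> 3 * card I" using big unfolding h_def[symmetric] by simp
  then have "n + 1 < 2 * card I" using n by linarith
  then obtain i where "i \<in> I" "Suc i \<in> I" using consecutive_in_dense[of I n] unfolding I_def by auto
  then obtain j j' where j: "a + i * d = b + j * d'" "a + Suc i * d = b + j' * d'"
    unfolding I_def h_def by auto
  then have "j * d' + d = j' * d'" by simp
  then have "d = (j' - j) * d'" by (metis diff_mult_distrib add_diff_cancel_left')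
  then show ?thesis by simp
qed

text \<open>Integer parameters allow a start \<open>x + p * d\<close> with negative p, where
  truncated subtraction would spoil the algebra.\<close>

definition zap :: "nat \<Rightarrow> int \<Rightarrow> int \<Rightarrow> nat set" where
  "zap n z d = (\<lambda>i. nat (z + int i * d)) ` {..<n}"

lemma zap_of_nat: "zap n (int a) (int d) = (\<lambda>i. a + i * d) ` {..<n}"
proof -
  have "nat (int a + int i * int d) = a + i * d" for i
    by (simp flip: of_nat_mult of_nat_add)
  then show ?thesis unfolding zap_def by simp
qed

lemma block_form:
  assumes n: "n \<ge> 4" and b: "(g, h) \<in> blocks n (aps n N)"
  obtains a d s where "0 < d" "d \<le> int N" "g = zap n a d" "h = zap n (a + s * d) d" "\<bar>s\<bar> < int n"
    "\<And>x. x \<in> g \<union> h \<Longrightarrow> \<exists>m. \<bar>m\<bar> < 2 * int n \<and> int x = a + m * d"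
proof -
  have gh: "g \<in> aps n N" "h \<in> aps n N" "2 * n \<le> 3 * card (g \<inter> h)"
    using b unfolding blocks_def by auto
  obtain a d where g: "d > 0" "g = (\<lambda>i. a + i * d) ` {..<n}"
    using gh unfolding aps_def arith_prog_def by auto
  obtain b e where h: "e > 0" "h = (\<lambda>i. b + i * e) ` {..<n}"
    using gh unfolding aps_def arith_prog_def by auto
  have "e dvd d" using gh(3) unfolding g(2) h(2) by (rule step_dvd[OF n g(1)])
  moreover have "2 * n \<le> 3 * card (h \<inter> g)" using gh(3) by (simp add: Int_commute)
  then have "d dvd e" unfolding g(2) h(2) by (rule step_dvd[OF n h(1)])
  ultimately have de: "e = d" by (simp add: dvd_antisym)
  have "g \<inter> h \<noteq> {}" using gh(3) n by auto
  then obtain i j where ij: "i < n" "j < n" "a + i * d = b + j * d" using g h de by auto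
  define s where "s = int i - int j"
  have "int a + int i * int d = int b + int j * int d" using ij(3) by (metis of_nat_add of_nat_mult)
  then have bs: "int b = int a + s * int d" unfolding s_def by (simp add: algebra_simps)
  have s: "\<bar>s\<bar> < int n" unfolding s_def using ij by linarith
  show thesis
  proof (rule that[of "int d" "int a" s])
    show "0 < int d" using g by simp
    have "{a, a + 1 * d} \<subseteq> g" unfolding g(2) using n by (auto intro: image_eqI[of _ _ 0]
      image_eqI[of _ _ 1])
    then show "int d \<le> int N" using gh(1) unfolding aps_def by auto
    show "g = zap n (int a) (int d)" using g zap_of_nat by simp
    show "h = zap n (int a + s * int d) (int d)" using h de bs zap_of_nat[of n b d] by simp
    fix x assume "x \<in> g \<union> h"
    then consider k where "k < n" "x = a + k * d" | k where "k < n" "x = b + k * d" using g h de by auto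
    then show "\<exists>m. \<bar>m\<bar> < 2 * int n \<and> int x = int a + m * int d"
    proof cases
      case 1
      then show ?thesis by (intro exI[of _ "int k"]) auto
    next
      case 2
      then have "int x = int a + (s + int k) * int d" using bs by (simp add: algebra_simps)
      then show ?thesis using 2 s by (intro exI[of _ "s + int k"]) auto
    qed
  qed (use s in auto)
qed

text \<open>Seen from one of its points, a block consists of two offsets of size O(n) and a
  difference; only the difference can be as large as N.\<close>

lemma block_through:
  assumes n: "n \<ge> 4" and b: "b \<in> blocks n (aps n N)" and x: "x \<in> fst b \<union> snd b"
  shows "\<exists>p q d. p \<in> {- 4 * int n..4 * int n} \<and> q \<in> {- 4 * int n..4 * int n} \<and> d \<in> {1..int N} \<and>
    b = (zap n (int x + p * d) d, zap n (int x + q * d) d) \<and>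
    (\<forall>y\<in>fst b \<union> snd b. \<exists>k. k \<in> {- 4 * int n..4 * int n} \<and> int y - int x = k * d)"
proof -
  obtain g h where gh: "b = (g, h)" by (cases b)
  then have bl: "(g, h) \<in> blocks n (aps n N)" "x \<in> g \<union> h" using b x by auto
  obtain a d s where ads: "0 < d" "d \<le> int N" "g = zap n a d"
    "h = zap n (a + s * d) d" "\<bar>s\<bar> < int n"
    and form: "\<And>x. x \<in> g \<union> h \<Longrightarrow> \<exists>m. \<bar>m\<bar> < 2 * int n \<and> int x = a + m * d"
    by (rule block_form[OF n bl(1)]) (rule that)
  obtain m where m: "\<bar>m\<bar> < 2 * int n" "int x = a + m * d" using form[OF bl(2)] by blast
  have e: "int x + (- m) * d = a" "int x + (s - m) * d = a + s * d" using m(2) by (auto simp: algebra_simps)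
  have "\<exists>k. k \<in> {- 4 * int n..4 * int n} \<and> int y - int x = k * d" if "y \<in> fst b \<union> snd b" for y
  proof -
    obtain k where k: "\<bar>k\<bar> < 2 * int n" "int y = a + k * d" using form[of y] gh \<open>y \<in> fst b \<union> snd b\<close> by auto
    then show ?thesis using m by (intro exI[of _ "k - m"]) (auto simp: algebra_simps)
  qed
  moreover have "b = (zap n (int x + (- m) * d) d, zap n (int x + (s - m) * d) d)" by (simp only:
    e gh ads(3,4))
  moreover have "- m \<in> {- 4 * int n..4 * int n}" "s - m \<in> {- 4 * int n..4 * int n}" "d \<in> {1..int N}"
    using m ads by auto
  ultimately show ?thesis by blast
qed

lemma card_blocks_through:
  assumes n: "n \<ge> 4"
  shows "card {b \<in> blocks n (aps n N). x \<in> fst b \<union> snd b} \<le> 81 * n ^ 2 * N"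
proof -
  define Z where "Z = {- 4 * int n..4 * int n}"
  define S where "S = Z \<times> Z \<times> {1..int N}"
  have "{b \<in> blocks n (aps n N). x \<in> fst b \<union> snd b}
     \<subseteq> (\<lambda>(p, q, d). (zap n (int x + p * d) d, zap n (int x + q * d) d)) ` S"
  proof
    fix b assume b: "b \<in> {b \<in> blocks n (aps n N). x \<in> fst b \<union> snd b}"
    then obtain p q d where pqd: "p \<in> Z" "q \<in> Z" "d \<in> {1..int N}"
      "b = (zap n (int x + p * d) d, zap n (int x + q * d) d)"
      using block_through[OF n, of b N x] unfolding Z_def by blast
    then show "b \<in> (\<lambda>(p, q, d). (zap n (int x + p * d) d, zap n (int x + q * d) d)) ` S"
      unfolding S_def by (intro image_eqI[of _ _ "(p, q, d)"]) auto
  qed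
  then have "card {b \<in> blocks n (aps n N). x \<in> fst b \<union> snd b} \<le> card S"
    by (rule card_image_subset) (auto simp: S_def Z_def)
  also have "card S = (8 * n + 1) * ((8 * n + 1) * N)" unfolding S_def Z_def
    by (simp add: card_cartesian_product) (simp add: nat_add_distrib nat_mult_distrib)
  also have "\<dots> \<le> (9 * n) * ((9 * n) * N)" using n by (intro mult_mono) auto
  finally show ?thesis by (simp add: power2_eq_square)
qed

text \<open>A second point determines the difference from one more offset k, by y - x = k d. The
  count no longer depends on N; this is the gain when a chain of blocks is closed.\<close>

lemma card_blocks_through_two:
  assumes n: "n \<ge> 4" and xy: "x \<noteq> y"
  shows "card {b \<in> blocks n (aps n N). {x, y} \<subseteq> fst b \<union> snd b} \<le> 729 * n ^ 3"
proof -
  define Z where "Z = {- 4 * int n..4 * int n}"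
  define S where "S = Z \<times> Z \<times> Z"
  define D where "D k = (int y - int x) div k" for k
  have "{b \<in> blocks n (aps n N). {x, y} \<subseteq> fst b \<union> snd b}
     \<subseteq> (\<lambda>(p, q, k). (zap n (int x + p * D k) (D k), zap n (int x + q * D k) (D k))) ` S"
  proof
    fix b assume b: "b \<in> {b \<in> blocks n (aps n N). {x, y} \<subseteq> fst b \<union> snd b}"
    then obtain p q d k where pqd: "p \<in> Z" "q \<in> Z" "k \<in> Z" "int y - int x = k * d"
      "b = (zap n (int x + p * d) d, zap n (int x + q * d) d)"
      using block_through[OF n, of b N x] unfolding Z_def by blast
    then have "k \<noteq> 0" using xy by auto
    then have "D k = d" unfolding D_def pqd(4) by simp
    then show "b \<in> (\<lambda>(p, q, k). (zap n (int x + p * D k) (D k), zap n (int x + q * D k) (D k))) ` S"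
      using pqd unfolding S_def by (intro image_eqI[of _ _ "(p, q, k)"]) auto
  qed
  then have "card {b \<in> blocks n (aps n N). {x, y} \<subseteq> fst b \<union> snd b} \<le> card S"
    by (rule card_image_subset) (auto simp: S_def Z_def)
  also have "card S = (8 * n + 1) * ((8 * n + 1) * (8 * n + 1))" unfolding S_def Z_def
    by (simp add: card_cartesian_product) (simp add: nat_add_distrib nat_mult_distrib)
  also have "\<dots> \<le> (9 * n) * ((9 * n) * (9 * n))" using n by (intro mult_mono) auto
  finally show ?thesis by (simp add: power3_eq_cube)
qed

section \<open>The exceptional events\<close>

text \<open>Entries (initial colour, label) of a vertex that can be displayed in colour k: either it starts
  with colour k, or it was flipped, which needs a label below R.\<close>

definition near :: "nat \<Rightarrow> nat \<Rightarrow> nat \<Rightarrow> (nat \<times> nat) set" where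
  "near r R k = {(a, b). a = k \<or> (Suc a mod r = k \<and> b < R)}"

definition body :: "'a set \<times> 'a set \<Rightarrow> 'a set" where
  "body b = fst b \<union> snd b"

text \<open>Cyclic chains of blocks. Distinctness is asked of the linking points, not of the blocks:
  it guarantees that the last block passes through two different given points.\<close>

definition links :: "('a set \<times> 'a set) set \<Rightarrow> ('a set \<times> 'a set) list \<Rightarrow> bool" where
  "links BL bs \<longleftrightarrow> 2 \<le> length bs \<and> set bs \<subseteq> BL \<and> (\<exists>xs. length xs = length bs \<and> distinct xs \<and>
     (\<forall>i<length bs. xs ! i \<in> body (bs ! i) \<inter> body (bs ! (Suc i mod length bs))))"

abbreviation cyc :: "nat \<Rightarrow> 'a set set \<Rightarrow> ('a set \<times> 'a set) list \<Rightarrow> bool" where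
  "cyc n E \<equiv> links (blocks n E)"

text \<open>A loose path of L - 1 edges has (L - 1)(n - 1) + 1 vertices; a closed chain of L blocks must
  exceed this by a fraction of n to be improbable enough.\<close>

definition spread :: "nat \<Rightarrow> ('a set \<times> 'a set) list \<Rightarrow> bool" where
  "spread n bs \<longleftrightarrow> (length bs - 1) * (n - 1) + 1 + n div 4 \<le> card (\<Union>b\<in>set bs. fst b)"

text \<open>Both directions occur because a walk through the explanations may go towards the root or
  away from it.\<close>

definition steps :: "nat \<Rightarrow> nat list \<Rightarrow> bool" where
  "steps r ks \<longleftrightarrow> (\<forall>k\<in>set ks. k < r) \<and>
     (\<forall>i. Suc i < length ks \<longrightarrow> ks ! Suc i = Suc (ks ! i) mod r \<or> ks ! i = Suc (ks ! Suc i) mod r)"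

text \<open>This arises from two linked progressions with a large overlap, whose common vertices all
  have labels below R. The second progression is forgotten, since so many small labels are rare
  enough by themselves.\<close>

definition dense_event :: "'a set set \<Rightarrow> nat \<Rightarrow> nat \<Rightarrow> nat \<Rightarrow> ('a \<Rightarrow> nat \<times> nat) \<Rightarrow> bool" where
  "dense_event E n r R w \<longleftrightarrow> (\<exists>e\<in>E. \<exists>k<r. \<exists>S\<subseteq>e. 2 * n \<le> 3 * card S \<and>
     (\<forall>u\<in>e. w u \<in> near r R k) \<and> (\<forall>u\<in>S. snd (w u) < R))"

definition cyc_event :: "'a set set \<Rightarrow> nat \<Rightarrow> nat \<Rightarrow> nat \<Rightarrow> nat \<Rightarrow> ('a \<Rightarrow> nat \<times> nat) \<Rightarrow> bool" where
  "cyc_event E n r R M w \<longleftrightarrow> (\<exists>bs ks. cyc n E bs \<and> spread n bs \<and> length bs \<le> M \<and> steps r ks \<and>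
     length ks = length bs \<and> (\<forall>i<length bs. \<forall>u\<in>fst (bs ! i). w u \<in> near r R (ks ! i)))"

text \<open>The node (e, Some v) says that v was flipped because of e; the root is (f, None). The hooks of
  (e, a) are the vertices of e flipped earlier than a. The sets of remaining vertices of the nodes
  are disjoint, so colours and labels are independent between nodes.\<close>

type_synonym 'a node = "'a set \<times> 'a option"

definition nodes :: "'a set set \<Rightarrow> 'a node set" where
  "nodes E = {(e, a). e \<in> E \<and> (\<forall>v. a = Some v \<longrightarrow> v \<in> e)}"

definition hooks :: "'a node set \<Rightarrow> 'a node \<Rightarrow> 'a set" where
  "hooks P p = {u \<in> fst p. Some u \<noteq> snd p \<and> (\<exists>e. (e, Some u) \<in> P)}"

definition own :: "'a node set \<Rightarrow> 'a node \<Rightarrow> 'a set" where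
  "own P p = fst p - hooks P p"

text \<open>Disjoint own sets give independence between nodes. The bound on the hooks says that the
  own sets of m nodes of size n contain at least m(n - 1) + 1 vertices in total. The rank excludes
  circular explanations: every node is reached from the root through hooks.\<close>

definition tree :: "'a set set \<Rightarrow> 'a node set \<Rightarrow> bool" where
  "tree E P \<longleftrightarrow> finite P \<and> P \<subseteq> nodes E \<and> (\<exists>!p. p \<in> P \<and> snd p = None) \<and>
     (\<forall>p\<in>P. \<forall>q\<in>P. p \<noteq> q \<longrightarrow> own P p \<inter> own P q = {}) \<and>
     (\<Sum>p\<in>P. card (hooks P p)) < card P \<and>
     (\<exists>rk :: 'a node \<Rightarrow> nat. \<forall>p\<in>P. \<forall>u. snd p = Some u \<longrightarrow> (\<exists>q\<in>P. rk q < rk p \<and> u \<in> hooks P q))"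

text \<open>A hook u of p shows the colour that follows the one in which its own explanation (e,
  Some u) was monochromatic.\<close>

definition colouring :: "nat \<Rightarrow> 'a node set \<Rightarrow> ('a node \<Rightarrow> nat) \<Rightarrow> bool" where
  "colouring r P k \<longleftrightarrow> (\<forall>p\<in>P. k p < r) \<and>
     (\<forall>p\<in>P. \<forall>q\<in>P. \<forall>u. snd q = Some u \<longrightarrow> u \<in> hooks P p \<longrightarrow> k p = Suc (k q) mod r)"

text \<open>The flag \<open>q\<close> records that the own vertices of the root all have labels at
  least R. When it is false, more than T nodes are required; each alternative makes the event
  polynomially rarer.\<close>

definition tree_event :: "'a set set \<Rightarrow> nat \<Rightarrow> nat \<Rightarrow> nat \<Rightarrow> ('a \<Rightarrow> nat \<times> nat) \<Rightarrow> bool" where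
  "tree_event E r R T w \<longleftrightarrow> (\<exists>P k q. tree E P \<and> colouring r P k \<and> (q \<or> T < card P) \<and>
     (\<forall>p\<in>P. \<forall>u\<in>own P p. fst (w u) = k p \<and> (\<forall>v. snd p = Some v \<longrightarrow> snd (w v) \<le> snd (w u)) \<and>
        (snd p = None \<and> q \<longrightarrow> R \<le> snd (w u))))"

section \<open>Recolouring\<close>

locale recolouring =
  fixes E :: "'a set set" and n r R T :: nat and w :: "'a \<Rightarrow> nat \<times> nat"
  assumes finE: "finite E" and cardE: "\<And>e. e \<in> E \<Longrightarrow> card e = n" and n8: "n \<ge> 8" and r2: "r \<ge> 2"
    and colours: "\<And>e u. e \<in> E \<Longrightarrow> u \<in> e \<Longrightarrow> fst (w u) < r"
begin

definition shown :: "'a set \<Rightarrow> 'a \<Rightarrow> nat" where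
  "shown F u = (if u \<in> F then Suc (fst (w u)) mod r else fst (w u))"

definition monochromatic :: "'a set \<Rightarrow> 'a set \<Rightarrow> bool" where
  "monochromatic F e \<longleftrightarrow> (\<exists>k. \<forall>u\<in>e. shown F u = k)"

definition trigger :: "'a set \<Rightarrow> 'a set \<Rightarrow> 'a \<Rightarrow> bool" where
  "trigger F e v \<longleftrightarrow> e \<in> E \<and> v \<in> e \<and> v \<notin> F \<and> monochromatic F e \<and> snd (w v) < R \<and>
     (\<forall>u\<in>e - F. snd (w v) \<le> snd (w u))"

primrec flip :: "nat \<Rightarrow> 'a set" where
  "flip 0 = {}"
| "flip (Suc t) = flip t \<union> {v. \<exists>e. trigger (flip t) e v}"

lemma finite_edge: "e \<in> E \<Longrightarrow> finite e"
  using cardE n8 card.infinite by fastforce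

lemma flip_le: "s \<le> t \<Longrightarrow> flip s \<subseteq> flip t"
  by (rule lift_Suc_mono_le[of flip]) auto

text \<open>For a flipped v, \<open>flip (birth v)\<close> is the state just before the flip, which
  is the state seen by the progression that caused it.\<close>

definition birth :: "'a \<Rightarrow> nat" where
  "birth v = (LEAST t. v \<in> flip (Suc t))"

lemma birth:
  assumes "v \<in> flip t"
  shows "v \<in> flip (Suc (birth v))" "v \<notin> flip (birth v)" "birth v < t"
proof -
  obtain s where s: "t = Suc s" using assms by (cases t) auto
  show "v \<in> flip (Suc (birth v))" unfolding birth_def
    by (rule LeastI[of "\<lambda>t. v \<in> flip (Suc t)" s]) (use assms s in simp)
  show "birth v < t" unfolding birth_def s less_Suc_eq_le
    by (rule Least_le) (use assms s in simp)
  show "v \<notin> flip (birth v)"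
  proof (cases "birth v")
    case (Suc b)
    then have "b < (LEAST t. v \<in> flip (Suc t))" unfolding birth_def by simp
    from not_less_Least[OF this] show ?thesis using Suc by simp
  qed simp
qed

lemma birth_trigger:
  assumes "v \<in> flip t"
  shows "\<exists>e. trigger (flip (birth v)) e v"
  using birth(1,2)[OF assms] by simp

lemma free: "v \<in> flip t \<Longrightarrow> snd (w v) < R"
  using birth_trigger unfolding trigger_def by blast

end

section \<open>The explanations of a monochromatic edge\<close>

locale bad_edge = recolouring +
  fixes f :: "'a set"
  assumes f: "f \<in> E" and bad: "monochromatic (flip T) f"
begin

definition edge :: "'a option \<Rightarrow> 'a set" where
  "edge a = (case a of None \<Rightarrow> f | Some v \<Rightarrow> (SOME e. trigger (flip (birth v)) e v))"

definition time :: "'a option \<Rightarrow> nat" where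
  "time a = (case a of None \<Rightarrow> T | Some v \<Rightarrow> birth v)"

text \<open>One explanation is chosen per flipped vertex, so the vertices themselves index the nodes
  and \<open>None\<close> stands for f. A vertex flipped in two of the edges still gives a single
  node; such a coincidence later shows up as a conflict.\<close>

inductive_set Q :: "'a option set" where
  root: "None \<in> Q"
| child: "a \<in> Q \<Longrightarrow> u \<in> edge a \<Longrightarrow> u \<in> flip (time a) \<Longrightarrow> Some u \<in> Q"

lemma time_le: "a \<in> Q \<Longrightarrow> time a \<le> T"
proof (induction rule: Q.induct)
  case (child a u)
  then show ?case using birth(3)[of u "time a"] by (simp add: time_def)
qed (simp add: time_def)

lemma Q_flip: "Some v \<in> Q \<Longrightarrow> v \<in> flip T"
  by (erule Q.cases) (use time_le flip_le in auto)

lemma Q_trigger: "Some v \<in> Q \<Longrightarrow> trigger (flip (time (Some v))) (edge (Some v)) v"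
  using someI_ex[OF birth_trigger[OF Q_flip]] by (simp add: edge_def time_def)

lemma Q_edge: assumes "a \<in> Q" shows "edge a \<in> E" "monochromatic (flip (time a)) (edge a)"
proof (atomize (full), cases a)
  case None
  then show "edge a \<in> E \<and> monochromatic (flip (time a)) (edge a)" using f bad by (simp add:
    edge_def time_def)
next
  case (Some v)
  then show "edge a \<in> E \<and> monochromatic (flip (time a)) (edge a)" using Q_trigger assms unfolding
    trigger_def by blast
qed

lemma finite_Q: "finite Q"
proof -
  have "Q \<subseteq> insert None (Some ` (\<Union>E))"
  proof
    fix a assume "a \<in> Q"
    show "a \<in> insert None (Some ` (\<Union>E))"
    proof (cases a)
      case (Some v)
      then have "v \<in> edge a" "edge a \<in> E" using Q_trigger \<open>a \<in> Q\<close> unfolding trigger_def by auto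
      then show ?thesis using Some by blast
    qed simp
  qed
  then show ?thesis by (rule finite_subset) (use finE finite_edge in auto)
qed

definition kap :: "'a option \<Rightarrow> nat" where
  "kap a = (SOME k. \<forall>u\<in>edge a. shown (flip (time a)) u = k)"

lemma kap: "a \<in> Q \<Longrightarrow> u \<in> edge a \<Longrightarrow> shown (flip (time a)) u = kap a"
  using someI_ex[of "\<lambda>k. \<forall>u\<in>edge a. shown (flip (time a)) u = k"] Q_edge(2)
  unfolding monochromatic_def kap_def by blast

lemma card_edge: "a \<in> Q \<Longrightarrow> card (edge a) = n"
  using Q_edge cardE by blast

lemma fin_edge: "a \<in> Q \<Longrightarrow> finite (edge a)"
  using Q_edge finite_edge by blast

lemma kap_less: assumes "a \<in> Q" shows "kap a < r"
proof -
  have "edge a \<noteq> {}" using card_edge[OF assms] n8 by auto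
  then obtain u where "u \<in> edge a" by auto
  have "shown (flip (time a)) u < r"
    using colours[OF Q_edge(1)[OF assms] \<open>u \<in> edge a\<close>] r2 by (simp add: shown_def)
  then show ?thesis using kap[OF assms \<open>u \<in> edge a\<close>] by simp
qed

lemma kap_near: "a \<in> Q \<Longrightarrow> u \<in> edge a \<Longrightarrow> w u \<in> near r R (kap a)"
  using kap[of a u] free[of u] by (cases "w u") (auto simp: shown_def near_def split: if_splits)

definition par :: "'a option \<Rightarrow> 'a option" where
  "par a = (SOME b. b \<in> Q \<and> the a \<in> edge b \<and> the a \<in> flip (time b))"

lemma par:
  assumes "Some u \<in> Q"
  shows "par (Some u) \<in> Q" "u \<in> edge (par (Some u))" "u \<in> flip (time (par (Some u)))"
proof -
  have "\<exists>b. b \<in> Q \<and> the (Some u) \<in> edge b \<and> the (Some u) \<in> flip (time b)"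
    using assms by (cases rule: Q.cases) auto
  from someI_ex[OF this] show "par (Some u) \<in> Q" "u \<in> edge (par (Some u))" "u \<in> flip (time (par (Some u)))"
    unfolding par_def by auto
qed

lemma in_edge: assumes "Some u \<in> Q" shows "u \<in> edge (Some u)" "u \<notin> flip (time (Some u))"
  using Q_trigger[OF assms] unfolding trigger_def by auto

lemma par_time: "Some u \<in> Q \<Longrightarrow> time (Some u) < time (par (Some u))"
  using birth(3)[OF par(3)] by (simp add: time_def)

text \<open>When its explanation was monochromatic, u was unflipped, so that edge had the initial
  colour of u. In the edge of a the vertex is already flipped and shows the next colour.\<close>

lemma hook_kap:
  assumes "a \<in> Q" "u \<in> edge a" "u \<in> flip (time a)"
  shows "kap a = Suc (kap (Some u)) mod r"
proof -
  have Q: "Some u \<in> Q" using assms by (rule Q.child)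
  have "kap (Some u) = fst (w u)" using kap[OF Q in_edge(1)[OF Q]] in_edge[OF Q] by (simp add: shown_def)
  moreover have "kap a = Suc (fst (w u)) mod r" using kap[OF assms(1,2)] assms(3) by (simp add: shown_def)
  ultimately show ?thesis by simp
qed

section \<open>Conflicts and shortest walks between them\<close>

definition adj :: "'a option \<Rightarrow> 'a option \<Rightarrow> bool" where
  "adj a b \<longleftrightarrow> (a \<noteq> None \<and> par a = b) \<or> (b \<noteq> None \<and> par b = a)"

text \<open>Without conflicts the explanations form a loose hypertree: different edges meet only
  along parent links, and there in a single vertex.\<close>

definition conflict :: "'a option \<Rightarrow> 'a option \<Rightarrow> bool" where
  "conflict a b \<longleftrightarrow> a \<noteq> b \<and> ((\<not> adj a b \<and> edge a \<inter> edge b \<noteq> {}) \<or> (adj a b \<and> 2 \<le> card (edge a \<inter> edge b)))"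

definition walk :: "(nat \<Rightarrow> 'a option) \<Rightarrow> nat \<Rightarrow> bool" where
  "walk g l \<longleftrightarrow> (\<forall>i\<le>l. g i \<in> Q) \<and> (\<forall>i<l. adj (g i) (g (Suc i)))"

lemma adj_sym: "adj a b \<longleftrightarrow> adj b a"
  unfolding adj_def by auto

lemma link:
  assumes "adj a b" "a \<in> Q" "b \<in> Q"
  obtains v where "v \<in> edge a" "v \<in> edge b" "(a = Some v \<and> par a = b) \<or> (b = Some v \<and> par b = a)"
proof -
  from assms(1) consider v where "a = Some v" "par a = b" | v where "b = Some v" "par b = a"
    unfolding adj_def by auto
  then show thesis
  proof cases
    case 1
    then show ?thesis using that[of v] in_edge(1)[of v] par(2)[of v] assms by blast
  next
    case 2
    then show ?thesis using that[of v] in_edge(1)[of v] par(2)[of v] assms by blast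
  qed
qed

lemma adj_kap:
  assumes "adj a b" "a \<in> Q" "b \<in> Q"
  shows "kap b = Suc (kap a) mod r \<or> kap a = Suc (kap b) mod r"
proof -
  obtain v where "(a = Some v \<and> par a = b) \<or> (b = Some v \<and> par b = a)" using link[OF assms] by metis
  then show ?thesis using hook_kap[OF par] assms by auto
qed

text \<open>Times strictly increase from a node to its parent and never exceed T, which bounds the
  number of steps.\<close>

lemma walk_to_root:
  "a \<in> Q \<Longrightarrow> \<exists>g l. walk g l \<and> g 0 = a \<and> g l = None \<and> l \<le> T - time a"
proof (induction "T - time a" arbitrary: a rule: less_induct)
  case less
  show ?case
  proof (cases a)
    case None
    then have "walk (\<lambda>_. None) 0" using Q.root by (simp add: walk_def)
    then show ?thesis using None by (intro exI[of _ "\<lambda>_. None"] exI[of _ 0]) auto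
  next
    case (Some u)
    have p: "par a \<in> Q" "time a < time (par a)" "time (par a) \<le> T"
      using par par_time less.prems time_le Some by auto
    then have "T - time (par a) < T - time a" by linarith
    from less.hyps[OF this p(1)] obtain g l where g: "walk g l" "g 0 = par a" "g l = None" "l \<le> T
      - time (par a)"
      by blast
    define h where "h i = (case i of 0 \<Rightarrow> a | Suc j \<Rightarrow> g j)" for i
    have "walk h (Suc l)" unfolding walk_def
    proof (intro conjI allI impI)
      fix i assume "i \<le> Suc l"
      then show "h i \<in> Q" using g(1) less.prems by (cases i) (auto simp: h_def walk_def)
    next
      fix i assume "i < Suc l"
      then show "adj (h i) (h (Suc i))" using g(1,2) Some by (cases i) (auto simp: h_def walk_def adj_def)
    qed
    moreover have "h 0 = a" "h (Suc l) = None" using g by (auto simp: h_def)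
    moreover have "Suc l \<le> T - time a" using g(4) p by linarith
    ultimately show ?thesis by blast
  qed
qed

lemma walk_between:
  assumes "a \<in> Q" "b \<in> Q"
  shows "\<exists>g l. walk g l \<and> g 0 = a \<and> g l = b \<and> l \<le> 2 * T"
proof -
  obtain g k where g: "walk g k" "g 0 = a" "g k = None" "k \<le> T - time a"
    using walk_to_root[OF assms(1)] by blast
  obtain h l where h: "walk h l" "h 0 = b" "h l = None" "l \<le> T - time b"
    using walk_to_root[OF assms(2)] by blast
  define m where "m i = (if i \<le> k then g i else h (k + l - i))" for i
  have "walk m (k + l)" unfolding walk_def
  proof (intro conjI allI impI)
    fix i assume "i \<le> k + l"
    then show "m i \<in> Q" using g(1) h(1) by (auto simp: m_def walk_def)
  next
    fix i assume i: "i < k + l"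
    consider "i < k" | "i = k" | "i > k" by linarith
    then show "adj (m i) (m (Suc i))"
    proof cases
      case 1
      then show ?thesis using g(1) by (auto simp: m_def walk_def)
    next
      case 2
      then have "l > 0" using i by simp
      then have "adj (h (l - 1)) (h (Suc (l - 1)))" using h(1) unfolding walk_def
        by (metis diff_less zero_less_one)
      then show ?thesis using 2 g(3) h(3) \<open>l > 0\<close> adj_sym by (auto simp: m_def)
    next
      case 3
      then have "adj (h (k + l - Suc i)) (h (Suc (k + l - Suc i)))" using h(1) i unfolding walk_def by auto
      moreover have "Suc (k + l - Suc i) = k + l - i" using i by simp
      ultimately show ?thesis using 3 adj_sym by (auto simp: m_def)
    qed
  qed
  moreover have "m 0 = a" using g by (simp add: m_def)
  moreover have "m (k + l) = b" using g h by (cases "l = 0") (auto simp: m_def)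
  moreover have "k + l \<le> 2 * T" using g(4) h(4) by linarith
  ultimately show ?thesis by blast
qed

text \<open>Minimality is over all conflicting pairs at once, so no proper subwalk has conflicting
  ends and the walk admits no shortcut. The bound 2 * T comes from joining two walks at the
  root.\<close>

definition small_conflict_walk :: "(nat \<Rightarrow> 'a option) \<Rightarrow> nat \<Rightarrow> bool" where
  "small_conflict_walk g l \<longleftrightarrow> walk g l \<and> conflict (g 0) (g l) \<and> l \<le> 2 * T \<and>
     (\<forall>h m. m < l \<longrightarrow> walk h m \<longrightarrow> \<not> conflict (h 0) (h m))"

lemma minimal_conflict:
  assumes "a \<in> Q" "b \<in> Q" "conflict a b"
  shows "\<exists>g l. small_conflict_walk g l"
proof -
  define P where "P l \<longleftrightarrow> (\<exists>g. walk g l \<and> conflict (g 0) (g l))" for l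
  obtain g l where g: "walk g l" "g 0 = a" "g l = b" "l \<le> 2 * T" using walk_between assms by blast
  then have Pl: "P l" unfolding P_def using assms by blast
  define m where "m = (LEAST l. P l)"
  have "P m" unfolding m_def using Pl by (rule LeastI)
  moreover have "m \<le> 2 * T" using Least_le[of P l] Pl g(4) unfolding m_def by simp
  moreover have "\<not> P k" if "k < m" for k using that not_less_Least unfolding m_def by blast
  ultimately show ?thesis unfolding P_def small_conflict_walk_def by metis
qed

lemma shortcut:
  assumes g: "walk g l" and s: "0 < s" "i + s \<le> l"
    and step: "Suc i + s \<le> l \<Longrightarrow> adj (g i) (g (Suc i + s))" and stop: "i + s = l \<Longrightarrow> g i = g l"
  shows "\<exists>h. walk h (l - s) \<and> h 0 = g 0 \<and> h (l - s) = g l"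
proof -
  define h where "h x = (if x \<le> i then g x else g (x + s))" for x
  have "walk h (l - s)" unfolding walk_def
  proof (intro conjI allI impI)
    fix x assume "x \<le> l - s"
    then show "h x \<in> Q" using g s by (auto simp: h_def walk_def)
  next
    fix x assume x: "x < l - s"
    consider "x < i" | "x = i" | "x > i" by linarith
    then show "adj (h x) (h (Suc x))"
    proof cases
      case 1
      then show ?thesis using g s by (auto simp: h_def walk_def)
    next
      case 2
      then show ?thesis using step x by (simp add: h_def)
    next
      case 3
      then have "adj (g (x + s)) (g (Suc (x + s)))" using g x by (auto simp: walk_def)
      then show ?thesis using 3 by (simp add: h_def)
    qed
  qed
  moreover have "h (l - s) = g l"
  proof (cases "i + s = l")
    case True
    then show ?thesis using stop s by (auto simp: h_def)
  next
    case False
    then have "i < l - s" "l - s + s = l" using s by linarith+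
    then show ?thesis by (simp add: h_def)
  qed
  ultimately show ?thesis by (auto simp: h_def)
qed

lemma shortest:
  assumes "small_conflict_walk g l"
  shows shortest_distinct: "i < j \<Longrightarrow> j \<le> l \<Longrightarrow> g i \<noteq> g j"
    and shortest_clean: "i < j \<Longrightarrow> j \<le> l \<Longrightarrow> (i, j) \<noteq> (0, l) \<Longrightarrow> \<not> conflict (g i) (g j)"
    and shortest_induced: "i + 2 \<le> j \<Longrightarrow> j \<le> l \<Longrightarrow> \<not> adj (g i) (g j)"
proof -
  have g: "walk g l" "conflict (g 0) (g l)"
    and min: "\<And>h m. m < l \<Longrightarrow> walk h m \<Longrightarrow> \<not> conflict (h 0) (h m)"
    using assms unfolding small_conflict_walk_def by auto
  have no_shortcut: False if c: "0 < k" "i + k \<le> l" "Suc i + k \<le> l \<Longrightarrow> adj (g i) (g (Suc i + k))"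
    "i + k = l \<Longrightarrow> g i = g l" for i k
  proof -
    obtain h where "walk h (l - k)" "h 0 = g 0" "h (l - k) = g l" using shortcut[OF g(1) c] by blast
    then show False using min[of "l - k" h] g(2) c by simp
  qed
  show "g i \<noteq> g j" if ij: "i < j" "j \<le> l"
  proof
    assume eq: "g i = g j"
    show False
    proof (rule no_shortcut[of "j - i" i])
      show "adj (g i) (g (Suc i + (j - i)))" if "Suc i + (j - i) \<le> l"
        using g(1) ij that eq unfolding walk_def by auto
    qed (use ij eq in auto)
  qed
  show "\<not> conflict (g i) (g j)" if ij: "i < j" "j \<le> l" "(i, j) \<noteq> (0, l)"
  proof -
    define h where "h x = g (i + x)" for x
    have "walk h (j - i)" using g(1) ij unfolding walk_def h_def by auto
    moreover have "h 0 = g i" "h (j - i) = g j" using ij by (auto simp: h_def)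
    moreover have "j - i < l" using ij by auto
    ultimately show ?thesis using min[of "j - i" h] by simp
  qed
  show "\<not> adj (g i) (g j)" if ij: "i + 2 \<le> j" "j \<le> l"
  proof
    assume "adj (g i) (g j)"
    then show False using ij by (intro no_shortcut[of "j - i - 1" i]) auto
  qed
qed

text \<open>Minimality turns the walk into a cycle of edges: neighbours meet in one vertex, other
  pairs are disjoint, and only the two ends may meet irregularly. This is all that remains of the
  recolouring in the geometric argument that follows.\<close>

lemma shortest_edges:
  assumes g: "small_conflict_walk g l"
  shows "1 \<le> l"
    and "l = 1 \<Longrightarrow> 2 \<le> card (edge (g 0) \<inter> edge (g 1))"
    and "2 \<le> l \<Longrightarrow> i < l \<Longrightarrow> card (edge (g i) \<inter> edge (g (Suc i))) = 1"
    and "i + 2 \<le> j \<Longrightarrow> j \<le> l \<Longrightarrow> (i, j) \<noteq> (0, l) \<Longrightarrow> edge (g i) \<inter> edge (g j) = {}"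
    and "2 \<le> l \<Longrightarrow> edge (g 0) \<inter> edge (g l) \<noteq> {}"
    and "i + 2 \<le> l \<Longrightarrow> edge (g i) \<inter> edge (g (Suc i)) \<inter> edge (g (Suc (Suc i))) = {}"
proof -
  have w: "walk g l" "conflict (g 0) (g l)" using g unfolding small_conflict_walk_def by auto
  have inQ: "g i \<in> Q" if "i \<le> l" for i using w(1) that unfolding walk_def by auto
  have ad: "adj (g i) (g (Suc i))" if "i < l" for i using w(1) that unfolding walk_def by auto
  show l1: "1 \<le> l"
  proof (rule ccontr)
    assume "\<not> 1 \<le> l"
    then have "l = 0" by simp
    then show False using w(2) unfolding conflict_def by simp
  qed
  show "2 \<le> card (edge (g 0) \<inter> edge (g 1))" if "l = 1"
    using w(2) ad[of 0] that unfolding conflict_def by simp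
  have one: "card (edge (g i) \<inter> edge (g (Suc i))) = 1" if il: "2 \<le> l" "i < l" for i
  proof -
    have i: "g i \<in> Q" "g (Suc i) \<in> Q" using inQ il by auto
    have "\<not> conflict (g i) (g (Suc i))" by (rule shortest_clean[OF g]) (use il in auto)
    moreover have "g i \<noteq> g (Suc i)" by (rule shortest_distinct[OF g]) (use il in auto)
    ultimately have "card (edge (g i) \<inter> edge (g (Suc i))) < 2" using ad[OF il(2)] unfolding
      conflict_def by auto
    moreover obtain v where "v \<in> edge (g i)" "v \<in> edge (g (Suc i))" by (rule link[OF ad[OF il(2)] i])
    then have "card (edge (g i) \<inter> edge (g (Suc i))) > 0" using fin_edge[OF i(1)] by (auto simp:
      card_gt_0_iff)
    ultimately show ?thesis by linarith
  qed
  show "card (edge (g i) \<inter> edge (g (Suc i))) = 1" if "2 \<le> l" "i < l" using one that .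
  show "edge (g i) \<inter> edge (g j) = {}" if "i + 2 \<le> j" "j \<le> l" "(i, j) \<noteq> (0, l)"
  proof -
    have "\<not> conflict (g i) (g j)" by (rule shortest_clean[OF g]) (use that in auto)
    moreover have "g i \<noteq> g j" by (rule shortest_distinct[OF g]) (use that in auto)
    moreover have "\<not> adj (g i) (g j)" by (rule shortest_induced[OF g]) (use that in auto)
    ultimately show ?thesis unfolding conflict_def by blast
  qed
  show "edge (g 0) \<inter> edge (g l) \<noteq> {}" if "2 \<le> l"
  proof -
    have "\<not> adj (g 0) (g l)" by (rule shortest_induced[OF g]) (use that in auto)
    then show ?thesis using w(2) unfolding conflict_def by blast
  qed
  show "edge (g i) \<inter> edge (g (Suc i)) \<inter> edge (g (Suc (Suc i))) = {}" if i: "i + 2 \<le> l"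
  proof (rule ccontr)
    assume "edge (g i) \<inter> edge (g (Suc i)) \<inter> edge (g (Suc (Suc i))) \<noteq> {}"
    then obtain x where x: "x \<in> edge (g i) \<inter> edge (g (Suc i))" "x \<in> edge (g (Suc i)) \<inter> edge (g
      (Suc (Suc i)))" by auto
    have Qs: "g i \<in> Q" "g (Suc i) \<in> Q" "g (Suc (Suc i)) \<in> Q" using inQ i by auto
    have uniq: "y = x" if "card A = 1" "x \<in> A" "y \<in> A" for A :: "'a set" and x y
      using that by (metis card_1_singletonE singletonD)
    have il: "i < l" "Suc i < l" "2 \<le> l" using i by auto
    obtain v where v: "v \<in> edge (g i)" "v \<in> edge (g (Suc i))"
      "(g i = Some v \<and> par (g i) = g (Suc i)) \<or> (g (Suc i) = Some v \<and> par (g (Suc i)) = g i)"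
      by (rule link[OF ad[OF il(1)] Qs(1,2)])
    obtain u where u: "u \<in> edge (g (Suc i))" "u \<in> edge (g (Suc (Suc i)))"
      "(g (Suc i) = Some u \<and> par (g (Suc i)) = g (Suc (Suc i))) \<or> (g (Suc (Suc i)) = Some u \<and> par
        (g (Suc (Suc i))) = g (Suc i))"
      by (rule link[OF ad[OF il(2)] Qs(2,3)])
    \<comment> \<open>A vertex common to three consecutive edges would be the link of both steps.
      But \<open>Some x\<close> is one node with one parent, so two of the three nodes would
      coincide.\<close>
    have "v = x" using uniq[OF one[OF il(3,1)] x(1), of v] v by auto
    moreover have "u = x" using uniq[OF one[OF il(3,2)] x(2), of u] u by auto
    moreover have "g i \<noteq> g (Suc (Suc i))" "g i \<noteq> g (Suc i)" "g (Suc i) \<noteq> g (Suc (Suc i))"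
      by (rule shortest_distinct[OF g]; use i in simp)+
    ultimately show False using u(3) v(3) by auto
  qed
qed

end

section \<open>Closed chains with many vertices\<close>

lemma union_of_chain:
  fixes e :: "nat \<Rightarrow> 'a set"
  assumes n: "n \<ge> 1" and ce: "\<And>i. i \<le> m \<Longrightarrow> finite (e i) \<and> card (e i) = n"
    and meet: "\<And>i. i < m \<Longrightarrow> card (e (Suc i) \<inter> (\<Union>j\<le>i. e j)) \<le> 1"
  shows "m * (n - 1) + n \<le> card (\<Union>j\<le>m. e j)"
  using ce meet
proof (induction m)
  case 0
  then show ?case by simp
next
  case (Suc m)
  let ?U = "\<Union>j\<le>m. e j"
  have IH: "m * (n - 1) + n \<le> card ?U" using Suc by simp
  have fin: "finite ?U" "finite (e (Suc m))" using Suc.prems by auto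
  have "card ?U + card (e (Suc m)) = card (?U \<union> e (Suc m)) + card (e (Suc m) \<inter> ?U)"
    using card_Un_Int[OF fin] by (simp add: Int_commute)
  moreover have "card (e (Suc m) \<inter> ?U) \<le> 1" using Suc.prems by simp
  moreover have "(\<Union>j\<le>Suc m. e j) = ?U \<union> e (Suc m)" by (auto simp: atMost_Suc)
  moreover have "card (e (Suc m)) = n" using Suc.prems by simp
  ultimately show ?case using IH n by simp
qed

text \<open>The chain can be far from loose only where its ends meet. If the ends share at least
  2n/3 vertices, they are merged into one block and the chain gets shorter; if they share fewer, the
  last edge adds a fraction of n of new vertices. Both ways lead to \<open>spread\<close>.\<close>

lemma loose_cycle:
  fixes e :: "nat \<Rightarrow> 'a set"
  assumes n8: "n \<ge> 8" and eE: "\<And>i. i \<le> l \<Longrightarrow> e i \<in> E" and cardE: "\<And>e. e \<in> E \<Longrightarrow> finite e \<and> card e = n"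
    and l1: "1 \<le> l" and two: "l = 1 \<Longrightarrow> 2 \<le> card (e 0 \<inter> e 1)"
    and one: "\<And>i. 2 \<le> l \<Longrightarrow> i < l \<Longrightarrow> card (e i \<inter> e (Suc i)) = 1"
    and dis: "\<And>i j. i + 2 \<le> j \<Longrightarrow> j \<le> l \<Longrightarrow> (i, j) \<noteq> (0, l) \<Longrightarrow> e i \<inter> e j = {}"
    and clo: "2 \<le> l \<Longrightarrow> e 0 \<inter> e l \<noteq> {}"
    and tri: "\<And>i. i + 2 \<le> l \<Longrightarrow> e i \<inter> e (Suc i) \<inter> e (Suc (Suc i)) = {}"
    and small: "l = 1 \<Longrightarrow> 3 * card (e 0 \<inter> e 1) < 2 * n"
  shows "\<exists>bs. cyc n E bs \<and> spread n bs \<and> length bs \<le> Suc l \<and> (\<forall>i<length bs. fst (bs ! i) = e i)"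
proof (cases "l = 1")
  case True
  define bs where "bs = [(e 0, e 0), (e 1, e 1)]"
  have E01: "e 0 \<in> E" "e 1 \<in> E" using eE True by auto
  have c: "finite (e 0)" "finite (e 1)" "card (e 0) = n" "card (e 1) = n" using cardE E01 by auto
  obtain x y where xy: "x \<in> e 0 \<inter> e 1" "y \<in> e 0 \<inter> e 1" "x \<noteq> y"
  proof -
    obtain S where "S \<subseteq> e 0 \<inter> e 1" "card S = 2" using obtain_subset_with_card_n[OF two[OF True]] by blast
    then show thesis using that by (auto simp: card_2_iff)
  qed
  have "cyc n E bs" unfolding links_def
  proof (intro conjI exI[of _ "[x, y]"])
    show "\<forall>i<length bs. [x, y] ! i \<in> body (bs ! i) \<inter> body (bs ! (Suc i mod length bs))"
      using xy by (auto simp: bs_def body_def less_Suc_eq)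
  qed (use xy c E01 in \<open>auto simp: bs_def blocks_def\<close>)
  moreover have "spread n bs"
  proof -
    have "card (e 0 \<union> e 1) + card (e 0 \<inter> e 1) = 2 * n" using card_Un_Int[of "e 0" "e 1"] c by simp
    then have "n - 1 + 1 + n div 4 \<le> card (e 0 \<union> e 1)" using small[OF True] n8 by linarith
    then show ?thesis unfolding spread_def bs_def by simp
  qed
  ultimately show ?thesis using True
    by (intro exI[of _ bs]) (auto simp: bs_def less_Suc_eq)
next
  case False
  then have l2: "2 \<le> l" using l1 by simp
  have c: "finite (e i)" "card (e i) = n" if "i \<le> l" for i using cardE eE that by auto
  have "\<exists>x. x \<in> e i \<inter> e (Suc i)" if "i < l" for i using one[OF l2 that] by (metis
    card_1_singletonE insertI1)
  then obtain x0 where x0: "\<And>i. i < l \<Longrightarrow> x0 i \<in> e i \<inter> e (Suc i)" by metis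
  obtain z where z: "z \<in> e 0 \<inter> e l" using clo[OF l2] by auto
  define x where "x i = (if i < l then x0 i else z)" for i
  have x: "i < l \<Longrightarrow> x i \<in> e i \<and> x i \<in> e (Suc i)" "x l \<in> e 0 \<and> x l \<in> e l" for i
    using x0 z unfolding x_def by auto
  \<comment> \<open>Two equal linking points would lie either in two edges that are not neighbours,
    or in three consecutive edges. The cases separate the closing point z and the short cycle l =
    2.\<close>
  have xneq: "x i \<noteq> x j" if ij: "i < j" "j \<le> l" for i j
  proof
    assume eq: "x i = x j"
    consider "j < l" "j = Suc i" | "j < l" "i + 2 \<le> j" | "j = l" "i = 0" "l = 2" | "j = l" "i = 0" "l \<ge> 3"
      | "j = l" "i \<ge> 1" "i + 2 \<le> l" | "j = l" "i \<ge> 2" "i + 1 = l" | "j = l" "i = 1" "l = 2"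
    proof (cases "j < l")
      case True
      then show thesis using that(1,2) ij by (cases "j = Suc i") auto
    next
      case False
      then have j: "j = l" using ij by simp
      consider "i = 0" | "i = 1" | "i \<ge> 2" by linarith
      then show thesis
      proof cases
        case 1
        then show thesis using that(3,4) j l2 by (cases "l = 2") auto
      next
        case 2
        then show thesis using that(5,7) j ij by (cases "l = 2") auto
      next
        case 3
        then show thesis using that(5,6) j ij by (cases "i + 1 = l") auto
      qed
    qed
    then show False
    proof cases
      case 1
      then have "x i \<in> e i \<inter> e (Suc i) \<inter> e (Suc (Suc i))" using x(1)[of i] x(1)[of j] eq ij by auto
      then show ?thesis using tri[of i] 1 by auto
    next
      case 2
      then have "x i \<in> e i \<inter> e j" using x(1)[of i] x(1)[of j] eq ij by auto
      then show ?thesis using dis[of i j] 2 by auto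
    next
      case 3
      then have "x 0 \<in> e 0 \<inter> e (Suc 0) \<inter> e (Suc (Suc 0))" using x(1)[of 0] x(2) eq by (auto simp:
        numeral_2_eq_2)
      then show ?thesis using tri[of 0] 3 by auto
    next
      case 4
      then have "x 0 \<in> e 1 \<inter> e l" using x(1)[of 0] x(2) eq by auto
      then show ?thesis using dis[of 1 l] 4 by auto
    next
      case 5
      then have "x i \<in> e i \<inter> e l" using x(1)[of i] x(2) eq by auto
      then show ?thesis using dis[of i l] 5 by auto
    next
      case 6
      then have "x i \<in> e 0 \<inter> e i" using x(1)[of i] x(2) eq by auto
      then show ?thesis using dis[of 0 i] 6 by auto
    next
      case 7
      then have "x 1 \<in> e 0 \<inter> e (Suc 0) \<inter> e (Suc (Suc 0))" using x(1)[of 1] x(2) eq by (auto simp: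
        numeral_2_eq_2)
      then show ?thesis using tri[of 0] 7 by auto
    qed
  qed
  have inj: "inj_on x {..l}"
    by (rule inj_onI) (metis atMost_iff linorder_neqE_nat xneq)
  have meet: "card (e (Suc i) \<inter> (\<Union>j\<le>i. e j)) \<le> 1" if "Suc i < l" for i
  proof -
    have "e (Suc i) \<inter> (\<Union>j\<le>i. e j) \<subseteq> e i \<inter> e (Suc i)"
    proof
      fix y assume y: "y \<in> e (Suc i) \<inter> (\<Union>j\<le>i. e j)"
      then obtain j where j: "j \<le> i" "y \<in> e j" by auto
      show "y \<in> e i \<inter> e (Suc i)"
      proof (cases "j = i")
        case False
        then have "e j \<inter> e (Suc i) = {}" using dis[of j "Suc i"] j that by auto
        then show ?thesis using y j by auto
      qed (use y j in auto)
    qed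
    then have "card (e (Suc i) \<inter> (\<Union>j\<le>i. e j)) \<le> card (e i \<inter> e (Suc i))"
      by (rule card_mono[rotated]) (use c[of i] that in auto)
    then show ?thesis using one[OF l2, of i] that by simp
  qed
  have path: "(l - 1) * (n - 1) + n \<le> card (\<Union>j\<le>l - 1. e j)"
    by (rule union_of_chain) (use n8 c meet l2 in auto)
  show ?thesis
  proof (cases "2 * n \<le> 3 * card (e 0 \<inter> e l)")
    case True
    \<comment> \<open>The last edge becomes the second half of the first block. It only carries the
      link from \<open>e (l - 1)\<close> and adds no vertices: the l edges before it already satisfy
      \<open>spread\<close> for length l.\<close>
    define b where "b i = (e i, if i = 0 then e l else e i)" for i
    define bs where "bs = map b [0..<l]"
    have nth: "bs ! i = b i" if "i < l" for i using that by (simp add: bs_def)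
    have len: "length bs = l" by (simp add: bs_def)
    have "cyc n E bs" unfolding links_def len
    proof (intro conjI exI[of _ "map x [0..<l]"])
      show "set bs \<subseteq> blocks n E" using eE c True by (auto simp: bs_def b_def blocks_def)
      show "distinct (map x [0..<l])" using inj by (auto simp: distinct_map intro: inj_on_subset)
      show "\<forall>i<l. map x [0..<l] ! i \<in> body (bs ! i) \<inter> body (bs ! (Suc i mod l))"
      proof (intro allI impI)
        fix i assume i: "i < l"
        show "map x [0..<l] ! i \<in> body (bs ! i) \<inter> body (bs ! (Suc i mod l))"
        proof (cases "Suc i = l")
          case True
          then show ?thesis using x(1)[OF i] i nth[of i] nth[of 0] l2 by (auto simp: body_def b_def)
        next
          case False
          then show ?thesis using x(1)[OF i] i nth[of i] nth[of "Suc i"] by (auto simp: body_def b_def)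
        qed
      qed
    qed (use l2 in auto)
    moreover have "spread n bs"
    proof -
      have "{0..<l} = {..l - 1}" using l2 by auto
      then have "(\<Union>b\<in>set bs. fst b) = (\<Union>j\<le>l - 1. e j)" by (auto simp: bs_def b_def)
      then show ?thesis unfolding spread_def len using path n8 by simp
    qed
    ultimately show ?thesis using nth len by (intro exI[of _ bs]) (auto simp: b_def)
  next
    case False
    define b where "b i = (e i, e i)" for i
    define bs where "bs = map b [0..<Suc l]"
    have nth: "bs ! i = b i" if "i < Suc l" for i using that by (simp add: bs_def del: upt_Suc)
    have len: "length bs = Suc l" by (simp add: bs_def)
    have "cyc n E bs" unfolding links_def len
    proof (intro conjI exI[of _ "map x [0..<Suc l]"])
      show "set bs \<subseteq> blocks n E" using eE c by (auto simp: bs_def b_def blocks_def)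
      show "distinct (map x [0..<Suc l])" using inj
        by (simp add: distinct_map atLeast0LessThan lessThan_Suc_atMost del: upt_Suc)
      show "\<forall>i<Suc l. map x [0..<Suc l] ! i \<in> body (bs ! i) \<inter> body (bs ! (Suc i mod Suc l))"
      proof (intro allI impI)
        fix i assume i: "i < Suc l"
        show "map x [0..<Suc l] ! i \<in> body (bs ! i) \<inter> body (bs ! (Suc i mod Suc l))"
        proof (cases "i = l")
          case True
          then show ?thesis using x(2) nth[of l] nth[of 0] by (auto simp: body_def b_def simp del: upt_Suc)
        next
          case False
          then show ?thesis using x(1)[of i] i nth[of i] nth[of "Suc i"] by (auto simp: body_def
            b_def simp del: upt_Suc)
        qed
      qed
    qed (use l2 in auto)
    moreover have "spread n bs"
    proof -
      let ?U = "\<Union>j\<le>l - 1. e j"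
      have fin: "finite ?U" "finite (e l)" using c by auto
      \<comment> \<open>Among the earlier edges only \<open>e (l - 1)\<close> and \<open>e 0\<close>
        meet \<open>e l\<close>, the former in one vertex and the latter in fewer than 2n/3, so more
        than n/3 - 1 vertices of \<open>e l\<close> are new.\<close>
      have "?U \<inter> e l \<subseteq> (e (l - 1) \<inter> e l) \<union> (e 0 \<inter> e l)"
      proof
        fix y assume y: "y \<in> ?U \<inter> e l"
        then obtain j where j: "j \<le> l - 1" "y \<in> e j" by auto
        consider "j = l - 1" | "j = 0" | "j \<noteq> 0" "j + 2 \<le> l" using j(1) by linarith
        then show "y \<in> (e (l - 1) \<inter> e l) \<union> (e 0 \<inter> e l)"
        proof cases
          case 3
          then have "e j \<inter> e l = {}" using dis[of j l] by auto
          then show ?thesis using y j by auto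
        qed (use y j in auto)
      qed
      then have "card (?U \<inter> e l) \<le> card ((e (l - 1) \<inter> e l) \<union> (e 0 \<inter> e l))"
        by (rule card_mono[rotated]) (use c[of l] in auto)
      also have "\<dots> \<le> card (e (l - 1) \<inter> e l) + card (e 0 \<inter> e l)" by (rule card_Un_le)
      also have "card (e (l - 1) \<inter> e l) = 1" using one[OF l2, of "l - 1"] l2 by simp
      finally have "card (?U \<inter> e l) \<le> 1 + card (e 0 \<inter> e l)" .
      moreover have "card ?U + card (e l) = card (?U \<union> e l) + card (?U \<inter> e l)" using card_Un_Int[OF fin] .
      moreover have "3 * card (e 0 \<inter> e l) < 2 * n" using False by simp
      ultimately have "(l - 1) * (n - 1) + n + n div 4 \<le> card (?U \<union> e l)"
        using path c[of l] n8 by linarith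
      moreover have "(l - 1) * (n - 1) + n = l * (n - 1) + 1"
        using l2 n8 by (cases l) auto
      moreover have "(\<Union>b\<in>set bs. fst b) = ?U \<union> e l"
      proof -
        have "{0..<Suc l} = insert l {..l - 1}" using l2 by auto
        then show ?thesis by (auto simp: bs_def b_def simp del: upt_Suc)
      qed
      ultimately show ?thesis unfolding spread_def len by simp
    qed
    ultimately show ?thesis using nth len by (intro exI[of _ bs]) (auto simp: b_def)
  qed
qed

section \<open>A monochromatic edge forces an exceptional event\<close>

context bad_edge
begin

text \<open>A vertex with label at least R never flips and shows its initial colour in both edges,
  whereas the colours of linked edges differ by one step mod r, which is a real change as r \<ge>
  2.\<close>

lemma shared_free:
  assumes "a \<in> Q" "b \<in> Q" "adj a b" "x \<in> edge a \<inter> edge b"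
  shows "snd (w x) < R"
proof (rule ccontr)
  assume "\<not> snd (w x) < R"
  then have "x \<notin> flip t" for t using free by blast
  then have "kap a = fst (w x)" "kap b = fst (w x)"
    using kap[OF assms(1), of x] kap[OF assms(2), of x] assms(4) by (auto simp: shown_def)
  then have "Suc (kap a) mod r = kap a" using adj_kap[OF assms(3,1,2)] by auto
  moreover have "kap a < r" by (rule kap_less[OF assms(1)])
  ultimately show False using r2 by (cases "Suc (kap a) = r") auto
qed

lemma conflict_event:
  assumes "a \<in> Q" "b \<in> Q" "conflict a b"
  shows "dense_event E n r R w \<or> cyc_event E n r R (2 * T + 1) w"
proof -
  obtain g l where g: "small_conflict_walk g l" using minimal_conflict[OF assms] by blast
  then have gl: "walk g l" "conflict (g 0) (g l)" "l \<le> 2 * T" unfolding small_conflict_walk_def by blast+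
  have inQ: "g i \<in> Q" if "i \<le> l" for i using gl(1) that unfolding walk_def by auto
  note se = shortest_edges[OF g]
  show ?thesis
  proof (cases "l = 1 \<and> 2 * n \<le> 3 * card (edge (g 0) \<inter> edge (g 1))")
    case True
    have Q01: "g 0 \<in> Q" "g 1 \<in> Q" "adj (g 0) (g 1)" using inQ True gl(1) unfolding walk_def by auto
    \<comment> \<open>Two linked edges with so large an overlap have too few vertices to satisfy
      \<open>spread\<close>; the labels of the common vertices are used instead.\<close>
    have "dense_event E n r R w" unfolding dense_event_def
    proof (intro bexI[of _ "edge (g 0)"] exI[of _ "kap (g 0)"] conjI exI[of _ "edge (g 0) \<inter> edge (g 1)"])
      show "\<forall>u\<in>edge (g 0) \<inter> edge (g 1). snd (w u) < R" using shared_free Q01 by blast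
    qed (use True Q01 kap_less kap_near Q_edge in auto)
    then show ?thesis ..
  next
    case False
    have "\<exists>bs. cyc n E bs \<and> spread n bs \<and> length bs \<le> Suc l \<and> (\<forall>i<length bs. fst (bs ! i) = edge (g i))"
      by (rule loose_cycle[OF n8 _ _ se]) (use inQ Q_edge finite_edge cardE False in auto)
    then obtain bs where bs: "cyc n E bs" "spread n bs" "length bs \<le> Suc l"
      "\<And>i. i < length bs \<Longrightarrow> fst (bs ! i) = edge (g i)" by blast
    define ks where "ks = map (\<lambda>i. kap (g i)) [0..<length bs]"
    have ks: "ks ! i = kap (g i)" if "i < length bs" for i using that by (simp add: ks_def)
    have "steps r ks" unfolding steps_def
    proof (intro conjI ballI allI impI)
      fix k assume "k \<in> set ks"
      then show "k < r" using kap_less inQ bs(3) by (auto simp: ks_def)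
    next
      fix i assume i: "Suc i < length ks"
      then have i': "Suc i < length bs" by (simp add: ks_def)
      then have "adj (g i) (g (Suc i))" "g i \<in> Q" "g (Suc i) \<in> Q" using gl(1) bs(3) unfolding
        walk_def by auto
      from adj_kap[OF this] show "ks ! Suc i = Suc (ks ! i) mod r \<or> ks ! i = Suc (ks ! Suc i) mod r"
        using ks i' by auto
    qed
    moreover have "\<forall>i<length bs. \<forall>u\<in>fst (bs ! i). w u \<in> near r R (ks ! i)"
      using ks bs(3,4) inQ kap_near by auto
    moreover have "length ks = length bs" by (simp add: ks_def)
    moreover have "length bs \<le> 2 * T + 1" using bs(3) gl(3) by linarith
    ultimately have "cyc_event E n r R (2 * T + 1) w" unfolding cyc_event_def using bs(1,2) by blast
    then show ?thesis ..
  qed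
qed

text \<open>An edge that is monochromatic in round t and still has a vertex to flip cannot have been
  monochromatic before, hence one of its vertices was flipped in round t - 1.\<close>

lemma generations:
  assumes u: "u \<in> f - flip T" "snd (w u) < R"
  shows "s \<le> T \<Longrightarrow> \<exists>a\<in>Q. time a = T - s \<and> (\<exists>u\<in>edge a - flip (time a). snd (w u) < R)"
proof (induction s)
  case 0
  then show ?case using u Q.root by (intro bexI[of _ None]) (auto simp: time_def edge_def)
next
  case (Suc s)
  then obtain a u where a: "a \<in> Q" "time a = T - s" "u \<in> edge a - flip (time a)" "snd (w u) < R" by auto
  define t where "t = T - Suc s"
  have ta: "time a = Suc t" using a(2) Suc.prems unfolding t_def by simp
  have "edge a \<inter> flip (Suc t) \<noteq> edge a \<inter> flip t"
  proof
    assume eq: "edge a \<inter> flip (Suc t) = edge a \<inter> flip t"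
    have eqv: "shown (flip t) x = shown (flip (Suc t)) x" if "x \<in> edge a" for x
    proof -
      have "x \<in> flip t \<longleftrightarrow> x \<in> flip (Suc t)" using eq that by blast
      then show ?thesis unfolding shown_def by simp
    qed
    have m: "monochromatic (flip t) (edge a)"
      using Q_edge(2)[OF a(1)] eqv unfolding monochromatic_def ta by auto
    have un: "u \<in> edge a - flip t" using a(3) ta by auto
    have "finite (edge a - flip t)" using fin_edge[OF a(1)] by auto
    then obtain v where v: "v \<in> edge a - flip t" "\<forall>x\<in>edge a - flip t. snd (w v) \<le> snd (w x)"
      using un ex_is_arg_min_if_finite[of "edge a - flip t" "\<lambda>x. snd (w x)"]
      unfolding is_arg_min_linorder by blast
    then have "snd (w v) < R" using un a(4) by (meson le_less_trans)
    then have "trigger (flip t) (edge a) v" using v m Q_edge(1)[OF a(1)] unfolding trigger_def by auto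
    then have "v \<in> flip (Suc t)" by auto
    then show False using eq v by blast
  qed
  then obtain x where x: "x \<in> edge a" "x \<in> flip (Suc t)" "x \<notin> flip t" using flip_le[of t "Suc t"]
    by (auto simp del: flip.simps)
  have xQ: "Some x \<in> Q" by (rule Q.child[OF a(1) x(1)]) (use x ta in simp)
  have "birth x = t"
  proof (rule ccontr)
    assume "birth x \<noteq> t"
    then have "Suc (birth x) \<le> t" using birth(3)[OF x(2)] by simp
    then show False using birth(1)[OF x(2)] x(3) flip_le by blast
  qed
  then have "time (Some x) = T - Suc s" by (simp add: time_def t_def)
  moreover have "x \<in> edge (Some x) - flip (time (Some x))" using in_edge[OF xQ] by simp
  moreover have "snd (w x) < R" using free x(2) by blast
  ultimately show ?case using xQ by blast
qed

definition pnode :: "'a option \<Rightarrow> 'a node" where "pnode a = (edge a, a)"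

text \<open>Without conflicts the hooks of a node are exactly its vertices flipped before its time,
  and its own set is the unflipped rest. Two edges meet at most in the vertex of a parent link,
  which is a hook of the parent and an own vertex of the child; hence both kinds of sets are
  disjoint between nodes.\<close>

lemma no_conflict_event:
  assumes nc: "\<And>a b. a \<in> Q \<Longrightarrow> b \<in> Q \<Longrightarrow> \<not> conflict a b"
  shows "tree_event E r R T w"
proof -
  define P where "P = pnode ` Q"
  have injp: "inj_on pnode Q" by (auto simp: inj_on_def pnode_def)
  have PE: "p \<in> P \<longleftrightarrow> (\<exists>a\<in>Q. p = pnode a)" for p unfolding P_def by auto
  have finP: "finite P" unfolding P_def using finite_Q by simp
  have cardP: "card P = card Q" unfolding P_def by (rule card_image[OF injp])
  have meet: "\<exists>v. edge a \<inter> edge b = {v} \<and> ((a = Some v \<and> par a = b) \<or> (b = Some v \<and> par b = a))"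
    if ab: "a \<in> Q" "b \<in> Q" "a \<noteq> b" "edge a \<inter> edge b \<noteq> {}" for a b
  proof -
    have c: "adj a b" "card (edge a \<inter> edge b) < 2" using nc[OF ab(1,2)] ab(3,4) unfolding
      conflict_def by auto
    obtain v where v: "v \<in> edge a" "v \<in> edge b" "(a = Some v \<and> par a = b) \<or> (b = Some v \<and> par b = a)"
      by (rule link[OF c(1) ab(1,2)])
    have "card (edge a \<inter> edge b) \<noteq> 0" using v(1,2) fin_edge[OF ab(1)] by auto
    then have "card (edge a \<inter> edge b) = 1" using c(2) by linarith
    then show ?thesis using v by (metis IntI card_1_singletonE singletonD)
  qed
  have hooks: "hooks P (pnode a) = edge a \<inter> flip (time a)" if a: "a \<in> Q" for a
  proof
    show "hooks P (pnode a) \<subseteq> edge a \<inter> flip (time a)"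
    proof
      fix u assume "u \<in> hooks P (pnode a)"
      then have u: "u \<in> edge a" "Some u \<noteq> a" "Some u \<in> Q" unfolding hooks_def PE pnode_def by auto
      then have "edge a \<inter> edge (Some u) \<noteq> {}" using in_edge by blast
      then obtain v where v: "edge a \<inter> edge (Some u) = {v}"
        "(a = Some v \<and> par a = Some u) \<or> (Some u = Some v \<and> par (Some u) = a)"
        using meet[OF a u(3)] u(2) by blast
      have "u = v" using v(1) u(1) in_edge(1)[OF u(3)] by blast
      then have "par (Some u) = a" using v(2) u(2) by auto
      then show "u \<in> edge a \<inter> flip (time a)" using par[OF u(3)] by auto
    qed
    show "edge a \<inter> flip (time a) \<subseteq> hooks P (pnode a)"
    proof
      fix u assume u: "u \<in> edge a \<inter> flip (time a)"
      then have uQ: "Some u \<in> Q" using Q.child[OF a] by auto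
      have "Some u \<noteq> a" using u in_edge(2)[of u] a by auto
      moreover have "(edge (Some u), Some u) \<in> P" unfolding PE pnode_def using uQ by blast
      ultimately show "u \<in> hooks P (pnode a)" using u unfolding hooks_def pnode_def by auto
    qed
  qed
  have own: "own P (pnode a) = edge a - flip (time a)" if a: "a \<in> Q" for a
    unfolding own_def hooks[OF a] by (auto simp: pnode_def)
  have dis_own: "own P (pnode a) \<inter> own P (pnode b) = {}" if ab: "a \<in> Q" "b \<in> Q" "a \<noteq> b" for a b
  proof (rule ccontr)
    assume "own P (pnode a) \<inter> own P (pnode b) \<noteq> {}"
    then obtain x where x: "x \<in> edge a - flip (time a)" "x \<in> edge b - flip (time b)"
      using own ab by auto
    then have "edge a \<inter> edge b \<noteq> {}" by auto
    then obtain v where v: "edge a \<inter> edge b = {v}" "(a = Some v \<and> par a = b) \<or> (b = Some v \<and> par b = a)"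
      using meet[OF ab] by blast
    have "x = v" using v(1) x by blast
    then show False using v(2) x par(3) ab by auto
  qed
  have dis_hooks: "hooks P (pnode a) \<inter> hooks P (pnode b) = {}" if ab: "a \<in> Q" "b \<in> Q" "a \<noteq> b" for a b
  proof (rule ccontr)
    assume "hooks P (pnode a) \<inter> hooks P (pnode b) \<noteq> {}"
    then obtain x where x: "x \<in> hooks P (pnode a)" "x \<in> hooks P (pnode b)" by auto
    then have x': "x \<in> edge a" "x \<in> edge b" "Some x \<noteq> a" "Some x \<noteq> b" unfolding hooks_def pnode_def by auto
    then have "edge a \<inter> edge b \<noteq> {}" by auto
    then obtain v where v: "edge a \<inter> edge b = {v}" "(a = Some v \<and> par a = b) \<or> (b = Some v \<and> par b = a)"
      using meet[OF ab] by blast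
    have "x = v" using v(1) x' by blast
    then show False using v(2) x' by auto
  qed
  \<comment> \<open>Each hook u belongs to one node and names another one, \<open>Some u\<close>,
    which is never the root; hence there are fewer hooks than nodes.\<close>
  have "(\<Sum>p\<in>P. card (hooks P p)) = (\<Sum>a\<in>Q. card (hooks P (pnode a)))"
    unfolding P_def by (rule sum.reindex[OF injp, unfolded o_def])
  also have "\<dots> = card (\<Union>a\<in>Q. hooks P (pnode a))"
    by (rule card_UN_disjoint[symmetric]) (use finite_Q hooks fin_edge dis_hooks in auto)
  also have "\<dots> \<le> card (the ` (Q - {None}))"
  proof (rule card_mono)
    show "(\<Union>a\<in>Q. hooks P (pnode a)) \<subseteq> the ` (Q - {None})"
    proof
      fix u assume "u \<in> (\<Union>a\<in>Q. hooks P (pnode a))"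
      then have "Some u \<in> Q" unfolding hooks_def PE pnode_def by auto
      then show "u \<in> the ` (Q - {None})" by force
    qed
  qed (use finite_Q in auto)
  also have "\<dots> \<le> card (Q - {None})" by (rule card_image_le) (use finite_Q in auto)
  also have "\<dots> < card P" unfolding cardP by (rule psubset_card_mono) (use finite_Q Q.root in auto)
  finally have sumK: "(\<Sum>p\<in>P. card (hooks P p)) < card P" .
  have "tree E P" unfolding tree_def
  proof (intro conjI)
    show "P \<subseteq> nodes E"
      unfolding P_def nodes_def pnode_def using Q_edge in_edge by auto
    show "\<exists>!p. p \<in> P \<and> snd p = None"
      by (rule ex1I[of _ "pnode None"]) (use Q.root in \<open>auto simp: PE pnode_def\<close>)
    show "\<forall>p\<in>P. \<forall>q\<in>P. p \<noteq> q \<longrightarrow> own P p \<inter> own P q = {}"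
    proof (intro ballI impI)
      fix p q assume "p \<in> P" "q \<in> P" "p \<noteq> q"
      moreover from this obtain a b where "a \<in> Q" "p = pnode a" "b \<in> Q" "q = pnode b" unfolding PE by blast
      ultimately show "own P p \<inter> own P q = {}" using dis_own by blast
    qed
    show "\<exists>rk :: 'a node \<Rightarrow> nat. \<forall>p\<in>P. \<forall>u. snd p = Some u \<longrightarrow> (\<exists>q\<in>P. rk q < rk p \<and> u \<in> hooks P q)"
    proof (intro exI[of _ "\<lambda>p. T - time (snd p)"] ballI allI impI)
      fix p u assume p: "p \<in> P" "snd p = Some u"
      then have uQ: "Some u \<in> Q" "p = pnode (Some u)" by (auto simp: PE pnode_def)
      have "T - time (par (Some u)) < T - time (Some u)"
        using par_time[OF uQ(1)] time_le[OF par(1)[OF uQ(1)]] by linarith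
      moreover have "u \<in> hooks P (pnode (par (Some u)))" using hooks[OF par(1)] par uQ by auto
      ultimately show "\<exists>q\<in>P. T - time (snd q) < T - time (snd p) \<and> u \<in> hooks P q"
        using PE par(1)[OF uQ(1)] uQ(2) by (intro bexI[of _ "pnode (par (Some u))"]) (auto simp: pnode_def)
    qed
  qed (use finP sumK in auto)
  moreover have "colouring r P (\<lambda>p. kap (snd p))" unfolding colouring_def
  proof (intro conjI ballI allI impI)
    fix p assume "p \<in> P"
    then show "kap (snd p) < r" using kap_less by (auto simp: PE pnode_def)
  next
    fix p q u assume pq: "p \<in> P" "q \<in> P" "snd q = Some u" "u \<in> hooks P p"
    then obtain a where a: "a \<in> Q" "p = pnode a" by (auto simp: PE)
    have "kap a = Suc (kap (Some u)) mod r" using hook_kap[OF a(1)] pq(4) hooks[OF a(1)] a(2) by auto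
    then show "kap (snd p) = Suc (kap (snd q)) mod r" using a pq by (simp add: pnode_def)
  qed
  \<comment> \<open>If f still has an unflipped vertex of label below R, \<open>generations\<close>
    provides a node for each time from 0 to T, which makes T + 1 nodes.\<close>
  moreover define q where "q \<longleftrightarrow> (\<forall>u\<in>f - flip T. R \<le> snd (w u))"
  have "q \<or> T < card P"
  proof (rule disjCI)
    assume "\<not> T < card P"
    show q unfolding q_def
    proof (rule ccontr)
      assume "\<not> (\<forall>u\<in>f - flip T. R \<le> snd (w u))"
      then obtain u where u: "u \<in> f - flip T" "snd (w u) < R" by auto
      have "{0..T} \<subseteq> time ` Q"
      proof
        fix t assume t: "t \<in> {0..T}"
        then obtain a where "a \<in> Q" "time a = T - (T - t)" using generations[OF u, of "T - t"] by auto
        then show "t \<in> time ` Q" using t by force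
      qed
      then have "card {0..T} \<le> card Q" by (rule surj_card_le[OF finite_Q])
      then show False using \<open>\<not> T < card P\<close> cardP by simp
    qed
  qed
  moreover have "\<forall>p\<in>P. \<forall>u\<in>own P p. fst (w u) = kap (snd p) \<and> (\<forall>v. snd p = Some v \<longrightarrow> snd (w v) \<le> snd (w u)) \<and>
        (snd p = None \<and> q \<longrightarrow> R \<le> snd (w u))"
  proof (intro ballI)
    fix p u assume p: "p \<in> P" "u \<in> own P p"
    then obtain a where a: "a \<in> Q" "p = pnode a" by (auto simp: PE)
    have u: "u \<in> edge a" "u \<notin> flip (time a)" using own[OF a(1)] p(2) a(2) by auto
    have "fst (w u) = kap a" using kap[OF a(1) u(1)] u(2) by (simp add: shown_def)
    moreover have "snd (w v) \<le> snd (w u)" if "a = Some v" for v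
      using Q_trigger[of v] a(1) that u unfolding trigger_def by auto
    moreover have "R \<le> snd (w u)" if "a = None" q
      using that u unfolding q_def by (auto simp: edge_def time_def)
    ultimately show "fst (w u) = kap (snd p) \<and> (\<forall>v. snd p = Some v \<longrightarrow> snd (w v) \<le> snd (w u)) \<and>
        (snd p = None \<and> q \<longrightarrow> R \<le> snd (w u))" using a(2) by (simp add: pnode_def)
  qed
  ultimately show ?thesis unfolding tree_event_def by blast
qed

end

theorem (in recolouring) recolouring_succeeds:
  assumes "\<not> dense_event E n r R w" "\<not> cyc_event E n r R (2 * T + 1) w" "\<not> tree_event E r R T w"
    and "f \<in> E"
  shows "\<not> monochromatic (flip T) f"
proof
  assume "monochromatic (flip T) f"
  then interpret bad_edge E n r R T w f by unfold_locales (use assms in auto)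
  show False using conflict_event no_conflict_event assms by blast
qed

section \<open>Weight of the dense events\<close>

lemma mass_image_le:
  fixes c :: real
  assumes "finite I" "s \<ge> 0" and c: "\<And>i. i \<in> I \<Longrightarrow> x \<in> fst (f i) \<Longrightarrow> wt s (f i) \<le> c"
  shows "mass s x (f ` I) \<le> card {i\<in>I. x \<in> fst (f i)} * c"
proof -
  have "mass s x (f ` I) \<le> (\<Sum>i\<in>{i\<in>I. x \<in> fst (f i)}. wt s (f i))"
    by (rule mass_image[OF assms(1,2)])
  also have "\<dots> \<le> card {i\<in>I. x \<in> fst (f i)} * c"
    by (rule sum_bounded_above) (use c in auto)
  finally show ?thesis .
qed

lemma card_pred: "card {a. a < r \<and> Suc a mod r = k} \<le> 1"
proof -
  have "inj_on (\<lambda>a. Suc a mod r) {..<r}"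
  proof (rule inj_onI)
    fix a b assume "a \<in> {..<r}" "b \<in> {..<r}" "Suc a mod r = Suc b mod r"
    then show "a = b" by (cases "Suc a = r"; cases "Suc b = r") auto
  qed
  then have "card {a. a < r \<and> Suc a mod r = k} \<le> card {k}"
    by (intro card_inj_on_le[of "\<lambda>a. Suc a mod r"]) (auto intro: inj_on_subset)
  then show ?thesis by simp
qed

definition palette :: "nat \<Rightarrow> nat \<Rightarrow> (nat \<times> nat) set" where
  "palette r n = {..<r} \<times> {..<n}"

text \<open>Colour k itself admits m labels. The only other admissible initial colour is the
  predecessor of k mod r, and it admits the R labels below R.\<close>

lemma card_near_below:
  assumes "\<And>p. p \<in> A \<Longrightarrow> fst p < r \<and> p \<in> near r R k \<and> snd p < m"
  shows "card A \<le> m + R"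
proof -
  let ?A = "{a. a < r \<and> Suc a mod r = k}"
  have "A \<subseteq> ({k} \<times> {..<m}) \<union> (?A \<times> {..<R})" using assms by (force simp: near_def)
  then have "card A \<le> card (({k} \<times> {..<m}) \<union> (?A \<times> {..<R}))" by (rule card_mono[rotated]) auto
  also have "\<dots> \<le> card ({k} \<times> {..<m}) + card (?A \<times> {..<R})" by (rule card_Un_le)
  also have "\<dots> = m + card ?A * R" by (simp add: card_cartesian_product)
  also have "\<dots> \<le> m + 1 * R" using card_pred[of r k] by (intro add_left_mono mult_right_mono) auto
  finally show ?thesis by simp
qed

lemma card_near: "card (near r R k \<inter> palette r n) \<le> n + R"
  by (rule card_near_below) (auto simp: palette_def)

lemma card_near_free: "card ({p \<in> near r R k. snd p < R} \<inter> palette r n) \<le> 2 * R"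
  unfolding mult_2 by (rule card_near_below) (auto simp: palette_def)

definition dense_index :: "'a set set \<Rightarrow> nat \<Rightarrow> nat \<Rightarrow> ('a set \<times> nat \<times> 'a set) set" where
  "dense_index E n r = {(e, k, S). e \<in> E \<and> k < r \<and> S \<subseteq> e \<and> 2 * n \<le> 3 * card S}"

definition dense_box :: "nat \<Rightarrow> nat \<Rightarrow> nat \<Rightarrow> 'a set \<times> nat \<times> 'a set \<Rightarrow> ('a, nat \<times> nat) box" where
  "dense_box n r R = (\<lambda>(e, k, S). (e, \<lambda>u. (if u \<in> S then {p \<in> near r R k. snd p < R} else near r R
    k) \<inter> palette r n))"

lemma dense_event_hits:
  assumes "dense_event E n r R w" and "\<And>e u. e \<in> E \<Longrightarrow> u \<in> e \<Longrightarrow> w u \<in> palette r n"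
  shows "\<exists>b\<in>dense_box n r R ` dense_index E n r. hits w b"
proof -
  obtain e k S where "e \<in> E" "k < r" "S \<subseteq> e" "2 * n \<le> 3 * card S" "\<forall>u\<in>e. w u \<in> near r R k" "\<forall>u\<in>S.
    snd (w u) < R"
    using assms(1) unfolding dense_event_def by auto
  then have "(e, k, S) \<in> dense_index E n r" "hits w (dense_box n r R (e, k, S))"
    using assms(2) unfolding dense_index_def hits_def dense_box_def by auto
  then show ?thesis by blast
qed

text \<open>The constant 512 is tuned as follows: a vertex of S contributes at most 1/(128 r), any
  other at most 4/r, and S has at least 2n/3 elements, so the weight is at most 16^(-n) r^(-n). The
  2^n choices of S leave 8^(-n), and the colour together with the degree cancels r^n.\<close>

lemma mass_dense:
  fixes D :: nat
  assumes finE: "finite E" and cardE: "\<And>e. e \<in> E \<Longrightarrow> finite e \<and> card e = n"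
    and deg: "card {e\<in>E. x \<in> e} \<le> D" and n: "n \<ge> 2" and r: "r \<ge> 1" and R: "512 * R \<le> n"
    and D: "real D \<le> real r ^ (n - 1)"
  shows "finite (dense_box n r R ` dense_index E n r)"
    and "mass (real r * (real n - 1)) x (dense_box n r R ` dense_index E n r) \<le> (1/8) ^ n"
proof -
  let ?I = "dense_index E n r"
  let ?s = "real r * (real n - 1)"
  let ?J = "{i \<in> ?I. x \<in> fst (dense_box n r R i)}"
  have s: "?s > 0" using n r by simp
  have "?I \<subseteq> E \<times> {..<r} \<times> Pow (\<Union>E)" unfolding dense_index_def by auto
  moreover have "finite (E \<times> {..<r} \<times> Pow (\<Union>E))" using finE cardE by auto
  ultimately have finI: "finite ?I" by (rule finite_subset)
  then show "finite (dense_box n r R ` ?I)" by simp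
  have wt1: "wt ?s (dense_box n r R i) \<le> (1 / r) ^ n * (1 / 16) ^ n" if "i \<in> ?I" for i
  proof -
    obtain e k S where i: "i = (e, k, S)" by (cases i)
    have e: "finite e" "card e = n" "S \<subseteq> e" "2 * n \<le> 3 * card S" using that cardE unfolding
      dense_index_def i by auto
    have fS: "finite S" using e finite_subset by blast
    have nn: "real n \<le> 2 * real n - 2" using n by simp
    have scale: "real a / ?s \<le> (1 / r) * c" if "real a \<le> c * (real n - 1)" for a :: nat and c :: real
    proof -
      have "real a / ?s = (1 / r) * (real a / (real n - 1))" by simp
      also have "\<dots> \<le> (1 / r) * c" using that n by (intro mult_left_mono) (auto simp: pos_divide_le_eq)
      finally show ?thesis .
    qed
    have R': "512 * real R \<le> real n" using R by (simp flip: of_nat_le_iff[where 'a = real])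
    have 1: "real (2 * R) / ?s \<le> (1 / r) * (1 / 128)"
      by (rule scale) (use R' nn in simp)
    have 2: "real (n + R) / ?s \<le> (1 / r) * 4"
      by (rule scale) (use R' nn in simp)
    have "wt ?s (dense_box n r R i) = (\<Prod>u\<in>e. real (card ((if u \<in> S then {p \<in> near r R k. snd p <
      R} else near r R k) \<inter> palette r n)) / ?s)"
      unfolding wt_def dense_box_def i by simp
    also have "\<dots> \<le> (\<Prod>u\<in>e. (1 / r) * (if u \<in> S then 1 / 128 else 4))"
    proof (rule prod_mono, intro conjI)
      fix u assume "u \<in> e"
      show "real (card ((if u \<in> S then {p \<in> near r R k. snd p < R} else near r R k) \<inter> palette r
        n)) / ?s \<le> (1 / r) * (if u \<in> S then 1 / 128 else 4)"
      proof (cases "u \<in> S")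
        case True
        have "real (card ({p \<in> near r R k. snd p < R} \<inter> palette r n)) / ?s \<le> real (2 * R) / ?s"
          using card_near_free[of r R k n] s by (intro divide_right_mono) auto
        then show ?thesis using 1 True by auto
      next
        case False
        have "real (card (near r R k \<inter> palette r n)) / ?s \<le> real (n + R) / ?s"
          using card_near[of r R k n] s by (intro divide_right_mono) auto
        then show ?thesis using 2 False by auto
      qed
    qed (use s in auto)
    also have "\<dots> = (1 / r) ^ n * (\<Prod>u\<in>e. if u \<in> S then 1 / 128 else 4)"
      by (simp only: prod.distrib prod_constant e(2))
    also have "(\<Prod>u\<in>e. if u \<in> S then 1 / 128 else 4 :: real) = (1 / 128) ^ card S * 4 ^ (n - card S)"
    proof -
      have "(\<Prod>u\<in>e. if u \<in> S then 1 / 128 else 4 :: real) = (\<Prod>u\<in>S. 1 / 128) * (\<Prod>u\<in>e - S. 4)"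
      proof -
        have "e \<inter> {u. u \<in> S} = S" "e \<inter> - {u. u \<in> S} = e - S" using e(3) by auto
        then show ?thesis by (simp only: prod.If_cases[OF e(1)])
      qed
      then show ?thesis using e fS by (simp add: card_Diff_subset)
    qed
    also have "\<dots> = 4 ^ n * (1 / 512) ^ card S"
    proof -
      have le: "card S \<le> n" using e by (metis card_mono)
      have "4 ^ n = (4 :: real) ^ (n - card S) * 4 ^ card S" using le by (simp flip: power_add)
      moreover have "(1 / 512 :: real) ^ card S * 4 ^ card S = (1 / 128) ^ card S" by (simp flip:
        power_mult_distrib)
      ultimately show ?thesis by (simp add: mult_ac)
    qed
    finally have wt_eq: "wt ?s (dense_box n r R i) \<le> (1 / r) ^ n * (4 ^ n * (1 / 512) ^ card S)" .
    have "(1 / 512 :: real) ^ card S \<le> (1 / 64) ^ n"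
    proof -
      \<comment> \<open>Since 9 is divisible by 3, the size bound 2n/3 turns into the integral
        exponent 6n.\<close>
      have "(1 / 512 :: real) = (1 / 2) ^ 9" by (simp add: power_divide)
      then have "(1 / 512 :: real) ^ card S = (1 / 2) ^ (9 * card S)" by (simp only: power_mult)
      also have "\<dots> \<le> (1 / 2) ^ (6 * n)" using e by (intro power_decreasing) auto
      also have "\<dots> = ((1 / 2) ^ 6) ^ n" by (simp only: power_mult)
      also have "\<dots> = (1 / 64) ^ n" by (simp add: power_divide)
      finally show ?thesis .
    qed
    then have "(4 :: real) ^ n * (1 / 512) ^ card S \<le> 4 ^ n * (1 / 64) ^ n" by (intro mult_left_mono) auto
    also have "\<dots> = (1 / 16) ^ n" by (simp flip: power_mult_distrib)
    finally have "(1 / r) ^ n * (4 ^ n * (1 / 512) ^ card S) \<le> (1 / r) ^ n * (1 / 16) ^ n"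
      by (intro mult_left_mono) auto
    then show ?thesis using wt_eq by linarith
  qed
  have sub: "?J \<subseteq> (SIGMA e:{e\<in>E. x \<in> e}. {..<r} \<times> Pow e)"
  proof
    fix i assume i: "i \<in> ?J"
    obtain e k S where "i = (e, k, S)" by (cases i)
    then show "i \<in> (SIGMA e:{e\<in>E. x \<in> e}. {..<r} \<times> Pow e)"
      using i by (simp add: dense_index_def dense_box_def)
  qed
  have finS: "finite {e\<in>E. x \<in> e}" using finE by simp
  have "card ?J \<le> card (SIGMA e:{e\<in>E. x \<in> e}. {..<r} \<times> Pow e)"
    by (rule card_mono[OF _ sub]) (use finE cardE in auto)
  also have "\<dots> = (\<Sum>e\<in>{e\<in>E. x \<in> e}. card ({..<r} \<times> Pow e))"
    by (rule card_SigmaI) (use finE cardE in auto)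
  also have "\<dots> = (\<Sum>e\<in>{e\<in>E. x \<in> e}. r * 2 ^ n)"
    by (rule sum.cong) (use cardE in \<open>auto simp: card_cartesian_product card_Pow\<close>)
  also have "\<dots> \<le> D * (r * 2 ^ n)" using deg by simp
  finally have "real (card ?J) \<le> real (D * (r * 2 ^ n))"
    by (simp only: of_nat_le_iff)
  then have count: "real (card ?J) \<le> real D * (real r * 2 ^ n)"
    by simp
  have "mass ?s x (dense_box n r R ` ?I) \<le> real (card ?J) * ((1 / r) ^ n * (1 / 16) ^ n)"
    by (rule mass_image_le) (use finI s wt1 in auto)
  also have "\<dots> \<le> (real r ^ (n - 1) * (real r * 2 ^ n)) * ((1 / r) ^ n * (1 / 16) ^ n)"
  proof (rule mult_right_mono)
    have "real D * (real r * 2 ^ n) \<le> real r ^ (n - 1) * (real r * 2 ^ n)" using D by (intro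
      mult_right_mono) auto
    then show "real (card ?J) \<le> real r ^ (n - 1) * (real r * 2 ^ n)"
      using count by linarith
  qed simp
  also have "\<dots> = (real r ^ n * (1 / r) ^ n) * (2 ^ n * (1 / 16) ^ n)"
    using n by (cases n) auto
  also have "\<dots> = (1 / 8) ^ n" using r by (simp flip: power_mult_distrib)
  finally show "mass ?s x (dense_box n r R ` ?I) \<le> (1 / 8) ^ n" .
qed

section \<open>Weight of the cyclic events\<close>

context
  fixes BL :: "('a set \<times> 'a set) set" and n D C :: nat
  assumes finBL: "finite BL"
    and size: "\<And>b. b \<in> BL \<Longrightarrow> finite (body b) \<and> card (body b) \<le> 2 * n"
    and deg: "\<And>x. card {b\<in>BL. x \<in> body b} \<le> D"
    and codeg: "\<And>x y. x \<noteq> y \<Longrightarrow> card {b\<in>BL. x \<in> body b \<and> y \<in> body b} \<le> C"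
begin

text \<open>Chains of blocks that start at x and whose last block contains y: the last block passes through
  two given vertices, so it has only C choices.\<close>

fun thread :: "'a \<Rightarrow> nat \<Rightarrow> 'a \<Rightarrow> ('a set \<times> 'a set) list set" where
  "thread y 0 x = (if x = y then {} else (\<lambda>b. [b]) ` {b\<in>BL. x \<in> body b \<and> y \<in> body b})"
| "thread y (Suc k) x = (\<Union>b\<in>{b\<in>BL. x \<in> body b}. \<Union>z\<in>body b. (#) b ` thread y k z)"

lemma thread_card: "finite (thread y k x) \<and> card (thread y k x) \<le> (D * (2 * n)) ^ k * C"
proof (induction k arbitrary: x)
  case 0
  have "card ((\<lambda>b. [b]) ` {b\<in>BL. x \<in> body b \<and> y \<in> body b}) \<le> card {b\<in>BL. x \<in> body b \<and> y \<in> body b}"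
    by (rule card_image_le) (use finBL in auto)
  then show ?case using codeg[of x y] finBL by auto
next
  case (Suc k)
  let ?c = "(D * (2 * n)) ^ k * C"
  have "finite (thread y (Suc k) x) \<and> card (thread y (Suc k) x) \<le> D * (2 * n * ?c)"
    unfolding thread.simps
    by (intro card_UN_bound card_image_bound Suc deg) (use finBL size in auto)
  then show ?case by (simp add: mult_ac)
qed

lemma in_thread:
  assumes "length rs = Suc k" "set rs \<subseteq> BL" "\<And>j. j \<le> k \<Longrightarrow> z j \<in> body (rs ! j)"
    "\<And>j. j < k \<Longrightarrow> z (Suc j) \<in> body (rs ! j)" "y \<in> body (rs ! k)" "z k \<noteq> y"
  shows "rs \<in> thread y k (z 0)"
  using assms
proof (induction k arbitrary: rs z)
  case 0
  then obtain b where "rs = [b]" by (auto simp: length_Suc_conv)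
  then show ?case using 0 by auto
next
  case (Suc k)
  then obtain b rs' where rs: "rs = b # rs'" by (cases rs) auto
  have "rs' \<in> thread y k (z (Suc 0))"
  proof (rule Suc.IH[of rs' "\<lambda>j. z (Suc j)"])
    show "z (Suc j) \<in> body (rs' ! j)" if "j \<le> k" for j using Suc.prems(3)[of "Suc j"] that rs by simp
    show "z (Suc (Suc j)) \<in> body (rs' ! j)" if "j < k" for j using Suc.prems(4)[of "Suc j"] that rs by simp
  qed (use Suc.prems rs in auto)
  moreover have "z (Suc 0) \<in> body b" "z 0 \<in> body b" "b \<in> BL"
    using Suc.prems(2) Suc.prems(3)[of 0] Suc.prems(4)[of 0] rs by auto
  ultimately have "rs \<in> (#) b ` thread y k (z (Suc 0))" "b \<in> {b\<in>BL. z 0 \<in> body b}" using rs by auto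
  then show ?case using \<open>z (Suc 0) \<in> body b\<close> unfolding thread.simps by blast
qed

text \<open>Rotation brings a block through a given vertex to the front, so only chains starting
  there have to be counted.\<close>

lemma links_rotate:
  assumes "links BL bs" "j < length bs"
  shows "links BL (rotate j bs)"
proof -
  obtain xs where xs: "length xs = length bs" "distinct xs"
    "\<And>i. i < length bs \<Longrightarrow> xs ! i \<in> body (bs ! i) \<inter> body (bs ! (Suc i mod length bs))"
    using assms unfolding links_def by blast
  let ?L = "length bs"
  have L: "0 < ?L" using assms by linarith
  have "rotate j xs ! i \<in> body (rotate j bs ! i) \<inter> body (rotate j bs ! (Suc i mod ?L))" if i: "i < ?L" for i
  proof -
    have 1: "rotate j bs ! i = bs ! ((j + i) mod ?L)" using nth_rotate[OF i] .
    have 2: "rotate j xs ! i = xs ! ((j + i) mod ?L)" using nth_rotate[of i xs j] i xs(1) by simp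
    have "rotate j bs ! (Suc i mod ?L) = bs ! ((j + Suc i mod ?L) mod ?L)" using nth_rotate[of
      "Suc i mod ?L" bs j] L by simp
    also have "(j + Suc i mod ?L) mod ?L = Suc ((j + i) mod ?L) mod ?L" by (simp add: mod_simps)
    finally show ?thesis using 1 2 xs(3)[of "(j + i) mod ?L"] L by simp
  qed
  then show ?thesis using assms xs unfolding links_def
    by (intro conjI exI[of _ "rotate j xs"]) auto
qed

text \<open>The factor L locates a block through x, which is then rotated to the front. It has D
  choices and its two linking points (2n)^2; each of the L - 2 middle blocks with its next linking
  point has 2nD choices, and the closing block only C.\<close>

lemma links_card:
  assumes L: "2 \<le> L"
  shows "finite {bs. links BL bs \<and> length bs = L \<and> (\<exists>b\<in>set bs. x \<in> body b)}"
    and "card {bs. links BL bs \<and> length bs = L \<and> (\<exists>b\<in>set bs. x \<in> body b)}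
      \<le> L * (D * (2 * n) ^ 2 * ((D * (2 * n)) ^ (L - 2) * C))"
proof -
  define A where "A j = {bs. links BL bs \<and> length bs = L \<and> x \<in> body (bs ! j)}" for j
  define k where "k = L - 2"
  let ?c = "(D * (2 * n)) ^ k * C"
  let ?B = "{b\<in>BL. x \<in> body b}"
  have fB: "finite ?B" using finBL by simp
  have "{bs. links BL bs \<and> length bs = L} \<subseteq> {bs. set bs \<subseteq> BL \<and> length bs = L}" unfolding links_def by auto
  then have fin: "finite {bs. links BL bs \<and> length bs = L}"
    using finite_lists_length_eq[OF finBL] finite_subset by blast
  have A0: "card (A 0) \<le> D * (2 * n) ^ 2 * ?c"
  proof -
    let ?W = "\<lambda>b. \<Union>y\<in>body b. \<Union>z\<in>body b. (#) b ` thread y k z"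
    have "A 0 \<subseteq> (\<Union>b\<in>?B. ?W b)"
    proof
      fix bs assume bs: "bs \<in> A 0"
      then obtain xs where xs: "length xs = L" "distinct xs"
        "\<And>i. i < L \<Longrightarrow> xs ! i \<in> body (bs ! i) \<inter> body (bs ! (Suc i mod L))"
        unfolding A_def links_def by auto
      obtain b rs where brs: "bs = b # rs" using bs L unfolding A_def by (cases bs) auto
      have len: "length rs = Suc k" "L = Suc (Suc k)" using bs brs L unfolding A_def k_def by auto
      have "rs \<in> thread (xs ! (Suc k)) k (xs ! 0)"
      proof (rule in_thread[OF len(1), of "\<lambda>j. xs ! j"])
        show "set rs \<subseteq> BL" using bs brs unfolding A_def links_def by auto
        show "xs ! j \<in> body (rs ! j)" if "j \<le> k" for j
          using xs(3)[of j] that brs len by auto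
        show "xs ! Suc j \<in> body (rs ! j)" if "j < k" for j
          using xs(3)[of "Suc j"] that brs len by auto
        show "xs ! Suc k \<in> body (rs ! k)" using xs(3)[of "Suc k"] brs len by auto
        show "xs ! k \<noteq> xs ! Suc k" using xs(1,2) len by (simp add: nth_eq_iff_index_eq)
      qed
      moreover have "xs ! Suc k \<in> body b" using xs(3)[of "Suc k"] brs len by auto
      moreover have "xs ! 0 \<in> body b" using xs(3)[of 0] brs len by auto
      moreover have "b \<in> ?B" using bs brs unfolding A_def links_def by auto
      ultimately show "bs \<in> (\<Union>b\<in>?B. ?W b)" unfolding brs by blast
    qed
    moreover have W: "finite (\<Union>b\<in>?B. ?W b) \<and> card (\<Union>b\<in>?B. ?W b) \<le> D * (2 * n * (2 * n * ?c))"
      by (intro card_UN_bound card_image_bound thread_card deg) (use fB size in auto)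
    ultimately have "card (A 0) \<le> card (\<Union>b\<in>?B. ?W b)" by (intro card_mono) auto
    also have "\<dots> \<le> D * (2 * n * (2 * n * ?c))" using W ..
    also have "\<dots> = D * (2 * n) ^ 2 * ?c" by (simp add: power2_eq_square)
    finally show ?thesis .
  qed
  have finA: "finite (A j)" for j by (rule finite_subset[OF _ fin]) (auto simp: A_def)
  have Aj: "card (A j) \<le> card (A 0)" if j: "j < L" for j
  proof (rule card_inj_on_le[of "rotate j"])
    show "inj_on (rotate j) (A j)"
    proof (rule inj_onI)
      fix a b assume ab: "a \<in> A j" "b \<in> A j" "rotate j a = rotate j b"
      then have len: "length a = L" "length b = L" unfolding A_def by auto
      have "rotate (L - j) (rotate j c) = c" if "length c = L" for c :: "('a set \<times> 'a set) list"
        using that j by (simp add: rotate_rotate)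
      then show "a = b" using ab(3) len by metis
    qed
    show "rotate j ` A j \<subseteq> A 0"
    proof
      fix bs assume "bs \<in> rotate j ` A j"
      then obtain a where a: "bs = rotate j a" "links BL a" "length a = L" "x \<in> body (a ! j)"
        unfolding A_def by auto
      have "0 < length a" using a(3) L by linarith
      from nth_rotate[OF this, of j] have "bs ! 0 = a ! j" using a j by simp
      then show "bs \<in> A 0" using a links_rotate j unfolding A_def by simp
    qed
  qed (rule finA)
  have eq: "{bs. links BL bs \<and> length bs = L \<and> (\<exists>b\<in>set bs. x \<in> body b)} = (\<Union>j\<in>{..<L}. A j)"
  proof -
    have "(\<exists>b\<in>set bs. x \<in> body b) \<longleftrightarrow> (\<exists>j<length bs. x \<in> body (bs ! j))" for bs
      by (metis in_set_conv_nth)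
    then show ?thesis unfolding A_def by auto
  qed
  show "finite {bs. links BL bs \<and> length bs = L \<and> (\<exists>b\<in>set bs. x \<in> body b)}" unfolding eq using finA by auto
  have "card (\<Union>j\<in>{..<L}. A j) \<le> L * (D * (2 * n) ^ 2 * ?c)"
    using card_UN_bound[of "{..<L}" L A "D * (2 * n) ^ 2 * ?c"] finA Aj A0 le_trans by fastforce
  then show "card {bs. links BL bs \<and> length bs = L \<and> (\<exists>b\<in>set bs. x \<in> body b)}
      \<le> L * (D * (2 * n) ^ 2 * ((D * (2 * n)) ^ (L - 2) * C))" unfolding eq k_def by simp
qed

end

text \<open>Read from the end, each further colour is the successor or the predecessor of the one
  after it.\<close>

lemma steps_card:
  "finite {ks. length ks = Suc m \<and> steps r ks} \<and> card {ks. length ks = Suc m \<and> steps r ks} \<le> r * 2 ^ m"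
proof (induction m)
  case 0
  have "{ks. length ks = Suc 0 \<and> steps r ks} \<subseteq> (\<lambda>k. [k]) ` {..<r}"
    by (auto simp: steps_def length_Suc_conv)
  then show ?case using card_image_subset[of _ "\<lambda>k. [k]" "{..<r}"] finite_subset[of _ "(\<lambda>k. [k]) `
    {..<r}"] by auto
next
  case (Suc m)
  let ?S = "{ks. length ks = Suc m \<and> steps r ks}"
  define N where "N ks = {a. a < r \<and> (Suc a mod r = hd ks \<or> a = Suc (hd ks) mod r)}" for ks :: "nat list"
  have N: "finite (N ks) \<and> card (N ks) \<le> 2" for ks
  proof -
    have "N ks \<subseteq> {a. a < r \<and> Suc a mod r = hd ks} \<union> {Suc (hd ks) mod r}" unfolding N_def by auto
    then have "card (N ks) \<le> card ({a. a < r \<and> Suc a mod r = hd ks} \<union> {Suc (hd ks) mod r})"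
      by (rule card_mono[rotated]) auto
    also have "\<dots> \<le> card {a. a < r \<and> Suc a mod r = hd ks} + card {Suc (hd ks) mod r}"
      by (rule card_Un_le)
    finally show ?thesis using card_pred[of r "hd ks"] unfolding N_def by simp
  qed
  have sub: "{ks. length ks = Suc (Suc m) \<and> steps r ks} \<subseteq> (\<Union>ks\<in>?S. (\<lambda>k. k # ks) ` N ks)"
  proof
    fix ks assume ks: "ks \<in> {ks. length ks = Suc (Suc m) \<and> steps r ks}"
    then obtain k ks' where k: "ks = k # ks'" "length ks' = Suc m" by (auto simp: length_Suc_conv)
    have st: "steps r (k # ks')" using ks k by simp
    have "steps r ks'" unfolding steps_def
    proof (intro conjI allI impI)
      show "\<forall>k\<in>set ks'. k < r" using st unfolding steps_def by simp
      fix i assume "Suc i < length ks'"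
      then have "Suc (Suc i) < length (k # ks')" by simp
      then show "ks' ! Suc i = Suc (ks' ! i) mod r \<or> ks' ! i = Suc (ks' ! Suc i) mod r"
        using st unfolding steps_def by fastforce
    qed
    moreover have "k \<in> N ks'"
    proof -
      have "ks' ! 0 = hd ks'" using k(2) by (cases ks') auto
      then show ?thesis using st k(2) unfolding steps_def N_def by force
    qed
    ultimately show "ks \<in> (\<Union>ks\<in>?S. (\<lambda>k. k # ks) ` N ks)" using k by auto
  qed
  have bd: "finite (\<Union>ks\<in>?S. (\<lambda>k. k # ks) ` N ks) \<and> card (\<Union>ks\<in>?S. (\<lambda>k. k # ks) ` N ks) \<le> r * 2 ^ m * 2"
    by (intro card_UN_bound card_image_bound N) (use Suc in auto)
  then have "card {ks. length ks = Suc (Suc m) \<and> steps r ks} \<le> r * 2 ^ m * 2"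
    using card_mono[OF _ sub] le_trans by blast
  then show ?case using finite_subset[OF sub] bd by simp
qed

definition cyc_index :: "'a set set \<Rightarrow> nat \<Rightarrow> nat \<Rightarrow> nat \<Rightarrow> (('a set \<times> 'a set) list \<times> nat list) set" where
  "cyc_index E n r L = {(bs, ks). cyc n E bs \<and> spread n bs \<and> length bs = L \<and> steps r ks \<and> length ks = L}"

definition cyc_box :: "nat \<Rightarrow> nat \<Rightarrow> nat \<Rightarrow> ('a set \<times> 'a set) list \<times> nat list \<Rightarrow> ('a, nat \<times> nat) box" where
  "cyc_box n r R = (\<lambda>(bs, ks). (\<Union>b\<in>set bs. fst b,
     \<lambda>u. {p \<in> palette r n. \<forall>i<length bs. u \<in> fst (bs ! i) \<longrightarrow> p \<in> near r R (ks ! i)}))"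

lemma cyc_event_hits:
  assumes "cyc_event E n r R M w" and "\<And>e u. e \<in> E \<Longrightarrow> u \<in> e \<Longrightarrow> w u \<in> palette r n"
  shows "\<exists>b\<in>(\<Union>L\<in>{2..M}. cyc_box n r R ` cyc_index E n r L). hits w b"
proof -
  obtain bs ks where bs: "cyc n E bs" "spread n bs" "length bs \<le> M" "steps r ks"
     "length ks = length bs" "\<forall>i<length bs. \<forall>u\<in>fst (bs ! i). w u \<in> near r R (ks ! i)"
    using assms(1) unfolding cyc_event_def by auto
  have "(bs, ks) \<in> cyc_index E n r (length bs)" using bs unfolding cyc_index_def by auto
  moreover have "length bs \<in> {2..M}" using bs unfolding links_def by auto
  moreover have "hits w (cyc_box n r R (bs, ks))"
  proof -
    have "w u \<in> palette r n" if "b \<in> set bs" "u \<in> fst b" for b u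
      using assms(2)[of "fst b" u] bs(1) that unfolding links_def blocks_def by auto
    then show ?thesis using bs(6) unfolding hits_def cyc_box_def by auto
  qed
  ultimately show ?thesis by blast
qed

text \<open>A chain has of order D^(L - 1) choices and a factor r for its colours, while its box
  contains at least (L - 1)(n - 1) + 1 + n/4 vertices. As D is at most d * r^(n-1), all powers of r
  cancel except r^(-n/4). What remains is a factor per block: d and 2n for the choices, 2 for the
  step of colour, and B0 for allowing n + R entries instead of n - 1 on its vertices.\<close>

lemma mass_cyc:
  fixes D C :: nat and d B0 :: real
  assumes finE: "finite E" and cardE: "\<And>e. e \<in> E \<Longrightarrow> finite e \<and> card e = n" and n: "n \<ge> 2" and r: "r \<ge> 2"
    and deg: "\<And>x. card {b\<in>blocks n E. x \<in> body b} \<le> D"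
    and codeg: "\<And>x y. x \<noteq> y \<Longrightarrow> card {b\<in>blocks n E. x \<in> body b \<and> y \<in> body b} \<le> C"
    and d: "1 \<le> d" "real D \<le> d * real r ^ (n - 1)"
    and B0: "1 \<le> B0" "(real (n + R) / (real n - 1)) ^ n \<le> B0"
  shows "finite (\<Union>L\<in>{2..M}. cyc_box n r R ` cyc_index E n r L)"
    and "mass (real r * (real n - 1)) x (\<Union>L\<in>{2..M}. cyc_box n r R ` cyc_index E n r L)
      \<le> M * (M * C * (4 * real n * d * B0) ^ M * (1 / 2) ^ (n div 4))"
proof -
  let ?s = "real r * (real n - 1)"
  have s: "?s > 0" using n r by simp
  have finBL: "finite (blocks n E)"
    by (rule finite_subset[of _ "E \<times> E"]) (use finE in \<open>auto simp: blocks_def\<close>)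
  have size: "finite (body b) \<and> card (body b) \<le> 2 * n" if "b \<in> blocks n E" for b
  proof -
    have "fst b \<in> E" "snd b \<in> E" using that unfolding blocks_def by auto
    then show ?thesis using cardE card_Un_le[of "fst b" "snd b"] unfolding body_def by auto
  qed
  note lc = links_card[where BL = "blocks n E" and n = n and D = D and C = C, OF finBL size deg codeg]
  define I where "I L = cyc_index E n r L" for L
  have finI: "finite (I L)" for L
  proof -
    have "I L \<subseteq> {bs. set bs \<subseteq> blocks n E \<and> length bs = L} \<times> {ks. set ks \<subseteq> {..<r} \<and> length ks = L}"
      unfolding I_def cyc_index_def links_def steps_def by auto
    moreover have "finite ({bs. set bs \<subseteq> blocks n E \<and> length bs = L} \<times> {ks. set ks \<subseteq> {..<r} \<and>
      length ks = L})"
      using finite_lists_length_eq[OF finBL] finite_lists_length_eq[of "{..<r}"] by (intro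
        finite_cartesian_product) auto
    ultimately show ?thesis by (rule finite_subset)
  qed
  show "finite (\<Union>L\<in>{2..M}. cyc_box n r R ` cyc_index E n r L)" using finI unfolding I_def by auto
  have wt1: "wt ?s (cyc_box n r R i) \<le> (1 / r) ^ ((L - 1) * (n - 1) + 1 + n div 4) * B0 ^ L" if i:
    "i \<in> I L" for i L
  proof -
    obtain bs ks where bk: "i = (bs, ks)" by (cases i)
    have b: "cyc n E bs" "spread n bs" "length bs = L" using i unfolding I_def cyc_index_def bk by auto
    define U where "U = (\<Union>b\<in>set bs. fst b)"
    have be: "finite (fst b) \<and> card (fst b) = n" if "b \<in> set bs" for b
      using b(1) cardE that unfolding links_def blocks_def by auto
    have finU: "finite U" unfolding U_def using be by auto
    have "card U \<le> (\<Sum>b\<in>set bs. card (fst b))" unfolding U_def by (rule card_UN_le) simp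
    also have "\<dots> = card (set bs) * n" using be by simp
    also have "\<dots> \<le> L * n" using b(3) card_length[of bs] by (intro mult_right_mono) auto
    finally have cU: "card U \<le> L * n" .
    have cU2: "(L - 1) * (n - 1) + 1 + n div 4 \<le> card U" using b(2,3) unfolding spread_def U_def by simp
    let ?q = "real (n + R) / (real n - 1)"
    have q1: "1 \<le> ?q" using n by (simp add: field_simps)
    have "wt ?s (cyc_box n r R i) = (\<Prod>u\<in>U. real (card (snd (cyc_box n r R i) u)) / ?s)"
      unfolding wt_def U_def cyc_box_def bk by simp
    also have "\<dots> \<le> (\<Prod>u\<in>U. (1 / r) * ?q)"
    proof (rule prod_mono, intro conjI)
      fix u assume "u \<in> U"
      then obtain j where j: "j < length bs" "u \<in> fst (bs ! j)" unfolding U_def by (metis UN_E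
        in_set_conv_nth)
      have "snd (cyc_box n r R i) u \<subseteq> near r R (ks ! j) \<inter> palette r n" unfolding cyc_box_def bk
        using j by auto
      then have "card (snd (cyc_box n r R i) u) \<le> card (near r R (ks ! j) \<inter> palette r n)"
        by (rule card_mono[rotated]) (simp add: palette_def)
      also have "\<dots> \<le> n + R" by (rule card_near)
      finally have "real (card (snd (cyc_box n r R i) u)) / ?s \<le> real (n + R) / ?s"
        using s by (intro divide_right_mono) auto
      then show "real (card (snd (cyc_box n r R i) u)) / ?s \<le> (1 / r) * ?q" by simp
    qed (use s in auto)
    also have "\<dots> = (1 / r) ^ card U * ?q ^ card U" by (simp only: prod_constant power_mult_distrib)
    also have "\<dots> \<le> (1 / r) ^ ((L - 1) * (n - 1) + 1 + n div 4) * B0 ^ L"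
    proof (rule mult_mono)
      show "(1 / real r) ^ card U \<le> (1 / r) ^ ((L - 1) * (n - 1) + 1 + n div 4)"
        by (rule power_decreasing[OF cU2]) (use r in auto)
      have "?q ^ card U \<le> ?q ^ (L * n)" by (rule power_increasing[OF cU q1])
      also have "\<dots> = (?q ^ n) ^ L" by (simp only: power_mult mult.commute[of L n])
      also have "\<dots> \<le> B0 ^ L" by (rule power_mono[OF B0(2)]) (use q1 in simp)
      finally show "?q ^ card U \<le> B0 ^ L" .
    qed (use q1 in auto)
    finally show ?thesis .
  qed
  have massL: "mass ?s x (cyc_box n r R ` I L) \<le> M * C * (4 * real n * d * B0) ^ M * (1 / 2) ^ (n div 4)"
    if L: "L \<in> {2..M}" for L
  proof -
    let ?J = "{i \<in> I L. x \<in> fst (cyc_box n r R i)}"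
    define A where "A = {bs. links (blocks n E) bs \<and> length bs = L \<and> (\<exists>b\<in>set bs. x \<in> body b)}"
    define K where "K = {ks. length ks = L \<and> steps r ks}"
    obtain m where m: "L = Suc (Suc m)" using L by (metis atLeastAtMost_iff add_2_eq_Suc le_Suc_ex)
    have A: "finite A" "card A \<le> L * (D * (2 * n) ^ 2 * ((D * (2 * n)) ^ (L - 2) * C))"
      unfolding A_def using lc[of L x] L by auto
    have K: "finite K" "card K \<le> r * 2 ^ Suc m" unfolding K_def using steps_card[of "Suc m" r] m by auto
    have "?J \<subseteq> A \<times> K"
    proof
      fix i assume i: "i \<in> ?J"
      obtain bs ks where bk: "i = (bs, ks)" by (cases i)
      show "i \<in> A \<times> K" using i unfolding bk I_def cyc_index_def cyc_box_def A_def K_def body_def by auto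
    qed
    then have "card ?J \<le> card (A \<times> K)"
      by (rule card_mono[rotated]) (use A K in auto)
    also have "\<dots> = card A * card K" by (rule card_cartesian_product)
    also have "\<dots> \<le> (L * (D * (2 * n) ^ 2 * ((D * (2 * n)) ^ (L - 2) * C))) * (r * 2 ^ Suc m)"
      by (rule mult_mono) (use A K in auto)
    also have "\<dots> = L * C * (D ^ Suc m * ((2 * n) ^ L * (r * 2 ^ Suc m)))"
    proof -
      have L2: "L - 2 = m" "(2 * n) ^ L = (2 * n) ^ 2 * (2 * n) ^ m" using m by (simp_all add:
        power2_eq_square)
      show ?thesis unfolding L2 power_mult_distrib[of D] power_Suc by (simp only: mult_ac)
    qed
    finally have cnt: "card ?J \<le> L * C * (D ^ Suc m * ((2 * n) ^ L * (r * 2 ^ Suc m)))" .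
    let ?e = "(L - 1) * (n - 1) + 1 + n div 4"
    have "mass ?s x (cyc_box n r R ` I L) \<le> real (card ?J) * ((1 / r) ^ ?e * B0 ^ L)"
      by (rule mass_image_le) (use finI s wt1 in auto)
    also have "\<dots> \<le> real (L * C * (D ^ Suc m * ((2 * n) ^ L * (r * 2 ^ Suc m)))) * ((1 / r) ^ ?e * B0 ^ L)"
      by (rule mult_right_mono) (use cnt B0 in \<open>simp_all only: of_nat_le_iff zero_le_mult_iff, auto\<close>)
    also have "\<dots> = real L * C * (real D ^ Suc m * ((2 * n) ^ L * (r * 2 ^ Suc m))) * ((1 / r) ^ ?e
      * B0 ^ L)"
      by simp
    also have "\<dots> \<le> real L * C * ((d * real r ^ (n - 1)) ^ Suc m * ((2 * n) ^ L * (r * 2 ^ Suc m)))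
      * ((1 / r) ^ ?e * B0 ^ L)"
      by (intro mult_right_mono mult_left_mono power_mono d(2)) (use B0 in auto)
    also have "\<dots> = real L * C * (d ^ Suc m * ((2 * n) ^ L * 2 ^ Suc m) * B0 ^ L) * (((real r ^ (n
      - 1)) ^ Suc m * r) * (1 / r) ^ ?e)"
      by (simp only: power_mult_distrib of_nat_mult mult_ac)
    also have "((real r ^ (n - 1)) ^ Suc m * r) * (1 / r) ^ ?e = (1 / r) ^ (n div 4)"
    proof -
      have "(real r ^ (n - 1)) ^ Suc m * r = real r ^ ((L - 1) * (n - 1) + 1)"
        unfolding m by (simp only: power_mult[symmetric] power_add power_one_right diff_Suc_1 mult.commute)
      moreover have "(1 / real r) ^ ?e = (1 / r) ^ ((L - 1) * (n - 1) + 1) * (1 / r) ^ (n div 4)"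
        by (simp only: power_add)
      moreover have "real r ^ k * (1 / r) ^ k = 1" for k using r by (simp flip: power_mult_distrib)
      ultimately show ?thesis by (simp only: mult.assoc[symmetric] mult_1_left)
    qed
    also have "real L * C * (d ^ Suc m * ((2 * n) ^ L * 2 ^ Suc m) * B0 ^ L) * (1 / r) ^ (n div 4)
      \<le> real M * C * ((4 * real n * d * B0) ^ M) * (1 / 2) ^ (n div 4)"
    proof (intro mult_mono)
      have "d ^ Suc m * ((2 * n) ^ L * 2 ^ Suc m) * B0 ^ L \<le> d ^ L * ((2 * n) ^ L * 2 ^ L) * B0 ^ L"
        unfolding m by (intro mult_mono power_increasing) (use d B0 n in auto)
      also have "\<dots> = (d * (real (2 * n) * 2) * B0) ^ L"
        by (simp only: power_mult_distrib of_nat_mult of_nat_power of_nat_numeral)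
      also have "d * (real (2 * n) * 2) * B0 = 4 * real n * d * B0" by simp
      also have "(4 * real n * d * B0) ^ L \<le> (4 * real n * d * B0) ^ M"
      proof (rule power_increasing)
        have "1 * 1 * 1 \<le> (4 * real n) * d * B0" using d B0 n by (intro mult_mono) auto
        then show "1 \<le> 4 * real n * d * B0" by simp
      qed (use L in auto)
      finally show "d ^ Suc m * ((2 * n) ^ L * 2 ^ Suc m) * B0 ^ L \<le> (4 * real n * d * B0) ^ M" .
      show "(1 / real r) ^ (n div 4) \<le> (1 / 2) ^ (n div 4)"
        by (rule power_mono) (use r in \<open>auto simp: field_simps\<close>)
    qed (use L d B0 in auto)
    finally show ?thesis by simp
  qed
  have "mass ?s x (\<Union>L\<in>{2..M}. cyc_box n r R ` I L) \<le> (\<Sum>L\<in>{2..M}. mass ?s x (cyc_box n r R ` I L))"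
    by (rule mass_UN) (use finI s in auto)
  also have "\<dots> \<le> real (card {2..M}) * (M * C * (4 * real n * d * B0) ^ M * (1 / 2) ^ (n div 4))"
    by (rule sum_bounded_above) (rule massL)
  also have "\<dots> \<le> M * (M * C * (4 * real n * d * B0) ^ M * (1 / 2) ^ (n div 4))"
    by (rule mult_right_mono) (use d B0 in auto)
  finally show "mass ?s x (\<Union>L\<in>{2..M}. cyc_box n r R ` cyc_index E n r L)
      \<le> M * (M * C * (4 * real n * d * B0) ^ M * (1 / 2) ^ (n div 4))" by (simp add: I_def)
qed

section \<open>Weight of the tree events\<close>

text \<open>That v has the least label in its node is not a restriction on single vertices, but
  becomes one when the label of v is prescribed. These are the prescriptions; the root has no such
  vertex and receives the dummy value 0.\<close>

definition starts :: "'a node set \<Rightarrow> nat \<Rightarrow> ('a node \<Rightarrow> nat) set" where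
  "starts P n = (\<Pi>\<^sub>E p\<in>P. if snd p = None then {0} else {..<n})"

definition hues :: "'a node set \<Rightarrow> nat \<Rightarrow> ('a node \<Rightarrow> nat) set" where
  "hues P r = {k \<in> P \<rightarrow>\<^sub>E {..<r}. colouring r P k}"

definition tree_box :: "nat \<Rightarrow> nat \<Rightarrow> nat \<Rightarrow> 'a node set \<Rightarrow> bool \<Rightarrow> ('a node \<Rightarrow> nat) \<times> ('a node \<Rightarrow> nat)
    \<Rightarrow> ('a, nat \<times> nat) box" where
  "tree_box n r R P q = (\<lambda>(k, t). (\<Union>p\<in>P. own P p, \<lambda>u. {ab \<in> palette r n. \<forall>p\<in>P. u \<in> own P p \<longrightarrow>
     fst ab = k p \<and> (\<forall>v. snd p = Some v \<longrightarrow> (if u = v then snd ab = t p else t p \<le> snd ab)) \<and>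
     (snd p = None \<and> q \<longrightarrow> R \<le> snd ab)}))"

lemma Suc_mod_inj:
  assumes "Suc a mod r = Suc b mod r" "a < r" "b < r"
  shows "a = b"
  using assms by (cases "Suc a = r"; cases "Suc b = r") auto

text \<open>The colour of the root determines all colours.\<close>

lemma card_hues:
  assumes P: "tree E P"
  shows "finite (hues P r)" "card (hues P r) \<le> r"
proof -
  have finP: "finite P" using P unfolding tree_def by auto
  show fin: "finite (hues P r)" unfolding hues_def
    by (rule finite_subset[of _ "P \<rightarrow>\<^sub>E {..<r}"]) (use finP in \<open>auto intro: finite_PiE\<close>)
  obtain z where z: "z \<in> P" "snd z = None" "\<And>p. p \<in> P \<Longrightarrow> snd p = None \<Longrightarrow> p = z"
    using P unfolding tree_def by auto
  obtain rk :: "'a node \<Rightarrow> nat" where rk: "\<And>p u. p \<in> P \<Longrightarrow> snd p = Some u \<Longrightarrow> \<exists>q\<in>P. rk q < rk p \<and> u \<in> hooks P q"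
    using P unfolding tree_def by blast
  have "inj_on (\<lambda>k. k z) (hues P r)"
  proof (rule inj_onI)
    fix k l assume kl: "k \<in> hues P r" "l \<in> hues P r" "k z = l z"
    have "k p = l p" if "p \<in> P" for p
      using that
    proof (induction "rk p" arbitrary: p rule: less_induct)
      case less
      show ?case
      proof (cases "snd p")
        case None
        then show ?thesis using z(3)[OF less.prems] kl(3) by simp
      next
        case (Some u)
        obtain q where q: "q \<in> P" "rk q < rk p" "u \<in> hooks P q" using rk[OF less.prems Some] by blast
        have "k q = Suc (k p) mod r" "l q = Suc (l p) mod r" "k p < r" "l p < r"
          using kl(1,2) q less.prems Some unfolding hues_def colouring_def by blast+
        moreover have "k q = l q" using less.hyps[OF q(2,1)] .
        ultimately show ?thesis using Suc_mod_inj[of "k p" r "l p"] by simp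
      qed
    qed
    moreover have "k \<in> extensional P" "l \<in> extensional P" using kl unfolding hues_def by (auto
      simp: PiE_def)
    ultimately show "k = l" by (auto intro: extensionalityI)
  qed
  moreover have "(\<lambda>k. k z) ` hues P r \<subseteq> {..<r}" using z(1) unfolding hues_def colouring_def by auto
  ultimately have "card (hues P r) \<le> card {..<r}" by (rule card_inj_on_le) simp
  then show "card (hues P r) \<le> r" by simp
qed

text \<open>Comparison with the integral of x^j. With j + 1 own vertices, (n - t)^j counts the
  labels of the others when the least one is t. For j + 1 comparable with n the sum is O(n^j) out of
  n^(j + 1) labellings, which is the gain of 1/n.\<close>

lemma sum_descending_powers:
  "(\<Sum>t<n. real (n - t) ^ j) \<le> real n ^ j * (1 + real n / (j + 1))"
proof -
  have tele: "(j + 1) * (\<Sum>i<n. real i ^ j) \<le> real n ^ (j + 1)"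
  proof (induction n)
    case 0
    then show ?case by simp
  next
    case (Suc n)
    have "real n ^ (j + 1) + (j + 1) * real n ^ j \<le> real (Suc n) ^ (j + 1)"
    proof -
      have "real n ^ (j + 1) + (j + 1) * real n ^ j \<le> (real n + 1) ^ (j + 1)"
      proof (induction j)
        case 0
        then show ?case by simp
      next
        case (Suc j)
        have "real n ^ (Suc j + 1) + (Suc j + 1) * real n ^ Suc j
            \<le> (real n + 1) * (real n ^ (j + 1) + (j + 1) * real n ^ j)"
          by (simp add: algebra_simps)
        also have "\<dots> \<le> (real n + 1) * (real n + 1) ^ (j + 1)"
          using Suc by (intro mult_left_mono) auto
        finally show ?case by simp
      qed
      then show ?thesis by (simp add: add.commute)
    qed
    then show ?case using Suc by (simp add: algebra_simps)
  qed
  have "(\<Sum>t<n. real (n - t) ^ j) = (\<Sum>i\<in>{1..n}. real i ^ j)"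
    by (rule sum.reindex_bij_witness[of _ "\<lambda>i. n - i" "\<lambda>t. n - t"]) auto
  also have "\<dots> \<le> (\<Sum>i<n. real i ^ j) + real n ^ j"
  proof (cases n)
    case (Suc m)
    have "(\<Sum>i\<in>{1..n}. real i ^ j) \<le> (\<Sum>i\<in>{..n}. real i ^ j)" by (rule sum_mono2) auto
    then show ?thesis unfolding Suc by (simp add: lessThan_Suc_atMost[symmetric])
  qed simp
  also have "(\<Sum>i<n. real i ^ j) \<le> real n ^ (j + 1) / (j + 1)"
    using tele by (simp add: field_simps)
  finally show ?thesis by (simp add: field_simps)
qed

text \<open>The price of the factors 1 - t with t = 1/n on n vertices: at most e^(n/(n - 1)) \<le>
  e^2 \<le> 9.\<close>

lemma ratio_power_le:
  assumes "n \<ge> 2" "k \<le> n"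
  shows "(real n / (real n - 1)) ^ k \<le> 9"
proof -
  have eq: "real n / (real n - 1) = 1 + 1 / (real n - 1)" using assms by (simp add: field_simps)
  have "(real n / (real n - 1)) ^ k \<le> (real n / (real n - 1)) ^ n"
    by (rule power_increasing[OF assms(2)]) (use assms in \<open>simp add: field_simps\<close>)
  also have "\<dots> \<le> exp (1 / (real n - 1)) ^ n"
    unfolding eq by (rule power_mono[OF exp_ge_add_one_self]) (use assms in simp)
  also have "\<dots> = exp (real n * (1 / (real n - 1)))" by (rule exp_of_nat_mult[symmetric])
  also have "\<dots> \<le> exp (1 + 1)"
    using assms by (subst exp_le_cancel_iff) (simp add: field_simps)
  also have "\<dots> = exp 1 * exp (1 :: real)" by (rule exp_add)
  also have "\<dots> \<le> 3 * 3" by (intro mult_mono exp_le) auto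
  finally show ?thesis by simp
qed

definition node_weight :: "nat \<Rightarrow> nat \<Rightarrow> nat \<Rightarrow> bool \<Rightarrow> 'a node set \<Rightarrow> 'a node \<Rightarrow> nat \<Rightarrow> real" where
  "node_weight n r R q P p t = (let s = real r * (real n - 1) in
     if snd p = None then (real (if q then n - R else n) / s) ^ card (own P p)
     else (1 / s) * (real (n - t) / s) ^ (card (own P p) - 1))"

lemma card_own:
  assumes "finite (fst p)"
  shows "card (own P p) = card (fst p) - card (hooks P p)" "card (hooks P p) \<le> card (fst p)"
proof -
  have sub: "hooks P p \<subseteq> fst p" unfolding hooks_def by auto
  then show "card (hooks P p) \<le> card (fst p)" by (rule card_mono[OF assms])
  show "card (own P p) = card (fst p) - card (hooks P p)" unfolding own_def
    by (rule card_Diff_subset) (use sub assms finite_subset in auto)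
qed

text \<open>With k hooks missing, k factors 1 - R/n are lost; each is at least 1/2 because of
  \<open>2 * R \<le> n\<close>, which explains 2^k.\<close>

lemma root_weight:
  assumes n: "n \<ge> 2" and r: "r \<ge> 1" and R: "2 * R \<le> n" and p: "snd p = None"
    and c: "finite (fst p)" "card (fst p) = n" and h: "k = card (hooks P p)"
  shows "node_weight n r R q P p t
    \<le> (1 / r) ^ (n - k) * (2 ^ k * (9 * (if q then (1 - R / n) ^ n else 1)))"
proof -
  define x where "x = (if q then 1 - real R / n else 1)"
  have x: "1 / 2 \<le> x" "x \<le> 1" using R n unfolding x_def by (auto simp: field_simps)
  have own: "card (own P p) = n - k" "k \<le> n" using card_own[OF c(1), of P] c h by auto
  have "node_weight n r R q P p t = (real (if q then n - R else n) / (real r * (real n - 1))) ^ (n - k)"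
    unfolding node_weight_def using p own by (simp add: Let_def)
  also have "real (if q then n - R else n) / (real r * (real n - 1)) = (1 / r) * (x * (real n /
    (real n - 1)))"
    using n R by (simp add: x_def of_nat_diff field_simps)
  also have "\<dots> ^ (n - k) = (1 / r) ^ (n - k) * (x ^ (n - k) * (real n / (real n - 1)) ^ (n - k))"
    by (simp only: power_mult_distrib)
  also have "\<dots> \<le> (1 / r) ^ (n - k) * ((2 ^ k * x ^ n) * 9)"
  proof (intro mult_left_mono mult_mono)
    have "1 \<le> (2 * x) ^ k" by (rule one_le_power) (use x in simp)
    then have "x ^ (n - k) * 1 \<le> x ^ (n - k) * (2 * x) ^ k" using x by (intro mult_left_mono) auto
    also have "\<dots> = 2 ^ k * (x ^ (n - k) * x ^ k)" by (simp only: power_mult_distrib mult_ac)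
    also have "x ^ (n - k) * x ^ k = x ^ n" using own(2) by (simp flip: power_add)
    finally show "x ^ (n - k) \<le> 2 ^ k * x ^ n" by simp
    show "(real n / (real n - 1)) ^ (n - k) \<le> 9" by (rule ratio_power_le[OF n]) simp
  qed (use x n in auto)
  also have "(2 ^ k * x ^ n) * 9 = 2 ^ k * (9 * (if q then (1 - R / n) ^ n else 1))" by (simp add: x_def)
  finally show ?thesis .
qed

text \<open>Summing over the least label leaves 1 + n/(n - k) \<le> k + 2 \<le> 2^(k + 1), so k
  hooks cost at most 2^k and the factor 1/n survives even when few own vertices remain. The 18 is 2
  * 9.\<close>

lemma inner_weight:
  assumes n: "n \<ge> 2" and r: "r \<ge> 1" and p: "snd p = Some v"
    and c: "finite (fst p)" "card (fst p) = n" and h: "k = card (hooks P p)" and k: "k < n"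
  shows "(\<Sum>t<n. node_weight n r R q P p t) \<le> (1 / r) ^ (n - k) * (2 ^ k * (18 / n))"
proof -
  define j where "j = n - 1 - k"
  have j: "n - k = Suc j" "n = j + 1 + k" using k unfolding j_def by auto
  let ?s = "real r * (real n - 1)"
  have own: "card (own P p) = Suc j" using card_own[OF c(1), of P] c h j by auto
  have "(\<Sum>t<n. node_weight n r R q P p t) = (\<Sum>t<n. (1 / ?s) ^ Suc j * real (n - t) ^ j)"
    unfolding node_weight_def using p own by (simp add: Let_def power_divide)
  also have "\<dots> = (1 / ?s) ^ Suc j * (\<Sum>t<n. real (n - t) ^ j)" by (simp only: sum_distrib_left)
  also have "\<dots> \<le> (1 / ?s) ^ Suc j * (real n ^ j * (1 + real n / (j + 1)))"
    by (rule mult_left_mono[OF sum_descending_powers]) (use n in simp)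
  also have "\<dots> \<le> (1 / ?s) ^ Suc j * (real n ^ j * (2 * 2 ^ k))"
  proof (intro mult_left_mono)
    have "real n \<le> real (k + 1) * real (j + 1)" unfolding j(2) by (simp add: algebra_simps)
    then have "real n / (j + 1) \<le> real (k + 1)" by (simp add: pos_divide_le_eq)
    moreover have "k + 2 \<le> 2 * 2 ^ k" by (induction k) auto
    then have "real (k + 2) \<le> real (2 * 2 ^ k)" by (simp only: of_nat_le_iff)
    ultimately show "1 + real n / (j + 1) \<le> 2 * 2 ^ k" by simp
  qed (use n in auto)
  also have "\<dots> = (1 / r) ^ Suc j * (2 ^ k * ((real n / (real n - 1)) ^ Suc j * (2 / n)))"
    using n by (simp add: power_divide power_mult_distrib mult_ac)
  also have "\<dots> \<le> (1 / r) ^ Suc j * (2 ^ k * (9 * (2 / n)))"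
    using ratio_power_le[OF n, of "Suc j"] j by (intro mult_left_mono mult_right_mono) auto
  finally show ?thesis using j by simp
qed

lemma wt_tree_box:
  assumes P: "tree E P" and cardE: "\<And>e. e \<in> E \<Longrightarrow> finite e \<and> card e = n" and n: "n \<ge> 2" and r: "r \<ge> 1"
    and t: "t \<in> starts P n"
  shows "wt (real r * (real n - 1)) (tree_box n r R P q (k, t)) \<le> (\<Prod>p\<in>P. node_weight n r R q P p (t p))"
proof -
  let ?s = "real r * (real n - 1)"
  have s: "?s > 0" using n r by simp
  let ?S = "snd (tree_box n r R P q (k, t))"
  have finP: "finite P" and PE: "\<And>p. p \<in> P \<Longrightarrow> finite (fst p)"
    using P cardE unfolding tree_def nodes_def by auto
  have finown: "\<forall>p\<in>P. finite (own P p)" using PE unfolding own_def by auto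
  have dis: "\<forall>p\<in>P. \<forall>q\<in>P. p \<noteq> q \<longrightarrow> own P p \<inter> own P q = {}" using P unfolding tree_def by blast
  have "wt ?s (tree_box n r R P q (k, t)) = (\<Prod>u\<in>(\<Union>p\<in>P. own P p). real (card (?S u)) / ?s)"
    unfolding wt_def by (simp add: tree_box_def)
  also have "\<dots> = (\<Prod>p\<in>P. \<Prod>u\<in>own P p. real (card (?S u)) / ?s)"
    by (rule prod.UNION_disjoint[OF finP finown dis])
  also have "\<dots> \<le> (\<Prod>p\<in>P. node_weight n r R q P p (t p))"
  proof (rule prod_mono, intro conjI)
    fix p assume p: "p \<in> P"
    have fo: "finite (own P p)" using finown p by auto
    show "0 \<le> (\<Prod>u\<in>own P p. real (card (?S u)) / ?s)" using s by (intro prod_nonneg) auto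
    show "(\<Prod>u\<in>own P p. real (card (?S u)) / ?s) \<le> node_weight n r R q P p (t p)"
    proof (cases "snd p")
      case None
      have "(\<Prod>u\<in>own P p. real (card (?S u)) / ?s) \<le> (\<Prod>u\<in>own P p. real (if q then n - R else n) / ?s)"
      proof (rule prod_mono, intro conjI)
        fix u assume u: "u \<in> own P p"
        have "?S u \<subseteq> {k p} \<times> (if q then {R..<n} else {..<n})"
          using p u None by (auto simp: tree_box_def palette_def)
        then have "card (?S u) \<le> card ({k p} \<times> (if q then {R..<n} else {..<n}))"
          by (rule card_mono[rotated]) simp
        also have "\<dots> = (if q then n - R else n)" by (simp add: card_cartesian_product)
        finally have "real (card (?S u)) \<le> real (if q then n - R else n)" by (simp only: of_nat_le_iff)
        then show "real (card (?S u)) / ?s \<le> real (if q then n - R else n) / ?s"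
          using s by (intro divide_right_mono) auto
      qed (use s in auto)
      then show ?thesis using None by (simp add: node_weight_def Let_def)
    next
      case (Some v)
      have v: "v \<in> own P p" using p P Some unfolding own_def hooks_def tree_def nodes_def by (cases p) auto
      have "(\<Prod>u\<in>own P p. real (card (?S u)) / ?s)
        = (real (card (?S v)) / ?s) * (\<Prod>u\<in>own P p - {v}. real (card (?S u)) / ?s)"
        by (rule prod.remove[OF fo v])
      also have "\<dots> \<le> (1 / ?s) * (\<Prod>u\<in>own P p - {v}. real (n - t p) / ?s)"
      proof (intro mult_mono prod_mono conjI)
        have "?S v \<subseteq> {(k p, t p)}" using p v Some by (auto simp: tree_box_def palette_def)
        then have "card (?S v) \<le> card {(k p, t p)}" by (rule card_mono[rotated]) simp
        then show "real (card (?S v)) / ?s \<le> 1 / ?s" using s by (intro divide_right_mono) auto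
        fix u assume u: "u \<in> own P p - {v}"
        have "?S u \<subseteq> {k p} \<times> {t p..<n}" using p u Some by (auto simp: tree_box_def palette_def)
        then have "card (?S u) \<le> card ({k p} \<times> {t p..<n})" by (rule card_mono[rotated]) simp
        also have "\<dots> = n - t p" by (simp add: card_cartesian_product)
        finally show "real (card (?S u)) / ?s \<le> real (n - t p) / ?s"
          using s by (intro divide_right_mono) auto
      qed (use s in \<open>auto intro: prod_nonneg\<close>)
      finally show ?thesis using Some fo v by (simp add: node_weight_def Let_def)
    qed
  qed
  finally show ?thesis .
qed

text \<open>The own sets contain at least m(n - 1) + 1 vertices, and the extra one pays for the r
  colours of the root. The factors 2^k multiply to at most 2^(m - 1), turning 18/n into 36/n at each
  node but the root. The root contributes 9; writing this as (n/4)(36/n) makes the m factors alike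
  and is the origin of the polynomial loss n/4.\<close>

lemma tree_weight:
  assumes P: "tree E P" and cardE: "\<And>e. e \<in> E \<Longrightarrow> finite e \<and> card e = n" and n: "n \<ge> 2" and r: "r \<ge> 1"
    and R: "2 * R \<le> n"
  shows "finite (tree_box n r R P q ` (hues P r \<times> starts P n))"
    and "mass (real r * (real n - 1)) x (tree_box n r R P q ` (hues P r \<times> starts P n))
      \<le> (if q then (1 - R / n) ^ n else 1) * (real n / 4) * (36 / (real n * real r ^ (n - 1))) ^ card P"
proof -
  let ?s = "real r * (real n - 1)"
  have s: "?s > 0" using n r by simp
  define \<rho> where "\<rho> = (if q then (1 - real R / n) ^ n else 1)"
  have \<rho>: "0 \<le> \<rho>" using R n unfolding \<rho>_def by (auto simp: field_simps)
  have finP: "finite P" and PE: "\<And>p. p \<in> P \<Longrightarrow> finite (fst p) \<and> card (fst p) = n"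
    using P cardE unfolding tree_def nodes_def by auto
  obtain z where z: "z \<in> P" "snd z = None" "\<And>p. p \<in> P \<Longrightarrow> snd p = None \<Longrightarrow> p = z"
    using P unfolding tree_def by auto
  have finS: "finite (starts P n)" unfolding starts_def using finP by (intro finite_PiE) auto
  have fin: "finite (hues P r \<times> starts P n)" using card_hues(1)[OF P] finS by auto
  then show "finite (tree_box n r R P q ` (hues P r \<times> starts P n))" by simp
  define m where "m = card P"
  have m1: "m \<ge> 1" using z(1) finP unfolding m_def by (metis One_nat_def Suc_leI card_gt_0_iff empty_iff)
  define K where "K = (\<Sum>p\<in>P. card (hooks P p))"
  have K: "K \<le> m - 1" using P unfolding tree_def K_def m_def by auto
  define c where "c p = (if snd p = None then 9 * \<rho> else 18 / real n)" for p :: "'a node"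
  have nw0: "0 \<le> node_weight n r R q P p t" for p t using s by (simp add: node_weight_def Let_def)
  have each: "(\<Sum>t\<in>(if snd p = None then {0} else {..<n}). node_weight n r R q P p t)
      \<le> (1 / r) ^ (n - card (hooks P p)) * (2 ^ card (hooks P p) * c p)" if p: "p \<in> P" for p
  proof (cases "snd p")
    case None
    then show ?thesis
      using root_weight[OF n r R None conjunct1[OF PE[OF p]] conjunct2[OF PE[OF p]] refl, where P
        = P and q = q and t = 0]
      by (simp add: c_def \<rho>_def)
  next
    case (Some v)
    have "v \<in> own P p" using p P Some unfolding own_def hooks_def tree_def nodes_def by (cases p) auto
    then have "card (own P p) > 0" using PE[OF p] by (auto simp: card_gt_0_iff own_def)
    then have "card (hooks P p) < n" using card_own[of p P] PE[OF p] by auto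
    then show ?thesis
      using inner_weight[OF n r Some conjunct1[OF PE[OF p]] conjunct2[OF PE[OF p]] refl, where P =
        P and R = R and q = q] Some
      by (simp add: c_def)
  qed
  have exps: "m * (n - 1) + 1 \<le> (\<Sum>p\<in>P. n - card (hooks P p))"
  proof -
    have eachn: "n - card (hooks P p) + card (hooks P p) = n" if "p \<in> P" for p
      using card_own(2)[of p P] PE[OF that] by auto
    have "(\<Sum>p\<in>P. n - card (hooks P p)) + K = (\<Sum>p\<in>P. (n - card (hooks P p)) + card (hooks P p))"
      unfolding K_def by (simp only: sum.distrib)
    also have "\<dots> = (\<Sum>p\<in>P. n)" by (rule sum.cong) (use eachn in auto)
    also have "\<dots> = m * n" unfolding m_def by simp
    finally have "(\<Sum>p\<in>P. n - card (hooks P p)) + K = m * n" .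
    moreover have "m * n = m * (n - 1) + m" using n by (cases n) auto
    ultimately show ?thesis using K m1 by linarith
  qed
  have "mass ?s x (tree_box n r R P q ` (hues P r \<times> starts P n))
      \<le> (\<Sum>i\<in>{i\<in>hues P r \<times> starts P n. x \<in> fst (tree_box n r R P q i)}. wt ?s (tree_box n r R P q i))"
    by (rule mass_image[OF fin]) (use s in simp)
  also have "\<dots> \<le> (\<Sum>i\<in>hues P r \<times> starts P n. wt ?s (tree_box n r R P q i))"
    by (rule sum_mono2[OF fin]) (use s in \<open>auto intro: wt_nonneg\<close>)
  also have "\<dots> \<le> (\<Sum>i\<in>hues P r \<times> starts P n. \<Prod>p\<in>P. node_weight n r R q P p (snd i p))"
    by (rule sum_mono) (use wt_tree_box[OF P cardE n r] in auto)
  also have "\<dots> = (\<Sum>k\<in>hues P r. \<Sum>t\<in>starts P n. \<Prod>p\<in>P. node_weight n r R q P p (t p))"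
    by (simp only: sum.cartesian_product split_def snd_conv)
  also have "\<dots> = card (hues P r) * (\<Sum>t\<in>starts P n. \<Prod>p\<in>P. node_weight n r R q P p (t p))" by simp
  also have "\<dots> \<le> r * (\<Sum>t\<in>starts P n. \<Prod>p\<in>P. node_weight n r R q P p (t p))"
    by (rule mult_right_mono) (use card_hues(2)[OF P] nw0 in \<open>auto intro!: sum_nonneg prod_nonneg\<close>)
  also have "(\<Sum>t\<in>starts P n. \<Prod>p\<in>P. node_weight n r R q P p (t p))
     = (\<Prod>p\<in>P. \<Sum>t\<in>(if snd p = None then {0} else {..<n}). node_weight n r R q P p t)"
    unfolding starts_def by (rule prod_sum_PiE[symmetric]) (use finP in auto)
  also have "r * \<dots> \<le> r * (\<Prod>p\<in>P. (1 / r) ^ (n - card (hooks P p)) * (2 ^ card (hooks P p) * c p))"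
    by (intro mult_left_mono prod_mono conjI each sum_nonneg nw0) auto
  also have "(\<Prod>p\<in>P. (1 / real r) ^ (n - card (hooks P p)) * (2 ^ card (hooks P p) * c p))
      = (1 / r) ^ (\<Sum>p\<in>P. n - card (hooks P p)) * (2 ^ K * (\<Prod>p\<in>P. c p))"
    unfolding K_def by (simp only: prod.distrib power_sum)
  also have "(\<Prod>p\<in>P. c p) = 9 * \<rho> * (18 / real n) ^ (m - 1)"
  proof -
    have "(\<Prod>p\<in>P. c p) = c z * (\<Prod>p\<in>P - {z}. c p)" by (rule prod.remove[OF finP z(1)])
    also have "(\<Prod>p\<in>P - {z}. c p) = (\<Prod>p\<in>P - {z}. 18 / real n)"
    proof (rule prod.cong[OF refl])
      fix p assume "p \<in> P - {z}"
      then have "snd p \<noteq> None" using z(3) by blast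
      then show "c p = 18 / real n" unfolding c_def by (rule if_not_P)
    qed
    finally show ?thesis using z(1,2) finP by (simp add: c_def m_def)
  qed
  also have "r * ((1 / r) ^ (\<Sum>p\<in>P. n - card (hooks P p)) * (2 ^ K * (9 * \<rho> * (18 / real n) ^ (m - 1))))
     \<le> r * ((1 / r) ^ (m * (n - 1) + 1) * (2 ^ (m - 1) * (9 * \<rho> * (18 / real n) ^ (m - 1))))"
    by (intro mult_left_mono mult_mono power_decreasing[OF exps] power_increasing[OF K]) (use r \<rho> in auto)
  also have "\<dots> = 9 * \<rho> * ((1 / r) ^ (m * (n - 1)) * (36 / real n) ^ (m - 1))"
  proof -
    have "2 ^ (m - 1) * (18 / real n) ^ (m - 1) = (36 / real n) ^ (m - 1)" by (simp flip:
      power_mult_distrib)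
    moreover have "real r * (1 / r) ^ (m * (n - 1) + 1) = (1 / r) ^ (m * (n - 1))" using r by simp
    moreover have "r * ((1 / r) ^ (m * (n - 1) + 1) * (2 ^ (m - 1) * (9 * \<rho> * (18 / real n) ^ (m - 1))))
      = 9 * \<rho> * ((real r * (1 / r) ^ (m * (n - 1) + 1)) * (2 ^ (m - 1) * (18 / real n) ^ (m - 1)))"
      by (simp only: mult_ac)
    ultimately show ?thesis by (simp only:)
  qed
  also have "\<dots> = \<rho> * (real n / 4) * (36 / (real n * real r ^ (n - 1))) ^ m"
  proof -
    have 1: "(36 / real n) ^ m = (36 / real n) ^ (m - 1) * (36 / real n)" using m1 by (cases m) auto
    have 2: "(36 / (real n * real r ^ (n - 1))) ^ m = (1 / r) ^ (m * (n - 1)) * (36 / real n) ^ m"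
    proof -
      have "36 / (real n * real r ^ (n - 1)) = (1 / r) ^ (n - 1) * (36 / real n)" by (simp add:
        power_divide)
      then show ?thesis by (simp only: power_mult_distrib power_mult[symmetric] mult.commute[of m])
    qed
    have "\<rho> * (real n / 4) * ((1 / r) ^ (m * (n - 1)) * ((36 / real n) ^ (m - 1) * (36 / real n)))
      = (real n / 4 * (36 / real n)) * \<rho> * ((1 / r) ^ (m * (n - 1)) * (36 / real n) ^ (m - 1))"
      by (simp only: mult_ac)
    moreover have "real n / 4 * (36 / real n) = 9" using n by simp
    ultimately show ?thesis by (simp only: 1 2)
  qed
  finally show "mass ?s x (tree_box n r R P q ` (hues P r \<times> starts P n))
      \<le> (if q then (1 - R / n) ^ n else 1) * (real n / 4) * (36 / (real n * real r ^ (n - 1))) ^ card P"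
    unfolding \<rho>_def m_def .
qed

section \<open>Summation over all trees through a vertex\<close>

definition touches :: "'a node \<Rightarrow> 'a node \<Rightarrow> bool" where
  "touches p q \<longleftrightarrow> (\<exists>x. (snd q = Some x \<and> x \<in> fst p) \<or> (snd p = Some x \<and> x \<in> fst q))"

text \<open>On the side of the cut without the root, a node of least rank hangs on a node of smaller
  rank, which must lie on the other side.\<close>

lemma tree_linked:
  assumes P: "tree E P"
  shows "linked touches P"
  unfolding linked_def
proof (intro allI impI)
  fix A assume A: "A \<subset> P \<and> A \<noteq> {}"
  obtain z where z: "z \<in> P" "snd z = None" "\<And>p. p \<in> P \<Longrightarrow> snd p = None \<Longrightarrow> p = z"
    using P unfolding tree_def by auto
  obtain rk :: "'a node \<Rightarrow> nat" where rk: "\<And>p u. p \<in> P \<Longrightarrow> snd p = Some u \<Longrightarrow> \<exists>q\<in>P. rk q < rk p \<and> u \<in> hooks P q"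
    using P unfolding tree_def by blast
  define X where "X = (if z \<in> A then P - A else A)"
  have X: "X \<subseteq> P" "X \<noteq> {}" "z \<notin> X" using A z(1) unfolding X_def by auto
  obtain p where p: "p \<in> X" "\<And>q. q \<in> X \<Longrightarrow> rk p \<le> rk q"
    using ex_has_least_nat[of "\<lambda>p. p \<in> X" _ rk] X(2) by (metis equals0I)
  have "p \<noteq> z" "p \<in> P" using p(1) X by auto
  then obtain u where u: "snd p = Some u" using z(3)[of p] by (cases "snd p") auto
  obtain q where q: "q \<in> P" "rk q < rk p" "u \<in> hooks P q" using rk[OF \<open>p \<in> P\<close> u] by blast
  have qX: "q \<notin> X" using p(2)[of q] q(2) by auto
  have uq: "u \<in> fst q" using q(3) unfolding hooks_def by auto
  have t: "touches p q" "touches q p" unfolding touches_def using u uq by auto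
  show "\<exists>a\<in>A. \<exists>b\<in>P - A. touches a b"
  proof (cases "z \<in> A")
    case True
    then have "p \<in> P - A" "q \<in> A" using p(1) qX q(1) unfolding X_def by auto
    then show ?thesis using t by blast
  next
    case False
    then have "p \<in> A" "q \<in> P - A" using p(1) qX q(1) unfolding X_def by auto
    then show ?thesis using t by blast
  qed
qed

lemma finite_nodes:
  assumes "finite E" "\<And>e. e \<in> E \<Longrightarrow> finite e"
  shows "finite (nodes E)"
proof (rule finite_subset)
  show "nodes E \<subseteq> E \<times> insert None (Some ` (\<Union>E))"
  proof
    fix p assume "p \<in> nodes E"
    then show "p \<in> E \<times> insert None (Some ` (\<Union>E))"
      unfolding nodes_def by (cases p; cases "snd p") auto
  qed
  show "finite (E \<times> insert None (Some ` (\<Union>E)))" using assms by auto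
qed

lemma card_nodes_through:
  assumes finE: "finite E" and cardE: "\<And>e. e \<in> E \<Longrightarrow> finite e \<and> card e = n"
    and deg: "card {e\<in>E. x \<in> e} \<le> D"
  shows "card {p\<in>nodes E. x \<in> fst p} \<le> D * (n + 1)"
proof -
  have "{p\<in>nodes E. x \<in> fst p} \<subseteq> (SIGMA e:{e\<in>E. x \<in> e}. insert None (Some ` e))"
  proof
    fix p assume p: "p \<in> {p\<in>nodes E. x \<in> fst p}"
    obtain e a where "p = (e, a)" by (cases p)
    then show "p \<in> (SIGMA e:{e\<in>E. x \<in> e}. insert None (Some ` e))"
      using p unfolding nodes_def by (cases a) auto
  qed
  then have "card {p\<in>nodes E. x \<in> fst p} \<le> card (SIGMA e:{e\<in>E. x \<in> e}. insert None (Some ` e))"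
    by (rule card_mono[rotated]) (use finE cardE in auto)
  also have "\<dots> = (\<Sum>e\<in>{e\<in>E. x \<in> e}. card (insert None (Some ` e)))"
    by (rule card_SigmaI) (use finE cardE in auto)
  also have "\<dots> = (\<Sum>e\<in>{e\<in>E. x \<in> e}. n + 1)"
    by (rule sum.cong) (use cardE in \<open>auto simp: card_image\<close>)
  also have "\<dots> = card {e\<in>E. x \<in> e} * (n + 1)" by simp
  also have "\<dots> \<le> D * (n + 1)" by (rule mult_right_mono[OF deg]) simp
  finally show ?thesis .
qed

text \<open>Contact is required at the marked vertex of one of the two nodes, not at an arbitrary
  common vertex. This keeps the degree of order nD instead of n^2 D, so that it is balanced by the
  node factor 36/(n r^(n-1)).\<close>

lemma card_touches:
  assumes finE: "finite E" and cardE: "\<And>e. e \<in> E \<Longrightarrow> finite e \<and> card e = n" and n: "n \<ge> 1"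
    and deg: "\<And>x. card {e\<in>E. x \<in> e} \<le> D" and p: "p \<in> nodes E"
  shows "card {q\<in>nodes E. touches p q} \<le> 3 * n * D"
proof -
  define B where "B = (case snd p of None \<Rightarrow> {} | Some x \<Rightarrow> {q\<in>nodes E. x \<in> fst q})"
  define A where "A = (\<Union>x\<in>fst p. (\<lambda>e. (e, Some x)) ` {e\<in>E. x \<in> e})"
  have fp: "finite (fst p)" "card (fst p) = n" using p cardE unfolding nodes_def by auto
  have finN: "finite (nodes E)" using finite_nodes finE cardE by blast
  have "{q\<in>nodes E. touches p q} \<subseteq> A \<union> B"
  proof
    fix q assume q: "q \<in> {q\<in>nodes E. touches p q}"
    then obtain x where "(snd q = Some x \<and> x \<in> fst p) \<or> (snd p = Some x \<and> x \<in> fst q)"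
      unfolding touches_def by blast
    then show "q \<in> A \<union> B"
    proof
      assume x: "snd q = Some x \<and> x \<in> fst p"
      then have "q = (fst q, Some x)" "x \<in> fst q" "fst q \<in> E" using q unfolding nodes_def by (auto
        simp: prod_eq_iff)
      then have "q \<in> A" unfolding A_def using x by blast
      then show ?thesis ..
    next
      assume "snd p = Some x \<and> x \<in> fst q"
      then show ?thesis using q unfolding B_def by auto
    qed
  qed
  moreover have finA: "finite A" unfolding A_def using fp finE by auto
  moreover have finB: "finite B" unfolding B_def using finN by (cases "snd p") auto
  ultimately have "card {q\<in>nodes E. touches p q} \<le> card (A \<union> B)" by (intro card_mono) auto
  also have "\<dots> \<le> card A + card B" by (rule card_Un_le)
  also have "card A \<le> n * D"
  proof -
    have "finite A \<and> card A \<le> n * D" unfolding A_def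
      by (intro card_UN_bound card_image_bound) (use fp finE deg in auto)
    then show ?thesis ..
  qed
  also have "card B \<le> D * (n + 1)"
  proof (cases "snd p")
    case (Some x)
    then show ?thesis unfolding B_def using card_nodes_through[OF finE cardE deg] by simp
  qed (simp add: B_def)
  also have "n * D + D * (n + 1) \<le> 3 * n * D"
    using n mult_le_mono1[OF n, of D] by (simp add: algebra_simps)
  finally show ?thesis by simp
qed

definition tree_boxes :: "'a set set \<Rightarrow> nat \<Rightarrow> nat \<Rightarrow> nat \<Rightarrow> nat \<Rightarrow> ('a, nat \<times> nat) box set" where
  "tree_boxes E n r R T = (\<Union>(P, q)\<in>{(P, q). tree E P \<and> (q \<or> T < card P)}.
     tree_box n r R P q ` (hues P r \<times> starts P n))"

lemma tree_event_hits:
  assumes ev: "tree_event E r R T w" and pal: "\<And>e u. e \<in> E \<Longrightarrow> u \<in> e \<Longrightarrow> w u \<in> palette r n"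
  shows "\<exists>b\<in>tree_boxes E n r R T. hits w b"
proof -
  obtain P k q where P: "tree E P" and k: "colouring r P k" and q: "q \<or> T < card P"
    and w: "\<And>p u. p \<in> P \<Longrightarrow> u \<in> own P p \<Longrightarrow> fst (w u) = k p \<and> (\<forall>v. snd p = Some v \<longrightarrow> snd (w v) \<le> snd (w u)) \<and>
        (snd p = None \<and> q \<longrightarrow> R \<le> snd (w u))"
    using ev unfolding tree_event_def by blast
  define k' where "k' = restrict k P"
  define t where "t = (\<lambda>p\<in>P. case snd p of None \<Rightarrow> 0 | Some v \<Rightarrow> snd (w v))"
  have "k' \<in> hues P r" using k unfolding hues_def k'_def colouring_def by auto
  moreover have "t \<in> starts P n" unfolding starts_def
  proof (rule PiE_I)
    fix p assume p: "p \<in> P"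
    show "t p \<in> (if snd p = None then {0} else {..<n})"
    proof (cases "snd p")
      case (Some v)
      then have "fst p \<in> E" "v \<in> fst p" using p P unfolding tree_def nodes_def by auto
      then show ?thesis using pal[of "fst p" v] p Some unfolding t_def palette_def by auto
    qed (use p in \<open>simp add: t_def\<close>)
  qed (simp add: t_def)
  moreover have "hits w (tree_box n r R P q (k', t))"
    unfolding hits_def
  proof
    fix u assume "u \<in> fst (tree_box n r R P q (k', t))"
    then obtain p where p: "p \<in> P" "u \<in> own P p" unfolding tree_box_def by auto
    have "fst p \<in> E" "u \<in> fst p" using p P unfolding tree_def nodes_def own_def by auto
    then have "w u \<in> palette r n" using pal by blast
    moreover have "fst (w u) = k' p \<and> (\<forall>v. snd p = Some v \<longrightarrow> (if u = v then snd (w u) = t p else t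
      p \<le> snd (w u))) \<and>
      (snd p = None \<and> q \<longrightarrow> R \<le> snd (w u))" if "p \<in> P" "u \<in> own P p" for p
      using w[OF that] that(1) unfolding k'_def t_def by auto
    ultimately show "w u \<in> snd (tree_box n r R P q (k', t)) u" unfolding tree_box_def by simp
  qed
  ultimately show ?thesis using P q unfolding tree_boxes_def by blast
qed

text \<open>Trees are connected under \<open>touches\<close>, so \<open>cluster_sum\<close> bounds
  the sum of their weights. Twice the node factor fits under z, and the spare factor 2 per node
  yields 2^(-T) for trees with more than T nodes. For this, 216(3nD + 1) has to be at most n
  r^(n-1), which the constant 2048 ensures.\<close>

lemma mass_tree:
  assumes finE: "finite E" and cardE: "\<And>e. e \<in> E \<Longrightarrow> finite e \<and> card e = n" and n: "n \<ge> 2" and r: "r \<ge> 1"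
    and R: "2 * R \<le> n" and deg: "\<And>x. card {e\<in>E. x \<in> e} \<le> D" and D1: "D \<ge> 1"
    and D: "real (2048 * D) \<le> real r ^ (n - 1)"
  shows "finite (tree_boxes E n r R T)"
    and "mass (real r * (real n - 1)) x (tree_boxes E n r R T) \<le> (real n / 4) * ((1 - R / n) ^ n +
      (1 / 2) ^ T)"
proof -
  let ?s = "real r * (real n - 1)"
  have s: "?s > 0" using n r by simp
  have finN: "finite (nodes E)" using finite_nodes finE cardE by blast
  define \<T> :: "('a node set \<times> bool) set" where "\<T> = {(P, q). tree E P \<and> (q \<or> T < card P)}"
  have sub\<T>: "\<T> \<subseteq> Pow (nodes E) \<times> UNIV" unfolding \<T>_def tree_def by auto
  have fin\<T>: "finite \<T>" by (rule finite_subset[OF sub\<T>]) (use finN in auto)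
  define B :: "'a node set \<times> bool \<Rightarrow> ('a, nat \<times> nat) box set"
    where "B = (\<lambda>(P, q). tree_box n r R P q ` (hues P r \<times> starts P n))"
  have eqB: "tree_boxes E n r R T = (\<Union>i\<in>\<T>. B i)" unfolding tree_boxes_def \<T>_def B_def by auto
  have finB: "finite (B i)" if "i \<in> \<T>" for i
    using that tree_weight(1)[OF _ cardE n r R] unfolding \<T>_def B_def by auto
  show "finite (tree_boxes E n r R T)" unfolding eqB using fin\<T> finB by auto
  define \<omega> where "\<omega> = 36 / (real n * real r ^ (n - 1))"
  have \<omega>0: "\<omega> \<ge> 0" unfolding \<omega>_def by simp
  define \<rho> where "\<rho> = (1 - real R / n) ^ n"
  have \<rho>0: "\<rho> \<ge> 0" unfolding \<rho>_def using R n by (auto simp: field_simps)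
  define \<Delta> where "\<Delta> = 3 * n * D"
  \<comment> \<open>This density maximises p (1 - p)^\<Delta>, with value at least p0/3.\<close>
  define p0 where "p0 = 1 / (real \<Delta> + 1)"
  have p0: "0 < p0" "p0 \<le> 1" unfolding p0_def by auto
  define z where "z = p0 * (1 - p0) ^ \<Delta>"
  have \<Delta>1: "\<Delta> \<ge> 1" using n D1 unfolding \<Delta>_def by simp
  have z: "2 * \<omega> \<le> z"
  proof -
    have "(1 + 1 / real \<Delta>) ^ \<Delta> \<le> exp (1 / real \<Delta>) ^ \<Delta>"
      by (rule power_mono[OF exp_ge_add_one_self]) simp
    also have "\<dots> = exp (real \<Delta> * (1 / real \<Delta>))" by (rule exp_of_nat_mult[symmetric])
    also have "\<dots> \<le> 3" using \<Delta>1 exp_le by simp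
    finally have e: "(1 + 1 / real \<Delta>) ^ \<Delta> \<le> 3" .
    have "0 < 1 + 1 / real \<Delta>" by (intro add_pos_nonneg) auto
    then have e0: "0 < (1 + 1 / real \<Delta>) ^ \<Delta>" by (rule zero_less_power)
    have "1 - p0 = 1 / (1 + 1 / real \<Delta>)" using \<Delta>1 unfolding p0_def by (simp add: field_simps)
    then have "(1 - p0) ^ \<Delta> = 1 / (1 + 1 / real \<Delta>) ^ \<Delta>" by (simp add: power_divide)
    also have "\<dots> \<ge> 1 / 3" using e e0 by (intro divide_left_mono) auto
    finally have "(1 - p0) ^ \<Delta> \<ge> 1 / 3" .
    then have "p0 * (1 / 3) \<le> z" unfolding z_def using p0 by (intro mult_left_mono) auto
    moreover have "2 * \<omega> \<le> p0 * (1 / 3)"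
    proof -
      have nD: "1 * 1 \<le> real n * real D" using n D1 by (intro mult_mono) auto
      have "real \<Delta> = 3 * (real n * real D)" unfolding \<Delta>_def by simp
      then have "216 * real \<Delta> + 216 \<le> 2048 * (real n * real D)" using nD by linarith
      then have "2 * 36 * 3 * (real \<Delta> + 1) \<le> real n * real (2048 * D)" by simp
      also have "\<dots> \<le> real n * real r ^ (n - 1)" by (rule mult_left_mono[OF D]) simp
      finally show ?thesis unfolding \<omega>_def p0_def using n r by (simp add: field_simps)
    qed
    ultimately show ?thesis by linarith
  qed
  have z0: "z \<ge> 0" using \<omega>0 z by linarith
  define \<C> :: "'a node \<Rightarrow> 'a node set set" where "\<C> a = {P\<in>Pow (nodes E). a \<in> P \<and> linked touches P}" for a
  define big where "big a k = {P\<in>\<C> a. k \<le> card P}" for a k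
  have clus: "(\<Sum>P\<in>\<C> a. z ^ card P) \<le> p0" if "a \<in> nodes E" for a
    unfolding \<C>_def z_def
    by (rule cluster_sum[OF finN _ _ card_touches[OF finE cardE _ deg, folded \<Delta>_def] that]) (use
      p0 n in auto)
  have fin\<C>: "finite (\<C> a)" for a unfolding \<C>_def using finN by auto
  have half: "\<omega> ^ m \<le> (1 / 2) ^ k * z ^ m" if "k \<le> m" for k m
  proof -
    have "\<omega> ^ m \<le> (1 / 2 * z) ^ m" by (rule power_mono) (use z \<omega>0 in auto)
    also have "\<dots> = (1 / 2) ^ m * z ^ m" by (rule power_mult_distrib)
    also have "\<dots> \<le> (1 / 2) ^ k * z ^ m" using that z0 by (intro mult_right_mono power_decreasing) auto
    finally show ?thesis .
  qed
  have sum\<C>: "(\<Sum>P\<in>big a k. \<omega> ^ card P) \<le> (1 / 2) ^ k * p0" if a: "a \<in> nodes E" for a k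
  proof -
    have "(\<Sum>P\<in>big a k. \<omega> ^ card P) \<le> (\<Sum>P\<in>big a k. (1 / 2) ^ k * z ^ card P)"
      by (rule sum_mono) (use half in \<open>auto simp: big_def\<close>)
    also have "\<dots> \<le> (\<Sum>P\<in>\<C> a. (1 / 2) ^ k * z ^ card P)"
      by (rule sum_mono2) (use fin\<C> z0 in \<open>auto simp: big_def\<close>)
    also have "\<dots> = (1 / 2) ^ k * (\<Sum>P\<in>\<C> a. z ^ card P)" by (simp only: sum_distrib_left)
    also have "\<dots> \<le> (1 / 2) ^ k * p0" by (intro mult_left_mono clus a) auto
    finally show ?thesis .
  qed
  define A where "A = {a\<in>nodes E. x \<in> fst a}"
  have finA: "finite A" unfolding A_def using finN by auto
  have cA: "card A \<le> D * (n + 1)" unfolding A_def by (rule card_nodes_through[OF finE cardE deg])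
  define \<F> where "\<F> q = {P. (P, q) \<in> \<T> \<and> (\<exists>a\<in>A. a \<in> P)}" for q
  have fin\<F>: "finite (\<F> q)" for q
    by (rule finite_subset[of _ "Pow (nodes E)"]) (use sub\<T> finN in \<open>auto simp: \<F>_def\<close>)
  have sum\<F>: "(\<Sum>P\<in>\<F> q. \<omega> ^ card P) \<le> (1 / 2) ^ k" if k: "\<And>P. (P, q) \<in> \<T> \<Longrightarrow> k \<le> card P" for q k
  proof -
    have "\<F> q \<subseteq> (\<Union>a\<in>A. big a k)"
    proof
      fix P assume "P \<in> \<F> q"
      then obtain a where a: "a \<in> A" "a \<in> P" "(P, q) \<in> \<T>" unfolding \<F>_def by auto
      then have "tree E P" unfolding \<T>_def by auto
      then have "linked touches P" by (rule tree_linked)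
      moreover have "P \<subseteq> nodes E" using sub\<T> a(3) by auto
      ultimately have "P \<in> \<C> a" using a(2) unfolding \<C>_def by simp
      then show "P \<in> (\<Union>a\<in>A. big a k)" using a k unfolding big_def by blast
    qed
    moreover have finbig: "finite (big a k)" for a unfolding big_def using fin\<C> by auto
    ultimately have "(\<Sum>P\<in>\<F> q. \<omega> ^ card P) \<le> (\<Sum>P\<in>(\<Union>a\<in>A. big a k). \<omega> ^ card P)"
      by (intro sum_mono2) (use finA finbig \<omega>0 in auto)
    also have "\<dots> \<le> (\<Sum>a\<in>A. \<Sum>P\<in>big a k. \<omega> ^ card P)"
      using finA finbig \<omega>0
    proof (induction A rule: finite_induct)
      case (insert a A)
      let ?X = "big a k" and ?Y = "\<Union>a\<in>A. big a k"
      have "sum (\<lambda>P. \<omega> ^ card P) (?X \<union> ?Y) = sum (\<lambda>P. \<omega> ^ card P) ?X + sum (\<lambda>P. \<omega> ^ card P) ?Y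
          - sum (\<lambda>P. \<omega> ^ card P) (?X \<inter> ?Y)"
        by (rule sum_Un) (use insert in auto)
      moreover have "0 \<le> sum (\<lambda>P. \<omega> ^ card P) (?X \<inter> ?Y)" by (intro sum_nonneg) (use \<omega>0 in auto)
      ultimately show ?case using insert by simp
    qed simp
    also have "\<dots> \<le> (\<Sum>a\<in>A. (1 / 2) ^ k * p0)" by (rule sum_mono) (use sum\<C> in \<open>auto simp: A_def\<close>)
    \<comment> \<open>The number of nodes through x is at most \<Delta> + 1 = 1/p0, so the choice of
      the starting node cancels the bound p0 of the cluster sum.\<close>
    also have "\<dots> = (1 / 2) ^ k * (card A * p0)" by simp
    also have "\<dots> \<le> (1 / 2) ^ k * 1"
    proof (rule mult_left_mono)
      have "card A \<le> \<Delta> + 1"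
      proof -
        have "D * (n + 1) \<le> D * (3 * n)" by (rule mult_left_mono) (use n in auto)
        also have "\<dots> = \<Delta>" unfolding \<Delta>_def by simp
        finally have "D * (n + 1) \<le> \<Delta> + 1" by simp
        then show ?thesis using cA by linarith
      qed
      then have "real (card A) \<le> real (\<Delta> + 1)" by (simp only: of_nat_le_iff)
      then show "card A * p0 \<le> 1" unfolding p0_def by (simp add: field_simps)
    qed simp
    finally show ?thesis by simp
  qed
  have bound: "mass ?s x (B (P, q)) \<le> (if x \<in> \<Union>(fst ` P) then (if q then \<rho> else 1) * (real n / 4)
    * \<omega> ^ card P else 0)"
    if "(P, q) \<in> \<T>" for P q
  proof (cases "x \<in> \<Union>(fst ` P)")
    case True
    then show ?thesis using that tree_weight(2)[OF _ cardE n r R, where P = P and x = x and q = q]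
      unfolding \<T>_def B_def \<rho>_def \<omega>_def by auto
  next
    case False
    have "{b\<in>B (P, q). x \<in> fst b} = {}" using False unfolding B_def tree_box_def own_def by auto
    then have "mass ?s x (B (P, q)) = 0" unfolding mass_def by (simp only: sum.empty)
    then show ?thesis using False by simp
  qed
  have "mass ?s x (\<Union>i\<in>\<T>. B i) \<le> (\<Sum>i\<in>\<T>. mass ?s x (B i))"
    by (rule mass_UN) (use fin\<T> finB s in auto)
  also have "\<dots> \<le> (\<Sum>i\<in>\<T>. if x \<in> \<Union>(fst ` fst i) then (if snd i then \<rho> else 1) * (real n / 4) * \<omega> ^
    card (fst i) else 0)"
  proof (rule sum_mono)
    fix i assume "i \<in> \<T>"
    then show "mass ?s x (B i) \<le> (if x \<in> \<Union>(fst ` fst i) then (if snd i then \<rho> else 1) * (real n /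
      4) * \<omega> ^ card (fst i) else 0)"
      using bound[of "fst i" "snd i"] by (simp only: prod.collapse)
  qed
  also have "\<dots> = (\<Sum>i\<in>{i\<in>\<T>. x \<in> \<Union>(fst ` fst i)}. (if snd i then \<rho> else 1) * (real n / 4) * \<omega> ^ card (fst i))"
    by (rule sum.inter_filter[OF fin\<T>, symmetric])
  also have "{i\<in>\<T>. x \<in> \<Union>(fst ` fst i)} = (\<lambda>P. (P, True)) ` \<F> True \<union> (\<lambda>P. (P, False)) ` \<F> False"
  proof -
    have "x \<in> \<Union>(fst ` P) \<longleftrightarrow> (\<exists>a\<in>A. a \<in> P)" if "(P, q) \<in> \<T>" for P q
    proof -
      have "P \<subseteq> nodes E" using that sub\<T> by auto
      then show ?thesis unfolding A_def by blast
    qed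
    note key = this
    show ?thesis
    proof (rule set_eqI)
      fix i :: "'a node set \<times> bool"
      obtain P q where i: "i = (P, q)" by (cases i)
      have "i \<in> {i\<in>\<T>. x \<in> \<Union>(fst ` fst i)} \<longleftrightarrow> (P, q) \<in> \<T> \<and> x \<in> \<Union>(fst ` P)"
        by (simp only: i mem_Collect_eq fst_conv)
      also have "\<dots> \<longleftrightarrow> P \<in> \<F> q"
        unfolding \<F>_def mem_Collect_eq by (intro conj_cong refl key)
      also have "\<dots> \<longleftrightarrow> i \<in> (\<lambda>P. (P, True)) ` \<F> True \<union> (\<lambda>P. (P, False)) ` \<F> False"
        unfolding i by (cases q) auto
      finally show "i \<in> {i\<in>\<T>. x \<in> \<Union>(fst ` fst i)} \<longleftrightarrow> i \<in> (\<lambda>P. (P, True)) ` \<F> True \<union> (\<lambda>P. (P,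
        False)) ` \<F> False" .
    qed
  qed
  also have "(\<Sum>i\<in>(\<lambda>P. (P, True)) ` \<F> True \<union> (\<lambda>P. (P, False)) ` \<F> False. (if snd i then \<rho> else 1) *
    (real n / 4) * \<omega> ^ card (fst i))
    = (\<Sum>P\<in>\<F> True. \<rho> * (real n / 4) * \<omega> ^ card P) + (\<Sum>P\<in>\<F> False. (real n / 4) * \<omega> ^ card P)"
    by (subst sum.union_disjoint) (use fin\<F> in \<open>auto simp: sum.reindex inj_on_def\<close>)
  also have "\<dots> = (real n / 4) * (\<rho> * (\<Sum>P\<in>\<F> True. \<omega> ^ card P) + (\<Sum>P\<in>\<F> False. \<omega> ^ card P))"
    by (simp add: sum_distrib_left algebra_simps)
  also have "\<dots> \<le> (real n / 4) * (\<rho> * (1 / 2) ^ 0 + (1 / 2) ^ T)"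
    by (intro mult_left_mono add_mono sum\<F>) (use \<rho>0 in \<open>auto simp: \<T>_def\<close>)
  finally show "mass ?s x (tree_boxes E n r R T) \<le> (real n / 4) * ((1 - R / n) ^ n + (1 / 2) ^ T)"
    unfolding eqB \<rho>_def by simp
qed

section \<open>The lower bound\<close>

definition good_colouring :: "nat \<Rightarrow> nat \<Rightarrow> nat \<Rightarrow> bool" where
  "good_colouring n r N \<longleftrightarrow> (\<exists>c :: nat \<Rightarrow> nat. c \<in> {1..N} \<rightarrow> {..<r} \<and> (\<forall>A\<in>aps n N. \<nexists>k. \<forall>x\<in>A. c x = k))"

lemma good_colouring_iff: "good_colouring n r N \<longleftrightarrow> \<not> vdW_property n r N"
  unfolding good_colouring_def vdW_property_def aps_def by blast

text \<open>Through a vertex pass at most 2 N r boxes, a progression with a colour each, of weight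
  at most 9 r^(-n). Their mass 18 N r^(1 - n) has to be at most t = 1/n, and here the factor n is
  lost.\<close>

lemma small_n:
  assumes n: "n \<ge> 2" and r: "r \<ge> 1" and N: "18 * n * N \<le> r ^ (n - 1)"
  shows "good_colouring n r N"
proof -
  define f where "f = (\<lambda>(A :: nat set, k :: nat). (A, \<lambda>_ :: nat. {k}))"
  define I where "I = aps n N \<times> {..<r}"
  let ?s = "real (card {..<r}) * (1 - 1 / real n)"
  have s: "?s > 0" using n r by simp
  have finI: "finite I" unfolding I_def using finite_aps by auto
  have "\<exists>w \<in> {1..N} \<rightarrow>\<^sub>E {..<r}. \<forall>b\<in>f ` I. \<not> hits w b"
  proof (rule local_lemma)
    show "{..<r} \<noteq> {}" using r by (simp add: lessThan_empty_iff)
    show "finite (f ` I)" using finI by simp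
    fix b assume "b \<in> f ` I"
    then obtain A k where "A \<in> aps n N" "k < r" "b = (A, \<lambda>_. {k})" unfolding f_def I_def by auto
    moreover from this have "A \<noteq> {}" using card_aps[of A n N] n by auto
    ultimately show "fst b \<subseteq> {1..N} \<and> fst b \<noteq> {} \<and> (\<forall>u\<in>fst b. snd b u \<subseteq> {..<r})"
      unfolding aps_def by auto
  next
    fix x :: nat
    have "mass ?s x (f ` I) \<le> card {i\<in>I. x \<in> fst (f i)} * (9 * (1 / r) ^ n)"
    proof (rule mass_image_le[OF finI])
      fix i assume "i \<in> I"
      then obtain A k where i: "i = (A, k)" "A \<in> aps n N" unfolding I_def by auto
      have "wt ?s (f i) = (1 / ?s) ^ n" using card_aps[OF i(2)] unfolding i f_def wt_def by simp
      also have "1 / ?s = (1 / r) * (real n / (real n - 1))" using n r by (simp add: field_simps)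
      also have "\<dots> ^ n = (1 / r) ^ n * (real n / (real n - 1)) ^ n" by (rule power_mult_distrib)
      also have "\<dots> \<le> (1 / r) ^ n * 9" by (intro mult_left_mono ratio_power_le n) auto
      finally show "wt ?s (f i) \<le> 9 * (1 / r) ^ n" by simp
    qed (use s in simp)
    also have "\<dots> \<le> real (2 * N * r) * (9 * (1 / r) ^ n)"
    proof (rule mult_right_mono)
      have "{i\<in>I. x \<in> fst (f i)} = {A \<in> aps n N. x \<in> A} \<times> {..<r}" unfolding I_def f_def by auto
      then have "card {i\<in>I. x \<in> fst (f i)} = card {A \<in> aps n N. x \<in> A} * r" by (simp add:
        card_cartesian_product)
      also have "\<dots> \<le> 2 * N * r" by (intro mult_right_mono card_aps_through n) auto
      finally show "real (card {i\<in>I. x \<in> fst (f i)}) \<le> real (2 * N * r)" by (simp only: of_nat_le_iff)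
    qed simp
    also have "\<dots> = real (18 * N) * (r * (1 / r) ^ n)" by simp
    also have "r * (1 / r) ^ n = (1 / real r) ^ (n - 1)" using n r by (cases n) auto
    also have "real (18 * N) * (1 / real r) ^ (n - 1) \<le> 1 / n"
    proof -
      have "real (18 * n * N) \<le> real (r ^ (n - 1))" using N by (simp only: of_nat_le_iff)
      then have "real n * real (18 * N) \<le> real r ^ (n - 1)" by (simp add: mult_ac)
      then show ?thesis using n r by (simp add: power_divide field_simps)
    qed
    finally show "mass ?s x (f ` I) \<le> 1 / n" .
  qed (use n in auto)
  then obtain w where w: "w \<in> {1..N} \<rightarrow>\<^sub>E {..<r}" "\<And>b. b \<in> f ` I \<Longrightarrow> \<not> hits w b" by blast
  have "\<nexists>k. \<forall>x\<in>A. w x = k" if A: "A \<in> aps n N" for A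
  proof
    assume "\<exists>k. \<forall>x\<in>A. w x = k"
    then obtain k where k: "\<forall>x\<in>A. w x = k" by blast
    have "A \<noteq> {}" using card_aps[OF A] n by auto
    then obtain x where x: "x \<in> A" by blast
    then have "w x \<in> {..<r}" using w(1) A unfolding aps_def by auto
    then have "k < r" using k x by auto
    then have "f (A, k) \<in> f ` I" using A unfolding I_def by auto
    moreover have "hits w (f (A, k))" using k unfolding hits_def f_def by auto
    ultimately show False using w(2) by blast
  qed
  moreover have "w \<in> {1..N} \<rightarrow> {..<r}" using w(1) by auto
  ultimately show ?thesis unfolding good_colouring_def by blast
qed

section \<open>Large n: the parameters and the corrected colouring\<close>

definition rounds :: "nat \<Rightarrow> nat" where
  "rounds n = nat \<lceil>8 * ln (real n)\<rceil>"

definition cyc_error :: "nat \<Rightarrow> nat \<Rightarrow> real" where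
  "cyc_error n R = (let M = real (2 * R + 1) in
     M * (M * real (729 * n ^ 3) * (4 * real n * (81 * real n ^ 2) * exp (2 * (real R + 1))) ^ (2
       * R + 1) * (1 / 2) ^ (n div 4)))"

text \<open>The constant 4096 is 2048 times 2, because the degree D is 2N. Each of the three kinds
  of boxes has mass at most 1/(4n), which together stays below t = 1/n. The same R bounds the labels
  and counts the rounds.\<close>

lemma large_n:
  assumes n: "n \<ge> 8" and r: "r \<ge> 2" and N1: "N \<ge> 1" and N: "4096 * N \<le> r ^ (n - 1)"
    and R: "512 * R \<le> n" and cyc_small: "cyc_error n R \<le> 1 / (4 * n)"
    and tree_small: "(real n / 4) * ((1 - R / n) ^ n + (1 / 2) ^ R) \<le> 1 / (4 * n)"
    and dense_small: "(1 / 8) ^ n \<le> 1 / (4 * real n)"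
  shows "good_colouring n r N"
proof -
  let ?E = "aps n N"
  let ?s = "real r * (real n - 1)"
  have s: "?s > 0" using n r by simp
  have finE: "finite ?E" by (rule finite_aps)
  have cardE: "finite e \<and> card e = n" if "e \<in> ?E" for e
    using card_aps[OF that] that finite_subset[of e "{1..N}"] unfolding aps_def by auto
  have deg: "card {e\<in>?E. x \<in> e} \<le> 2 * N" for x by (rule card_aps_through) (use n in simp)
  have bdeg: "card {b\<in>blocks n ?E. x \<in> body b} \<le> 81 * n ^ 2 * N" for x
    using card_blocks_through[of n N x] n unfolding body_def by simp
  have bcodeg: "card {b\<in>blocks n ?E. x \<in> body b \<and> y \<in> body b} \<le> 729 * n ^ 3" if "x \<noteq> y" for x y
    using card_blocks_through_two[of n x y N] n that unfolding body_def by simp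
  have rN: "4096 * real N \<le> real r ^ (n - 1)"
  proof -
    have "real (4096 * N) \<le> real (r ^ (n - 1))" using N by (simp only: of_nat_le_iff)
    then show ?thesis by simp
  qed
  define B1 where "B1 = dense_box n r R ` dense_index ?E n r"
  define B2 where "B2 = (\<Union>L\<in>{2..2 * R + 1}. cyc_box n r R ` cyc_index ?E n r L)"
  define B3 where "B3 = tree_boxes ?E n r R R"
  have n2: "n \<ge> 2" and r1: "r \<ge> 1" and R2: "2 * R \<le> n" using n r R by auto
  have D1: "real (2 * N) \<le> real r ^ (n - 1)" using rN by simp
  have D2: "real (2048 * (2 * N)) \<le> real r ^ (n - 1)" using rN by simp
  have d: "(1 :: real) \<le> 81 * real n ^ 2" using n2 by (simp add: one_le_power mult_ge1_I)
  have D3: "real (81 * n ^ 2 * N) \<le> (81 * real n ^ 2) * real r ^ (n - 1)"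
  proof -
    have "real N \<le> real r ^ (n - 1)" using rN by linarith
    then have "(81 * real n ^ 2) * real N \<le> (81 * real n ^ 2) * real r ^ (n - 1)" by (intro
      mult_left_mono) auto
    then show ?thesis by simp
  qed
  have B0: "1 \<le> exp (2 * (real R + 1))" by simp
  have B0': "(real (n + R) / (real n - 1)) ^ n \<le> exp (2 * (real R + 1))"
  proof -
    have "real (n + R) / (real n - 1) = 1 + (real R + 1) / (real n - 1)" using n by (simp add: field_simps)
    also have "\<dots> \<le> exp ((real R + 1) / (real n - 1))" by (rule exp_ge_add_one_self)
    finally have "(real (n + R) / (real n - 1)) ^ n \<le> exp ((real R + 1) / (real n - 1)) ^ n"
      by (rule power_mono) (use n in simp)
    also have "\<dots> = exp (real n * ((real R + 1) / (real n - 1)))" by (rule exp_of_nat_mult[symmetric])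
    also have "\<dots> \<le> exp (2 * (real R + 1))"
    proof (subst exp_le_cancel_iff)
      have "real n \<le> 2 * real n - 2" using n by simp
      then have "real n * (real R + 1) \<le> (2 * real n - 2) * (real R + 1)" by (intro mult_right_mono) auto
      then show "real n * ((real R + 1) / (real n - 1)) \<le> 2 * (real R + 1)" using n by (simp add:
        field_simps)
    qed
    finally show ?thesis .
  qed
  have N2: "1 \<le> 2 * N" using N1 by simp
  have fin: "finite B1" "finite B2" "finite B3"
    unfolding B1_def B2_def B3_def
    by (rule mass_dense(1)[OF finE cardE deg n2 r1 R D1] mass_cyc(1)[OF finE cardE n2 r bdeg
      bcodeg d D3 B0 B0']
        mass_tree(1)[OF finE cardE n2 r1 R2 deg N2 D2]; assumption)+
  have m1: "mass ?s x B1 \<le> (1 / 8) ^ n" for x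
    unfolding B1_def by (rule mass_dense(2)[OF finE cardE deg n2 r1 R D1])
  have m2: "mass ?s x B2 \<le> cyc_error n R" for x
  proof -
    have "mass ?s x B2 \<le> real (2 * R + 1) * (real ((2 * R + 1) * (729 * n ^ 3))
        * (4 * real n * (81 * real n ^ 2) * exp (2 * (real R + 1))) ^ (2 * R + 1) * (1 / 2) ^ (n div 4))"
      unfolding B2_def by (rule mass_cyc(2)[OF finE cardE n2 r bdeg bcodeg d D3 B0 B0'])
    also have "\<dots> = cyc_error n R" unfolding cyc_error_def Let_def by (simp only: of_nat_mult)
    finally show ?thesis .
  qed
  have m3: "mass ?s x B3 \<le> (real n / 4) * ((1 - R / n) ^ n + (1 / 2) ^ R)" for x
    unfolding B3_def by (rule mass_tree(2)[OF finE cardE n2 r1 R2 deg N2 D2])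
  have "\<exists>w \<in> {1..N} \<rightarrow>\<^sub>E palette r n. \<forall>b\<in>B1 \<union> B2 \<union> B3. \<not> hits w b"
  proof (rule local_lemma)
    show "finite (palette r n)" "palette r n \<noteq> {}" using n r unfolding palette_def
      by (auto simp: lessThan_empty_iff)
    show "finite (B1 \<union> B2 \<union> B3)" using fin by auto
    fix b assume b: "b \<in> B1 \<union> B2 \<union> B3"
    show "fst b \<subseteq> {1..N} \<and> fst b \<noteq> {} \<and> (\<forall>u\<in>fst b. snd b u \<subseteq> palette r n)"
    proof -
      have V: "e \<subseteq> {1..N}" "e \<noteq> {}" if "e \<in> ?E" for e
        using that card_aps[OF that] n unfolding aps_def by auto
      from b consider "b \<in> B1" | "b \<in> B2" | "b \<in> B3" by blast
      then show ?thesis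
      proof cases
        case 1
        then obtain i where "i \<in> dense_index ?E n r" "b = dense_box n r R i" unfolding B1_def by blast
        then obtain e k S where "b = dense_box n r R (e, k, S)" "e \<in> ?E" unfolding dense_index_def by auto
        then show ?thesis using V[of e] unfolding dense_box_def by auto
      next
        case 2
        then obtain L where L: "L \<in> {2..2 * R + 1}" "b \<in> cyc_box n r R ` cyc_index ?E n r L"
          unfolding B2_def by blast
        then obtain i where b: "L \<ge> 2" "i \<in> cyc_index ?E n r L" "b = cyc_box n r R i" by auto
        obtain bs ks where i: "i = (bs, ks)" by (cases i)
        have bs: "cyc n ?E bs" "length bs = L" using b(2) unfolding i cyc_index_def by auto
        have fE: "fst x \<in> ?E" if "x \<in> set bs" for x using bs(1) that unfolding links_def blocks_def by auto
        have "bs \<noteq> []" using bs(2) b(1) by auto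
        then obtain x where x: "x \<in> set bs" by (cases bs) auto
        have "(\<Union>b\<in>set bs. fst b) \<noteq> {}" using V(2)[OF fE[OF x]] x by blast
        moreover have "(\<Union>b\<in>set bs. fst b) \<subseteq> {1..N}" by (rule UN_least) (rule V(1)[OF fE])
        ultimately show ?thesis unfolding b(3) i cyc_box_def by auto
      next
        case 3
        then obtain P q i where c: "tree ?E P" "b = tree_box n r R P q i"
          unfolding B3_def tree_boxes_def by blast
        obtain k t where i: "i = (k, t)" by (cases i)
        have P: "finite P" "P \<subseteq> nodes ?E" "(\<Sum>p\<in>P. card (hooks P p)) < card P" using c(1) unfolding
          tree_def by auto
        have fE: "fst p \<in> ?E" if "p \<in> P" for p using P(2) that unfolding nodes_def by auto
        have "(\<Union>p\<in>P. own P p) \<noteq> {}"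
        proof
          assume e: "(\<Union>p\<in>P. own P p) = {}"
          have "1 \<le> card (hooks P p)" if "p \<in> P" for p
          proof -
            have "own P p = {}" using e that by auto
            then have "card (fst p) - card (hooks P p) = 0" using card_own(1)[of p P] cardE[OF
              fE[OF that]] by simp
            then show ?thesis using cardE[OF fE[OF that]] n by simp
          qed
          then have "(\<Sum>p\<in>P. 1) \<le> (\<Sum>p\<in>P. card (hooks P p))" by (rule sum_mono)
          then show False using P(3) by simp
        qed
        moreover have "(\<Union>p\<in>P. own P p) \<subseteq> {1..N}"
        proof (rule UN_least)
          fix p assume "p \<in> P"
          from V(1)[OF fE[OF this]] show "own P p \<subseteq> {1..N}" unfolding own_def by (rule
            subset_trans[OF Diff_subset])
        qed
        ultimately show ?thesis unfolding c(2) i tree_box_def by auto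
      qed
    qed
  next
    fix x
    have seq: "real (card (palette r n)) * (1 - 1 / real n) = ?s"
      using n by (simp add: palette_def card_cartesian_product field_simps)
    have "mass ?s x (B1 \<union> B2 \<union> B3) \<le> mass ?s x (B1 \<union> B2) + mass ?s x B3"
      by (rule mass_mono_Un) (use fin s in auto)
    also have "mass ?s x (B1 \<union> B2) \<le> mass ?s x B1 + mass ?s x B2"
      by (rule mass_mono_Un) (use fin s in auto)
    also have "mass ?s x B1 \<le> 1 / (4 * n)" using m1[of x] dense_small by simp
    also have "mass ?s x B2 \<le> 1 / (4 * n)" using order_trans[OF m2 cyc_small] by simp
    also have "mass ?s x B3 \<le> 1 / (4 * n)" using order_trans[OF m3 tree_small] by simp
    finally have "mass ?s x (B1 \<union> B2 \<union> B3) \<le> 1 / real (4 * n) + 1 / real (4 * n) + 1 / real (4 * n)" by simp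
    also have "\<dots> \<le> 1 / n" using n by (simp add: field_simps)
    finally show "mass (real (card (palette r n)) * (1 - 1 / real n)) x (B1 \<union> B2 \<union> B3) \<le> 1 / n"
      unfolding seq .
  qed (use n in auto)
  then obtain w where w: "w \<in> {1..N} \<rightarrow>\<^sub>E palette r n" "\<And>b. b \<in> B1 \<union> B2 \<union> B3 \<Longrightarrow> \<not> hits w b" by blast
  have pal: "w u \<in> palette r n" if "e \<in> ?E" "u \<in> e" for e u
    using w(1) that unfolding aps_def by auto
  interpret recolouring ?E n r R R w
  proof
    show "fst (w u) < r" if "e \<in> ?E" "u \<in> e" for e u using pal[OF that] unfolding palette_def by auto
  qed (use finE cardE n r in auto)
  have "\<not> dense_event ?E n r R w"
  proof
    assume ev: "dense_event ?E n r R w"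
    have "\<exists>b\<in>B1. hits w b" unfolding B1_def by (rule dense_event_hits[OF ev pal])
    then show False using w(2) by blast
  qed
  moreover have "\<not> cyc_event ?E n r R (2 * R + 1) w"
  proof
    assume ev: "cyc_event ?E n r R (2 * R + 1) w"
    have "\<exists>b\<in>B2. hits w b" unfolding B2_def by (rule cyc_event_hits[OF ev pal])
    then show False using w(2) by blast
  qed
  moreover have "\<not> tree_event ?E r R R w"
  proof
    assume ev: "tree_event ?E r R R w"
    have "\<exists>b\<in>B3. hits w b" unfolding B3_def by (rule tree_event_hits[OF ev pal])
    then show False using w(2) by blast
  qed
  ultimately have nm: "\<not> monochromatic (flip R) A" if "A \<in> ?E" for A
    using recolouring_succeeds that by blast
  show ?thesis unfolding good_colouring_def
  proof (intro exI[of _ "shown (flip R)"] conjI ballI)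
    show "shown (flip R) \<in> {1..N} \<rightarrow> {..<r}"
    proof
      fix u assume "u \<in> {1..N}"
      then have "w u \<in> palette r n" using w(1) by auto
      then show "shown (flip R) u \<in> {..<r}" using r unfolding shown_def palette_def by auto
    qed
    fix A assume "A \<in> ?E"
    then show "\<nexists>k. \<forall>x\<in>A. shown (flip R) x = k" using nm unfolding monochromatic_def by blast
  qed
qed

definition admissible :: "nat \<Rightarrow> bool" where
  "admissible n \<longleftrightarrow> 512 * rounds n \<le> n \<and> cyc_error n (rounds n) \<le> 1 / (4 * n) \<and>
     (real n / 4) * ((1 - rounds n / n) ^ n + (1 / 2) ^ rounds n) \<le> 1 / (4 * n) \<and>
     (1 / 8) ^ n \<le> 1 / (4 * real n) \<and> 8 \<le> n"

text \<open>The 8 in \<open>rounds\<close> makes both e^(-R) and 2^(-R) at most n^(-4), enough to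
  turn the loss n/4 of the trees into 1/(4n). In the cyclic error a base of at most n^20 is raised
  to a power O(ln n), which is negligible against 2^(-n/4).\<close>

lemma eventually_admissible: "\<forall>\<^sub>F n in sequentially. admissible n"
proof -
  have E1: "\<forall>\<^sub>F n in sequentially. 512 * (8 * ln (real n) + 1) \<le> real n" by real_asymp
  have E2: "\<forall>\<^sub>F n in sequentially. 324 * exp 4 * real n ^ 19 \<le> real n ^ 20" by real_asymp
  have E3: "\<forall>\<^sub>F n in sequentially. 16 * ln (real n) + 3 \<le> real n" by real_asymp
  have E4: "\<forall>\<^sub>F n in sequentially. real n * (real n * (729 * real n ^ 3) *
      exp (20 * ln (real n) * (16 * ln (real n) + 3)) * (2 * exp (- (real n / 4) * ln 2))) \<le> 1 /
        (4 * real n)"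
    by real_asymp
  have E5: "\<forall>\<^sub>F n in sequentially. (1 / 8) ^ n \<le> 1 / (4 * real n)" by real_asymp
  have E6: "\<forall>\<^sub>F n in sequentially. (8 :: nat) \<le> n" by (rule eventually_ge_at_top)
  from E1 E2 E3 E4 E5 E6 show ?thesis
  proof eventually_elim
    case (elim n)
    define R where "R = rounds n"
    have n0: "real n > 0" using elim(6) by simp
    have ln0: "0 \<le> ln (real n)" using elim(6) by simp
    have Rup: "real R \<le> 8 * ln (real n) + 1" and Rlow: "8 * ln (real n) \<le> real R"
      unfolding R_def rounds_def using ln0 by (auto simp: of_nat_nat)
    have R512: "512 * R \<le> n"
    proof -
      have "512 * real R \<le> 512 * (8 * ln (real n) + 1)" using Rup by (intro mult_left_mono) auto
      then have "real (512 * R) \<le> real n" using elim(1) by simp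
      then show ?thesis by (simp only: of_nat_le_iff)
    qed
    have tree: "(real n / 4) * ((1 - R / n) ^ n + (1 / 2) ^ R) \<le> 1 / (4 * n)"
    proof -
      have e4: "exp (- (4 * ln (real n))) = 1 / real n ^ 4"
        using n0 exp_of_nat_mult[of 4 "ln (real n)"] by (simp add: exp_minus inverse_eq_divide)
      have "(1 - R / n) ^ n \<le> exp (- (R / n)) ^ n"
        by (rule power_mono) (use exp_ge_add_one_self[of "- (R / n)"] R512 n0 in \<open>auto simp: field_simps\<close>)
      also have "\<dots> = exp (- real R)" using n0 by (simp flip: exp_of_nat_mult)
      also have "\<dots> \<le> exp (- (4 * ln (real n)))" using Rlow ln0 by simp
      finally have 1: "(1 - R / n) ^ n \<le> 1 / real n ^ 4" unfolding e4 .
      have "(1 / 2 :: real) ^ R = exp (- (real R * ln 2))"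
        by (simp add: exp_minus exp_of_nat_mult power_divide inverse_eq_divide)
      also have "\<dots> \<le> exp (- (4 * ln (real n)))"
      proof -
        \<comment> \<open>The crude bound ln 2 \<ge> 1/2 is where half of the factor 8 is
          spent.\<close>
        have "exp (1 :: real) \<le> 2 ^ 2" using exp_le by simp
        then have "1 \<le> ln ((2 :: real) ^ 2)" by (subst ln_ge_iff) auto
        moreover have "ln ((2 :: real) ^ 2) = 2 * ln 2" by (subst ln_realpow) auto
        ultimately have "1 / 2 \<le> ln (2 :: real)" by linarith
        then have "real R * (1 / 2) \<le> real R * ln 2" by (intro mult_left_mono) auto
        then show ?thesis using Rlow by simp
      qed
      finally have 2: "(1 / 2) ^ R \<le> 1 / real n ^ 4" unfolding e4 .
      have "(real n / 4) * ((1 - R / n) ^ n + (1 / 2) ^ R) \<le> (real n / 4) * (1 / real n ^ 4 + 1 /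
        real n ^ 4)"
        by (intro mult_left_mono add_mono 1 2) simp
      also have "\<dots> = 1 / (4 * n) * (2 / real n ^ 2)" using n0 by (simp add: field_simps eval_nat_numeral)
      also have "\<dots> \<le> 1 / (4 * n) * 1"
      proof (rule mult_left_mono)
        have "8 * 8 \<le> real n * real n" using elim(6) by (intro mult_mono) auto
        then show "2 / real n ^ 2 \<le> 1" using n0 by (simp add: power2_eq_square)
      qed simp
      finally show ?thesis by simp
    qed
    have cyc: "cyc_error n R \<le> 1 / (4 * n)"
    proof -
      let ?b = "4 * real n * (81 * real n ^ 2) * exp (2 * (real R + 1))"
      let ?M = "2 * R + 1"
      have M: "real ?M \<le> 16 * ln (real n) + 3" using Rup by simp
      then have Mn: "real ?M \<le> real n" using elim(3) by linarith
      have "exp (2 * (real R + 1)) \<le> exp (4 + 16 * ln (real n))" using Rup by simp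
      also have "\<dots> = exp 4 * real n ^ 16"
        using n0 exp_of_nat_mult[of 16 "ln (real n)"] by (simp add: exp_add)
      finally have "?b \<le> 4 * real n * (81 * real n ^ 2) * (exp 4 * real n ^ 16)"
        by (intro mult_left_mono) auto
      also have "\<dots> = 324 * exp 4 * real n ^ 19" by (simp add: eval_nat_numeral)
      also have "\<dots> \<le> real n ^ 20" by (rule elim(2))
      also have "\<dots> = exp (20 * ln (real n))" using n0 exp_of_nat_mult[of 20 "ln (real n)"] by simp
      finally have "?b \<le> exp (20 * ln (real n))" .
      then have "?b ^ ?M \<le> exp (20 * ln (real n)) ^ ?M" by (rule power_mono) simp
      also have "\<dots> = exp (real ?M * (20 * ln (real n)))" by (rule exp_of_nat_mult[symmetric])
      also have "\<dots> \<le> exp (20 * ln (real n) * (16 * ln (real n) + 3))"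
        using mult_right_mono[OF M, of "20 * ln (real n)"] ln0 by (simp add: mult.commute)
      finally have b: "?b ^ ?M \<le> exp (20 * ln (real n) * (16 * ln (real n) + 3))" .
      have half: "(1 / 2 :: real) ^ (n div 4) \<le> 2 * exp (- (real n / 4) * ln 2)"
      proof -
        have "real n / 4 - 1 \<le> real (n div 4)" by linarith
        then have "(real n / 4 - 1) * ln 2 \<le> real (n div 4) * ln 2" by (intro mult_right_mono) auto
        then have 1: "exp (- (real (n div 4) * ln 2)) \<le> exp (ln 2 + - (real n / 4) * ln 2)" by
          (simp add: algebra_simps)
        have 2: "(1 / 2 :: real) ^ (n div 4) = exp (- (real (n div 4) * ln 2))"
          by (simp add: exp_minus exp_of_nat_mult power_divide inverse_eq_divide)
        have "exp (ln 2 + - (real n / 4) * ln 2) = 2 * exp (- (real n / 4) * ln 2)"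
          unfolding exp_add by simp
        then show ?thesis using 1 unfolding 2 by simp
      qed
      have "cyc_error n R = real ?M * (real ?M * (729 * real n ^ 3) * ?b ^ ?M * (1 / 2) ^ (n div 4))"
        unfolding cyc_error_def Let_def by simp
      also have "\<dots> \<le> real n * (real n * (729 * real n ^ 3) *
          exp (20 * ln (real n) * (16 * ln (real n) + 3)) * (2 * exp (- (real n / 4) * ln 2)))"
        by (intro mult_mono Mn b half) auto
      also have "\<dots> \<le> 1 / (4 * real n)" by (rule elim(4))
      finally show ?thesis by simp
    qed
    show ?case unfolding admissible_def
      using R512 cyc tree elim(5,6) by (simp only: R_def of_nat_mult of_nat_numeral)
  qed
qed

theorem theorem2:
  "\<exists>\<beta>::real. \<beta> > 0 \<and>
     (\<forall>r n :: nat. r \<ge> 2 \<longrightarrow> n \<ge> 3 \<longrightarrow> real (vdW_number n r) \<ge> \<beta> * real r ^ (n - 1))"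
proof -
  obtain n0 where n0: "\<forall>n\<ge>n0. admissible n"
    using eventually_admissible unfolding eventually_sequentially by (rule exE)
  \<comment> \<open>The summand 4096 serves all n from n0 on; 18 * n0 serves the smaller n, for
    which the lost factor n is at most n0.\<close>
  define \<beta> where "\<beta> = 1 / (4096 + 18 * real n0)"
  have \<beta>: "\<beta> > 0" unfolding \<beta>_def by (intro divide_pos_pos) auto
  have "real (vdW_number n r) \<ge> \<beta> * real r ^ (n - 1)" if r: "r \<ge> 2" and n: "n \<ge> 3" for r n :: nat
  proof (rule ccontr)
    define N where "N = vdW_number n r"
    assume "\<not> real (vdW_number n r) \<ge> \<beta> * real r ^ (n - 1)"
    then have "real N < real r ^ (n - 1) / (4096 + 18 * real n0)" unfolding N_def \<beta>_def by simp
    then have "real N * (4096 + 18 * real n0) < real r ^ (n - 1)" by (subst (asm) pos_less_divide_eq) auto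
    then have "real (N * (4096 + 18 * n0)) \<le> real (r ^ (n - 1))" by simp
    then have lt: "N * (4096 + 18 * n0) \<le> r ^ (n - 1)" by (simp only: of_nat_le_iff)
    \<comment> \<open>The argument for large n needs a nonempty interval, so N = 0 is left to
      \<open>small_n\<close> together with the small n.\<close>
    have "good_colouring n r N"
    proof (cases "n \<ge> n0 \<and> N \<ge> 1")
      case True
      have "4096 * N \<le> N * (4096 + 18 * n0)" by (simp add: algebra_simps)
      then have "4096 * N \<le> r ^ (n - 1)" using lt by linarith
      moreover have "admissible n" using n0 True by blast
      ultimately show ?thesis using large_n[of n r N "rounds n"] True r unfolding admissible_def by simp
    next
      case False
      have "18 * n * N \<le> N * (4096 + 18 * n0)"
      proof (cases "N = 0")
        case False
        then have "n \<le> n0" using \<open>\<not> (n \<ge> n0 \<and> N \<ge> 1)\<close> by linarith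
        then have "N * (18 * n) \<le> N * (4096 + 18 * n0)" by (intro mult_left_mono) auto
        then show ?thesis by (simp add: mult_ac)
      qed simp
      then have "18 * n * N \<le> r ^ (n - 1)" using lt by linarith
      then show ?thesis using small_n[of n r N] n r by simp
    qed
    then have "\<not> vdW_property n r N" by (simp add: good_colouring_iff)
    moreover have "vdW_property n r N"
      unfolding N_def vdW_number_def using vdW_property_exists[of n r] n by (auto intro: LeastI_ex)
    ultimately show False by blast
  qed
  then show ?thesis using \<beta> by blast
qed

end
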